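(* Let $S=k[x_1,\dots,x_n]$ be a polynomial ring over a field $k$ and let $M\subset S$ be a generic monomial ideal. If $M$ has no embedded associated primes, then $M$ is Cohen-Macaulay (i.e. $S/M$ is Cohen-Macaulay). In this case, both the Scarf complex $\Delta_M$ and the Stanley-Reisner complex $V(M)$ are shellable.
   Context: For a monomial $\mathbf{x}^{\mathbf a}=x_1^{a_1}\cdots x_n^{a_n}$ put $\operatorname{supp}(\mathbf{x}^{\mathbf a})=\{s: a_s\neq 0\}$. Let $m_1,\dots,m_r$ be the minimal monomial generators of $M$; for $\sigma\subseteq\{1,\dots,r\}$ let $m_\sigma=\operatorname{lcm}(m_i:i\in\sigma)$, with $m_\emptyset=1$. Generic: $M$ is called generic if for any two distinct minimal generators $m_i,m_j$ which have the same positive degree in some variable $x_s$ there exists a third minimal generator $m_l$ of $M$ which divides $m_{\{i,j\}}$ and satisfies $\operatorname{supp}(m_{\{i,j\}}/m_l)=\operatorname{supp}(m_{\{i,j\}})$. Scarf complex: $\Delta_M=\{\sigma\subseteq\{1,\dots,r\}: m_\tau\ne m_\sigma\text{ for all }\tau\subseteq\{1,\dots,r\}\text{ with }\tau\neq\sigma\}$. Stanley-Reisner complex: $V(M)$ is the simplicial complex of the square-free monomial ideal $\operatorname{rad}(M)$; it consists of all subsets of $\{x_1,\dots,x_n\}$ which are not support sets of monomials in $M$. Shellable is meant in the usual sense for (pure) simplicial complexes. *)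

theory Defs
  imports
    "HOL-Library.Poly_Mapping"
    "HOL-Library.Extended_Nat"
    "HOL-Algebra.QuotRing"
    "HOL-Algebra.Ring_Divisibility"
begin

section \<open>Commutative algebra over HOL-Algebra rings\<close>

definition assoc_primes :: "('a, 'b) ring_scheme \<Rightarrow> 'a set \<Rightarrow> 'a set set" where
  \<comment> \<open>\<open>Ass(R/I)\<close>: the prime ideals of the form \<open>I : f\<close>, i.e. annihilators of elements of \<open>R/I\<close>\<close>
  "assoc_primes R I =
     {P. primeideal P R \<and> (\<exists>f\<in>carrier R. P = {a \<in> carrier R. a \<otimes>\<^bsub>R\<^esub> f \<in> I})}"

definition embedded_primes :: "('a, 'b) ring_scheme \<Rightarrow> 'a set \<Rightarrow> 'a set set" where
  "embedded_primes R I = {P \<in> assoc_primes R I. \<exists>Q\<in>assoc_primes R I. Q \<subset> P}"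

definition regular_sequence :: "('a, 'b) ring_scheme \<Rightarrow> 'a list \<Rightarrow> bool" where
  \<comment> \<open>each \<open>xs ! i\<close> is a nonzerodivisor on \<open>R/(xs ! 0, \<dots>, xs ! (i - 1))\<close>, and \<open>R/(xs)\<close> is nonzero\<close>
  "regular_sequence R xs \<longleftrightarrow>
     set xs \<subseteq> carrier R \<and>
     (\<forall>i<length xs. \<forall>a\<in>carrier R.
        xs ! i \<otimes>\<^bsub>R\<^esub> a \<in> Idl\<^bsub>R\<^esub> (set (take i xs)) \<longrightarrow> a \<in> Idl\<^bsub>R\<^esub> (set (take i xs))) \<and>
     Idl\<^bsub>R\<^esub> (set xs) \<noteq> carrier R"

definition ideal_depth :: "('a, 'b) ring_scheme \<Rightarrow> 'a set \<Rightarrow> enat" where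
  "ideal_depth R I = (SUP xs \<in> {xs. regular_sequence R xs \<and> set xs \<subseteq> I}. enat (length xs))"

definition prime_height :: "('a, 'b) ring_scheme \<Rightarrow> 'a set \<Rightarrow> enat" where
  \<comment> \<open>lengths \<open>h\<close> of strict chains \<open>P\<^sub>0 \<subset> \<dots> \<subset> P\<^sub>h = P\<close> of primes; the list holds \<open>P\<^sub>0, \<dots>, P\<^sub>h\<^sub>-\<^sub>1\<close>\<close>
  "prime_height R P =
     (SUP Ps \<in> {Ps. (\<forall>Q\<in>set Ps. primeideal Q R) \<and> sorted_wrt (\<subset>) (Ps @ [P])}. enat (length Ps))"

text \<open>
  The definition for Noetherian rings that are not necessarily local, as in Eisenbud's
  Commutative Algebra, Section 18.2: the depth of each maximal ideal \<open>P\<close> equals its codimension,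
  that is, \<open>depth(P, R) = dim R\<^sub>P\<close>. The zero ring is Cohen-Macaulay.
\<close>

definition cohen_macaulay :: "('a, 'b) ring_scheme \<Rightarrow> bool" where
  "cohen_macaulay R \<longleftrightarrow>
     cring R \<and> noetherian_ring R \<and>
     (\<forall>P. maximalideal P R \<longrightarrow> ideal_depth R P = prime_height R P)"

section \<open>Simplicial complexes\<close>

text \<open>The complex without any faces is allowed, and a singleton need not be a face.\<close>

definition simplicial_complex :: "'a set set \<Rightarrow> bool" where
  "simplicial_complex \<Delta> \<longleftrightarrow> finite \<Delta> \<and> (\<forall>F\<in>\<Delta>. finite F \<and> (\<forall>G. G \<subseteq> F \<longrightarrow> G \<in> \<Delta>))"

definition facets :: "'a set set \<Rightarrow> 'a set set" where
  "facets \<Delta> = {F \<in> \<Delta>. \<forall>G\<in>\<Delta>. F \<subseteq> G \<longrightarrow> G = F}"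

definition pure_complex :: "'a set set \<Rightarrow> bool" where
  "pure_complex \<Delta> \<longleftrightarrow> (\<forall>F\<in>facets \<Delta>. \<forall>G\<in>facets \<Delta>. card F = card G)"

definition shellable :: "'a set set \<Rightarrow> bool" where
  \<comment> \<open>the last condition: each new facet \<open>Fs ! j\<close> meets the union of the earlier ones in a subcomplex
     that is pure of codimension one in \<open>Fs ! j\<close>\<close>
  "shellable \<Delta> \<longleftrightarrow>
     simplicial_complex \<Delta> \<and> pure_complex \<Delta> \<and>
     (\<exists>Fs. distinct Fs \<and> set Fs = facets \<Delta> \<and>
        (\<forall>j. 0 < j \<and> j < length Fs \<longrightarrow>
           (\<forall>G \<in> facets (Pow (Fs ! j) \<inter> (\<Union>i<j. Pow (Fs ! i))). card G + 1 = card (Fs ! j))))"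

section \<open>Monomial ideals\<close>

text \<open>
  The variables are indexed by a finite type \<open>'v\<close>, so \<open>n = CARD('v)\<close>; an exponent vector
  is a term of type \<open>'v \<Rightarrow>\<^sub>0 nat\<close>, and multiplication of polynomials is the convolution product.
\<close>

type_synonym ('v, 'k) mpoly = "('v \<Rightarrow>\<^sub>0 nat) \<Rightarrow>\<^sub>0 'k"

definition poly_ring :: "('v, 'k::field) mpoly ring" where
  "poly_ring = \<lparr>carrier = UNIV, mult = (*), one = 1, zero = 0, add = (+)\<rparr>"

definition xmon :: "('v \<Rightarrow>\<^sub>0 nat) \<Rightarrow> ('v, 'k::field) mpoly" where
  "xmon a = Poly_Mapping.single a 1"

definition monomial_ideal :: "('v, 'k::field) mpoly set \<Rightarrow> bool" where
  "monomial_ideal M \<longleftrightarrow> (\<exists>A. M = Idl\<^bsub>poly_ring\<^esub> (xmon ` A))"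

text \<open>
  Monomials are represented by their exponent vectors. In particular \<open>supp\<close> is \<open>keys\<close>, the quotient
  of a monomial by a divisor is the difference of exponents, and \<open>m\<^sub>\<sigma>\<close> is indexed directly by the
  set \<open>\<sigma>\<close> of generators rather than by the set of their labels \<open>1, \<dots>, r\<close>.
\<close>

definition min_gens :: "('v, 'k::field) mpoly set \<Rightarrow> ('v \<Rightarrow>\<^sub>0 nat) set" where
  "min_gens M =
     {a. xmon a \<in> M \<and> (\<forall>b. xmon b \<in> M \<and> (xmon b :: ('v, 'k) mpoly) dvd xmon a \<longrightarrow> b = a)}"

definition mon_lcm :: "('v::finite \<Rightarrow>\<^sub>0 nat) set \<Rightarrow> ('v \<Rightarrow>\<^sub>0 nat)" where
  \<comment> \<open>meaningful for finite \<open>\<sigma>\<close> only; the empty set gives exponent 0, i.e. the monomial 1\<close>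
  "mon_lcm \<sigma> =
     Abs_poly_mapping (\<lambda>s. Max (insert 0 ((\<lambda>a. Poly_Mapping.lookup a s) ` \<sigma>)))"

definition generic :: "('v::finite, 'k::field) mpoly set \<Rightarrow> bool" where
  "generic M \<longleftrightarrow>
     (\<forall>a\<in>min_gens M. \<forall>b\<in>min_gens M.
        a \<noteq> b \<and>
        (\<exists>s. Poly_Mapping.lookup a s = Poly_Mapping.lookup b s \<and> 0 < Poly_Mapping.lookup a s) \<longrightarrow>
        (\<exists>c\<in>min_gens M. c \<noteq> a \<and> c \<noteq> b \<and>
           (xmon c :: ('v, 'k) mpoly) dvd xmon (mon_lcm {a, b}) \<and>
           Poly_Mapping.keys (mon_lcm {a, b} - c) = Poly_Mapping.keys (mon_lcm {a, b})))"

definition scarf_complex :: "('v::finite, 'k::field) mpoly set \<Rightarrow> ('v \<Rightarrow>\<^sub>0 nat) set set" where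
  "scarf_complex M =
     {\<sigma>. \<sigma> \<subseteq> min_gens M \<and> (\<forall>\<tau>. \<tau> \<subseteq> min_gens M \<and> \<tau> \<noteq> \<sigma> \<longrightarrow> mon_lcm \<tau> \<noteq> mon_lcm \<sigma>)}"

definition stanley_reisner_complex :: "('v, 'k::field) mpoly set \<Rightarrow> 'v set set" where
  "stanley_reisner_complex M = {F. \<not> (\<exists>a. xmon a \<in> M \<and> Poly_Mapping.keys a = F)}"

end

theory Submission
  imports Defs "HOL-Analysis.Cartesian_Space"
begin

text \<open>
  Write \<open>D\<close> for a bound on the exponents of the minimal generators and add the powers \<open>x\<^sub>s^D\<close> to them.
  A corner of the resulting staircase is a vector \<open>u\<close> such that no generator lies strictly below
  \<open>u\<close>, but every coordinate is attained by some generator that is otherwise strictly below \<open>u\<close>; its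
  generators are those below \<open>u\<close>, one for each variable. Genericity makes the corners the facets of a
  regular triangulation: for a large base \<open>t\<close> the equations \<open>\<Sum>\<^sub>j y\<^sub>j t^(a\<^sub>j) = 1\<close> over the generators
  \<open>a\<close> of a corner have a unique solution, the solutions are the vertices of a simple polyhedron, and
  sorting them by a linear functional is a shelling. The functional with coefficients
  \<open>t^(b\<^sub>j + 1/2)\<close> separates the corners strictly above \<open>b\<close> from the others, so these
  are shelled as well.

  Each corner \<open>u\<close> gives the associated prime generated by the variables with \<open>u\<^sub>s < D\<close>. Neighbouring
  corners have primes of the same height or comparable ones, so without embedded primes all
  corners consist of equally many true generators. Then the restrictions of the shelling to the true
  generators and to the powers \<open>x\<^sub>s^D\<close> are shellings of \<open>\<Delta>\<^sub>M\<close> and \<open>V(M)\<close>.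

  Let \<open>P\<close> be a maximal ideal containing \<open>M\<close> and \<open>d\<close> the common dimension. By Zariski's lemma \<open>P\<close>
  contains a monic polynomial \<open>z\<^sub>s\<close> in \<open>x\<^sub>s\<close> for every \<open>s\<close>, which may be multiplied by \<open>x\<^sub>s^D\<close>. Over
  \<open>k[z]\<close> the module \<open>S/M\<close> is a direct sum of Stanley-Reisner rings of complexes \<open>{u > b}\<close>, all
  shelled of dimension \<open>d\<close>, and on these the elementary symmetric polynomials \<open>e\<^sub>d, \<dots>, e\<^sub>1\<close> of the
  \<open>z\<^sub>s\<close> form a regular sequence. Hence the depth is at least \<open>d\<close>. A regular sequence in \<open>P\<close> yields a
  chain of primes of the same length, and a chain of primes over \<open>M\<close> of length \<open>h\<close> has \<open>h \<le> d\<close>, because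
  elements \<open>y\<^sub>i \<in> P\<^sub>i\<^sub>+\<^sub>1 - P\<^sub>i\<close> are algebraically independent.
\<close>

text \<open>The Cohen-Macaulay property is tested at every maximal ideal \<open>P\<close>, over an
  arbitrary field. So the homogeneous maximal ideal does not suffice, \<open>P\<close> need not be a
  point with coordinates in k, and general linear forms may not exist. The elements
  \<open>z_s\<close> treat all \<open>P\<close> alike, and elementary symmetric polynomials are
  parameters even over finite fields. The factor x_s^D makes every term of \<open>z_s\<close> look
  to \<open>M\<close> like its leading term x_s^N, so membership in \<open>M\<close> is read off
  from leading exponents and S/M splits over k[z] as if \<open>z_s\<close> were x_s^N. The
  remainders of exponents modulo N produce the vectors b: this is why the corners above every b must
  be shelled, and not only all of them. A shelling need not survive restriction to some of the
  vertices. Here it does because each corner has the same number of true generators, and the absence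
  of embedded primes enters the proof only through this count.\<close>

section \<open>Shelling the corners of a generic staircase\<close>

text \<open>The facet that is added last comes first in the list.\<close>

fun shelled :: "'a set list \<Rightarrow> bool" where
  "shelled [] \<longleftrightarrow> True"
| "shelled (L # Ls) \<longleftrightarrow> (\<forall>K\<in>set Ls. \<exists>v\<in>L - K. \<exists>K'\<in>set Ls. L - {v} \<subseteq> K') \<and> shelled Ls"

text \<open>The greatest element of \<open>U\<close> is added last. The witness \<open>w'\<close> of
  the last assumption is itself below \<open>u\<close>, so it is never the removed element and the
  assumptions pass to the smaller set.\<close>

lemma shelled_of_order:
  fixes f :: "'u \<Rightarrow> 'a set" and less :: "'u \<Rightarrow> 'u \<Rightarrow> bool"
  assumes "finite U"
    and tr: "\<And>u v w. less u v \<Longrightarrow> less v w \<Longrightarrow> less u w"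
    and irr: "\<And>u. \<not> less u u"
    and "\<And>u v. u \<in> U \<Longrightarrow> v \<in> U \<Longrightarrow> u \<noteq> v \<Longrightarrow> less u v \<or> less v u"
    and "\<And>u w. u \<in> U \<Longrightarrow> w \<in> U \<Longrightarrow> less w u \<Longrightarrow>
           \<exists>v\<in>f u - f w. \<exists>w'\<in>U. less w' u \<and> f u - {v} \<subseteq> f w'"
  shows "\<exists>Ls. set Ls = f ` U \<and> shelled Ls"
  using assms(1,4,5)
proof (induction U rule: finite_psubset_induct)
  case (psubset U)
  show ?case
  proof (cases "U = {}")
    case True
    then show ?thesis by (intro exI[of _ "[]"]) auto
  next
    case False
    have "asymp_on U less" "transp_on U less"
      using tr irr by (auto intro!: asymp_onI transp_onI)
    from Finite_Set.bex_max_element[OF psubset.hyps(1) this False]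
    obtain m where m: "m \<in> U" "\<And>x. x \<in> U \<Longrightarrow> \<not> less m x"
      by (metis irr)
    let ?U = "U - {m}"
    have step: "\<exists>v\<in>f u - f w. \<exists>w'\<in>?U. less w' u \<and> f u - {v} \<subseteq> f w'"
      if "u \<in> U" "w \<in> U" "less w u" for u w
      using psubset.prems(2)[OF that] m that by blast
    have "\<exists>Ls. set Ls = f ` ?U \<and> shelled Ls"
      by (rule psubset.IH) (use m psubset.prems(1) step in auto)
    then obtain Ls where Ls: "set Ls = f ` ?U" "shelled Ls" by blast
    have "shelled (f m # Ls)"
    proof (simp add: Ls, intro ballI)
      fix w assume w: "w \<in> ?U"
      then have "less w m" using psubset.prems(1)[of w m] m by auto
      from step[OF m(1) _ this] w
      show "\<exists>v\<in>f m - f w. \<exists>x\<in>?U. f m - {v} \<subseteq> f x" by blast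
    qed
    moreover have "set (f m # Ls) = f ` U" using Ls m by auto
    ultimately show ?thesis by blast
  qed
qed

text \<open>Restricts a shelling to a class of vertices. Traces that repeat an earlier one are
  dropped; the constant size \<open>d\<close> ensures that the vertex removed from a new trace
  belongs to the class.\<close>

lemma shelled_vimage:
  fixes f :: "'b \<Rightarrow> 'a"
  assumes inj: "inj f"
    and "shelled Ls" and "\<And>L. L \<in> set Ls \<Longrightarrow> finite (f -` L) \<and> card (f -` L) = d"
  shows "\<exists>Fs. set Fs = (\<lambda>L. f -` L) ` set Ls \<and> shelled Fs"
  using assms(2-)
proof (induction Ls)
  case Nil
  then show ?case by (intro exI[of _ "[]"]) auto
next
  case (Cons L Ls)
  from Cons obtain Fs where Fs: "set Fs = (\<lambda>L. f -` L) ` set Ls" "shelled Fs" by auto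
  show ?case
  proof (cases "f -` L \<in> set Fs")
    case True
    then show ?thesis using Fs by (intro exI[of _ Fs]) auto
  next
    case False
    have "\<exists>v\<in>f -` L - f -` K. \<exists>K'\<in>set Fs. f -` L - {v} \<subseteq> K'" if K: "K \<in> set Ls" for K
    proof -
      obtain v K' where v: "v \<in> L" "v \<notin> K" and K': "K' \<in> set Ls" "L - {v} \<subseteq> K'"
        using Cons.prems(1) K by auto
      \<comment> \<open>Otherwise the trace of \<open>L\<close> would be contained in that of
        \<open>K'\<close>, hence equal to it by size, although it is new.\<close>
      have "v \<in> range f"
      proof (rule ccontr)
        assume "v \<notin> range f"
        then have "f -` L \<subseteq> f -` K'" using K' by auto
        then have "f -` L = f -` K'"
          using Cons.prems(2)[of L] Cons.prems(2)[of K'] K' by (intro card_subset_eq) auto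
        then show False using False K' Fs by auto
      qed
      then obtain x where "v = f x" by auto
      moreover have "f -` L - {x} \<subseteq> f -` K'" if "v = f x"
      proof
        fix y assume y: "y \<in> f -` L - {x}"
        show "y \<in> f -` K'"
        proof (rule ccontr)
          assume "y \<notin> f -` K'"
          then have "f y = v" using y K'(2) by auto
          then show False using y that inj by (auto dest: injD)
        qed
      qed
      ultimately show ?thesis using v K' Fs(1) by (intro bexI[of _ x] bexI[of _ "f -` K'"]) auto
    qed
    then have "shelled (f -` L # Fs)" using Fs by auto
    then show ?thesis using Fs by (intro exI[of _ "f -` L # Fs"]) auto
  qed
qed

section \<open>Diagonally dominant systems and lexicographic functionals\<close>

definition dot :: "('v::finite \<Rightarrow> real) \<Rightarrow> ('v \<Rightarrow> real) \<Rightarrow> real" where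
  "dot c y = (\<Sum>j\<in>UNIV. c j * y j)"

lemma dot_diff: "dot c (\<lambda>j. x j - y j) = dot c x - dot c y"
  by (simp add: dot_def right_diff_distrib sum_subtractf)

lemma dot_add: "dot c (\<lambda>j. x j + y j) = dot c x + dot c y"
  by (simp add: dot_def distrib_left sum.distrib)

lemma dot_scale: "dot c (\<lambda>j. k * x j) = k * dot c x"
  by (simp add: dot_def sum_distrib_left algebra_simps)

lemma dot_sum: "dot c (\<lambda>j. \<Sum>s\<in>A. w s * d s j) = (\<Sum>s\<in>A. w s * dot c (d s))"
  by (simp add: dot_def sum_distrib_left sum.swap[of _ _ A] algebra_simps)

lemma near_identity_bound:
  fixes m :: "'v::finite \<Rightarrow> 'v \<Rightarrow> real"
  assumes "\<And>s. m s s = 1" and "\<And>s j. j \<noteq> s \<Longrightarrow> \<bar>m s j\<bar> \<le> e"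
    and z: "\<And>j. \<bar>z j\<bar> \<le> Z" and "0 \<le> e" "0 \<le> Z"
  shows "\<bar>dot (m s) z - z s\<bar> \<le> real CARD('v) * e * Z"
proof -
  have "dot (m s) z - z s = (\<Sum>j\<in>UNIV - {s}. m s j * z j)"
    by (simp add: dot_def sum.remove[of UNIV s] assms(1))
  also have "\<bar>\<dots>\<bar> \<le> (\<Sum>j\<in>UNIV - {s}. e * Z)"
    by (intro order.trans[OF sum_abs] sum_mono) (auto simp: abs_mult intro!: mult_mono assms)
  also have "\<dots> = real (CARD('v) - 1) * (e * Z)" by (simp add: card_Diff_singleton)
  also have "\<dots> \<le> real CARD('v) * (e * Z)"
    using assms(4,5) by (intro mult_right_mono) auto
  finally show ?thesis by (simp add: mult.assoc)
qed

lemma max_abs_attained: "\<exists>s. \<forall>j. \<bar>z j\<bar> \<le> \<bar>z s\<bar>" for z :: "'v::finite \<Rightarrow> real"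
proof -
  have "Max (range (\<lambda>j. \<bar>z j\<bar>)) \<in> range (\<lambda>j. \<bar>z j\<bar>)" by (intro Max_in) auto
  then obtain s where "\<bar>z s\<bar> = Max (range (\<lambda>j. \<bar>z j\<bar>))" by (metis rangeE)
  then have "\<bar>z j\<bar> \<le> \<bar>z s\<bar>" for j by (auto intro!: Max_ge)
  then show ?thesis by blast
qed

text \<open>Diagonal dominance: at a coordinate of largest absolute value the off-diagonal terms
  cannot cancel the diagonal one.\<close>

lemma near_identity_inj:
  fixes m :: "'v::finite \<Rightarrow> 'v \<Rightarrow> real"
  assumes m: "\<And>s. m s s = 1" "\<And>s j. j \<noteq> s \<Longrightarrow> \<bar>m s j\<bar> \<le> e"
    and e: "0 \<le> e" "real CARD('v) * e < 1" and z: "\<And>s. dot (m s) z = 0"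
  shows "z s = 0"
proof -
  obtain s0 where s0: "\<And>j. \<bar>z j\<bar> \<le> \<bar>z s0\<bar>"
    using max_abs_attained[of z] by blast
  have "\<bar>z s0\<bar> \<le> real CARD('v) * e * \<bar>z s0\<bar>"
    using near_identity_bound[of m e z "\<bar>z s0\<bar>" s0] m e z s0 by auto
  then have "(1 - real CARD('v) * e) * \<bar>z s0\<bar> \<le> 0" by (simp add: algebra_simps)
  then have "\<bar>z s0\<bar> \<le> 0" using e(2) by (simp add: mult_le_0_iff)
  then show ?thesis using s0[of s] by auto
qed

lemma near_identity_solve:
  fixes m :: "'v::finite \<Rightarrow> 'v \<Rightarrow> real"
  assumes m: "\<And>s. m s s = 1" "\<And>s j. j \<noteq> s \<Longrightarrow> \<bar>m s j\<bar> \<le> e"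
    and e: "0 \<le> e" "real CARD('v) * e < 1"
  shows "\<exists>z. \<forall>s. dot (m s) z = b s"
proof -
  define h where "h = (\<lambda>z :: real ^ 'v. \<chi> s. dot (m s) (\<lambda>j. z $ j))"
  have lin: "linear h"
    by (rule linearI)
      (auto simp: h_def vec_eq_iff dot_def algebra_simps sum.distrib sum_distrib_left)
  have "inj h"
    unfolding linear_injective_0[OF lin]
  proof (intro allI impI)
    fix z assume "h z = 0"
    then have "dot (m s) (\<lambda>j. z $ j) = 0" for s by (simp add: h_def vec_eq_iff)
    from near_identity_inj[OF m e this] show "z = 0" by (simp add: vec_eq_iff)
  qed
  then have "surj h" using lin linear_injective_imp_surjective by blast
  then obtain z where "h z = (\<chi> s. b s)" by (metis surjD)
  then show ?thesis by (intro exI[of _ "\<lambda>j. z $ j"]) (simp add: h_def vec_eq_iff)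
qed

text \<open>
  Comparing vectors lexicographically by a list of functionals replaces a functional in general
  position: there are no ties, and it still respects nonnegative combinations.
\<close>

fun lexneg :: "('v::finite \<Rightarrow> real) list \<Rightarrow> ('v \<Rightarrow> real) \<Rightarrow> bool" where
  "lexneg [] y \<longleftrightarrow> False"
| "lexneg (c # cs) y \<longleftrightarrow> dot c y < 0 \<or> dot c y = 0 \<and> lexneg cs y"

lemma lexneg_add: "lexneg cs x \<Longrightarrow> lexneg cs y \<Longrightarrow> lexneg cs (\<lambda>j. x j + y j)"
  by (induction cs) (auto simp: dot_add)

lemma lexneg_scale: "lexneg cs x \<Longrightarrow> 0 < k \<Longrightarrow> lexneg cs (\<lambda>j. k * x j)"
  by (induction cs) (auto simp: dot_scale mult_less_0_iff)

lemma lexneg_total: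
  "lexneg cs (\<lambda>j. x j - y j) \<or> lexneg cs (\<lambda>j. y j - x j) \<or> (\<forall>c\<in>set cs. dot c x = dot c y)"
  by (induction cs) (auto simp: dot_diff)

lemma lexneg_not_nonneg: "(\<And>c. c \<in> set cs \<Longrightarrow> 0 \<le> dot c x) \<Longrightarrow> \<not> lexneg cs x"
  by (induction cs) force+

text \<open>The local step of the simplex method: if a nonnegative combination of edges
  \<open>d s\<close> descends, so does some edge that occurs in it. If the first functional is
  negative on no such edge and the sum gives 0, all its weighted values vanish and the later
  functionals decide.\<close>

lemma lexneg_sum:
  assumes "finite A" "\<And>s. s \<in> A \<Longrightarrow> 0 \<le> w s" "lexneg cs (\<lambda>j. \<Sum>s\<in>A. w s * d s j)"
  shows "\<exists>s\<in>A. 0 < w s \<and> lexneg cs (d s)"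
  using assms(3)
proof (induction cs)
  case (Cons c cs)
  show ?case
  proof (rule ccontr)
    assume neg: "\<not> ?thesis"
    have nn: "0 \<le> w s * dot c (d s)" if "s \<in> A" for s
    proof (cases "w s = 0")
      case False
      then have "\<not> dot c (d s) < 0" using assms(2)[OF that] neg that by (auto simp: less_le)
      then show ?thesis using assms(2)[OF that] by auto
    qed auto
    then have "0 \<le> (\<Sum>s\<in>A. w s * dot c (d s))" by (simp add: sum_nonneg)
    with Cons.prems have eq: "(\<Sum>s\<in>A. w s * dot c (d s)) = 0"
      and "lexneg cs (\<lambda>j. \<Sum>s\<in>A. w s * d s j)" by (auto simp: dot_sum)
    from Cons.IH[OF this(2)] obtain s where s: "s \<in> A" "0 < w s" "lexneg cs (d s)" by auto
    moreover have "w s * dot c (d s) = 0"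
      using sum_nonneg_0[OF assms(1) nn eq s(1)] .
    ultimately show False using neg by auto
  qed
qed auto

section \<open>Corners of a staircase and the passage through a ridge\<close>

text \<open>
  The generators are indexed by a type \<open>'g\<close>, so that the powers \<open>x\<^sub>s^D\<close> added to the minimal
  generators form a separate class of indices.
\<close>

locale staircase =
  fixes G :: "'g set" and deg :: "'g \<Rightarrow> 'v::finite \<Rightarrow> nat"
  assumes fin: "finite G"
    and gen: "\<lbrakk>a \<in> G; b \<in> G; a \<noteq> b; deg a s = deg b s; 0 < deg a s\<rbrakk> \<Longrightarrow>
      \<exists>c\<in>G. \<forall>j. deg c j < max (deg a j) (deg b j) \<or> deg c j = 0"
    and art: "\<exists>a\<in>G. \<forall>j. j \<noteq> s \<longrightarrow> deg a j = 0"
begin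

definition corner :: "('v \<Rightarrow> nat) \<Rightarrow> bool" where
  "corner u \<longleftrightarrow> (\<forall>a\<in>G. \<exists>j. u j \<le> deg a j) \<and>
     (\<forall>s. 0 < u s \<and> (\<exists>a\<in>G. deg a s = u s \<and> (\<forall>j. j \<noteq> s \<longrightarrow> deg a j < u j)))"

definition face :: "('v \<Rightarrow> nat) \<Rightarrow> 'g set" where
  "face u = {a \<in> G. \<forall>j. deg a j \<le> u j}"

text \<open>The generator supplied by genericity would lie strictly below \<open>u\<close>: wherever
  it is not below the maximum of the two degrees it is 0, and \<open>u\<close> is positive.\<close>

lemma no_tie:
  assumes "\<And>a. a \<in> G \<Longrightarrow> \<exists>j. u j \<le> deg a j" "\<And>j. 0 < u j"
    and "a \<in> face u" "b \<in> face u" "deg a s = deg b s" "0 < deg a s"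
  shows "a = b"
proof (rule ccontr)
  assume "a \<noteq> b"
  then obtain c where c: "c \<in> G" "\<And>j. deg c j < max (deg a j) (deg b j) \<or> deg c j = 0"
    using gen[of a b s] assms by (auto simp: face_def)
  have "deg c j < u j" for j
  proof -
    have "deg a j \<le> u j" "deg b j \<le> u j" using assms(3,4) by (auto simp: face_def)
    then show ?thesis using c(2)[of j] assms(2)[of j] by auto
  qed
  then show False using assms(1)[OF c(1)] by (metis leD)
qed

text \<open>For a corner the choice is forced (\<open>champ_unique\<close>), and
  \<open>champ u\<close> numbers the generators of the face by the variables.\<close>

definition champ :: "('v \<Rightarrow> nat) \<Rightarrow> 'v \<Rightarrow> 'g" where
  "champ u s = (SOME a. a \<in> G \<and> deg a s = u s \<and> (\<forall>j. j \<noteq> s \<longrightarrow> deg a j < u j))"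

context
  fixes u assumes u: "corner u"
begin

lemma corner_pos: "0 < u s" and corner_hit: "a \<in> G \<Longrightarrow> \<exists>j. u j \<le> deg a j"
  using u by (auto simp: corner_def)

lemma champ: "champ u s \<in> G" "deg (champ u s) s = u s" "j \<noteq> s \<Longrightarrow> deg (champ u s) j < u j"
proof -
  have "\<exists>a. a \<in> G \<and> deg a s = u s \<and> (\<forall>j. j \<noteq> s \<longrightarrow> deg a j < u j)"
    using u by (auto simp: corner_def)
  from someI_ex[OF this]
  show "champ u s \<in> G" "deg (champ u s) s = u s" "j \<noteq> s \<Longrightarrow> deg (champ u s) j < u j"
    by (auto simp: champ_def)
qed

lemma champ_face: "champ u s \<in> face u"
  using champ(1,2)[of s] champ(3)[of _ s] by (auto simp: face_def) (metis le_less)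

lemma champ_unique: "a \<in> face u \<Longrightarrow> deg a s = u s \<Longrightarrow> a = champ u s"
  using no_tie[of u a "champ u s" s] corner_pos corner_hit champ champ_face by auto

lemma face_eq: "face u = range (champ u)"
proof
  show "face u \<subseteq> range (champ u)"
  proof
    fix a assume a: "a \<in> face u"
    then obtain j where "u j \<le> deg a j" using corner_hit by (auto simp: face_def)
    then have "deg a j = u j" using a by (auto simp: face_def intro: antisym)
    from champ_unique[OF a this] show "a \<in> range (champ u)" by auto
  qed
qed (use champ_face in auto)

lemma inj_champ: "inj (champ u)"
proof (rule injI, rule ccontr)
  fix s t assume *: "champ u s = champ u t" "s \<noteq> t"
  then show False using champ(2)[of t] champ(3)[of t s] by auto
qed

lemma finite_face: "finite (face u)" and card_face: "card (face u) = CARD('v)"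
  using inj_champ by (auto simp: face_eq card_image)

text \<open>The exchange across the ridge opposite to \<open>champ u s\<close>: coordinate
  \<open>s\<close> is lowered to the largest degree that another generator of the face has in it.
  That generator releases its own coordinate \<open>t\<close>, which is raised until a new generator
  blocks it. If all the others have degree 0 in \<open>s\<close>, the ridge lies on the
  boundary.\<close>

lemma ridge_neighbour:
  assumes t: "t \<noteq> s" "0 < deg (champ u t) s"
  shows "\<exists>w. corner w \<and> face u - {champ u s} \<subseteq> face w \<and> w \<noteq> u"
proof -
  obtain t where ts: "t \<noteq> s" "0 < deg (champ u t) s"
      and tmax: "\<And>j. j \<noteq> s \<Longrightarrow> deg (champ u j) s \<le> deg (champ u t) s"
  proof -
    let ?D = "(\<lambda>j. deg (champ u j) s) ` (UNIV - {s})"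
    have "Max ?D \<in> ?D" using t(1) by (intro Max_in) auto
    then obtain t' where t': "t' \<noteq> s" "deg (champ u t') s = Max ?D"
      by (elim imageE) (metis DiffD2 insertI1)
    have "deg (champ u j) s \<le> Max ?D" if "j \<noteq> s" for j using that by (intro Max_ge) auto
    then show thesis using t t' that[of t'] by (metis less_le_trans)
  qed
  define e where "e = deg (champ u t) s"
  have e: "0 < e" "e < u s" using ts champ(3)[of s t] by (auto simp: e_def)
  \<comment> \<open>Only \<open>champ u t\<close> attains \<open>e\<close>, so it can take over
    coordinate \<open>s\<close> at the new corner.\<close>
  have tie: "j = t" if "j \<noteq> s" "deg (champ u j) s = e" for j
    using no_tie[of u "champ u j" "champ u t" s] that ts corner_pos corner_hit champ_face
      inj_champ by (auto simp: e_def dest: injD)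
  define v where "v = u(s := e)"
  \<comment> \<open>The generators that can block the growth of coordinate \<open>t\<close>; the one
    of least degree in \<open>t\<close> stops it.\<close>
  define B where "B = {a \<in> G. \<forall>j. j \<noteq> t \<longrightarrow> deg a j < v j}"
  have vpos: "0 < v j" for j using corner_pos e by (auto simp: v_def)
  have "B \<noteq> {}"
  proof -
    obtain a where "a \<in> G" "\<And>j. j \<noteq> t \<Longrightarrow> deg a j = 0" using art[of t] by auto
    then have "a \<in> B" using vpos by (simp add: B_def)
    then show ?thesis by auto
  qed
  moreover have finB: "finite B" using fin by (auto simp: B_def)
  ultimately have "Min ((\<lambda>a. deg a t) ` B) \<in> (\<lambda>a. deg a t) ` B" by (intro Min_in) auto
  then obtain a where a: "a \<in> B" "deg a t = Min ((\<lambda>a. deg a t) ` B)" by auto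
  have amin: "deg a t \<le> deg c t" if "c \<in> B" for c
    unfolding a(2) using that finB by (intro Min_le) auto
  have alt: "deg a j < u j" if "j \<noteq> t" for j
    using a(1) that e by (force simp: B_def v_def split: if_splits)
  have ae: "deg a s < e" using a(1) ts by (auto simp: B_def v_def)
  \<comment> \<open>Otherwise \<open>a\<close> would belong to the face and be
    \<open>champ u t\<close>, whose degree in \<open>s\<close> is \<open>e\<close> and not
    smaller.\<close>
  have agt: "u t < deg a t"
  proof (rule ccontr)
    assume "\<not> u t < deg a t"
    then have fa: "a \<in> face u" using alt a(1)
      by (auto simp: face_def B_def) (metis less_imp_le linorder_not_less)
    then obtain j where j: "u j \<le> deg a j" using corner_hit by (auto simp: face_def)
    then have "j = t" using alt[of j] by (metis leD)
    then have "deg a t = u t" using j fa by (auto simp: face_def intro: antisym)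
    from champ_unique[OF fa this] show False using ae e_def by auto
  qed
  define w where "w = v(t := deg a t)"
  have w: "w s = e" "w t = deg a t" "\<And>j. j \<noteq> s \<Longrightarrow> j \<noteq> t \<Longrightarrow> w j = u j"
    using ts by (auto simp: w_def v_def)
  have cs: "deg (champ u j) i < w i" if "j \<noteq> s" "j \<noteq> t" "i \<noteq> j" for i j
  proof -
    consider "i = s" | "i = t" | "i \<noteq> s" "i \<noteq> t" by blast
    then show ?thesis
    proof cases
      case 1
      have "deg (champ u j) s \<noteq> e" using tie[OF that(1)] that(2) by blast
      then show ?thesis using tmax[OF that(1)] w(1) 1 by (simp add: e_def)
    next
      case 2
      have "deg (champ u j) t < u t" by (rule champ(3)) (use that in simp)
      then show ?thesis using agt w(2) 2 by simp
    next
      case 3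
      have "deg (champ u j) i < u i" by (rule champ(3)) (use that in simp)
      then show ?thesis using w(3)[OF 3] by simp
    qed
  qed
  have ct: "deg (champ u t) i < w i" if "i \<noteq> s" for i
  proof (cases "i = t")
    case True
    then show ?thesis using champ(2)[of t] agt w(2) by simp
  next
    case False
    have "deg (champ u t) i < u i" by (rule champ(3)) (use False in simp)
    then show ?thesis using w(3)[OF that False] by simp
  qed
  have "corner w"
    unfolding corner_def
  proof (intro conjI ballI allI)
    fix c assume c: "c \<in> G"
    show "\<exists>j. w j \<le> deg c j"
    proof (rule ccontr)
      assume "\<not> ?thesis"
      then have lt: "deg c j < w j" for j by (simp add: not_le)
      have "c \<in> B" using c lt by (auto simp: B_def w_def) (metis fun_upd_apply lt w_def)
      then show False using amin[of c] lt[of t] w by auto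
    qed
  next
    fix j show "0 < w j" using vpos agt w corner_pos[of t] by (cases "j = t") (auto simp: w_def)
  next
    fix j
    consider "j = s" | "j = t" | "j \<noteq> s" "j \<noteq> t" by blast
    then show "\<exists>a\<in>G. deg a j = w j \<and> (\<forall>i. i \<noteq> j \<longrightarrow> deg a i < w i)"
    proof cases
      case 1
      then show ?thesis using champ(1)[of t] ct w
        by (intro bexI[of _ "champ u t"]) (auto simp: e_def)
    next
      case 2
      then show ?thesis using a(1) w by (intro bexI[of _ a]) (auto simp: B_def w_def)
    next
      case 3
      then show ?thesis using champ[of j] cs w by (intro bexI[of _ "champ u j"]) auto
    qed
  qed
  moreover have "face u - {champ u s} \<subseteq> face w"
  proof
    fix x assume "x \<in> face u - {champ u s}"
    then obtain j where j: "x = champ u j" "j \<noteq> s" by (auto simp: face_eq)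
    have "deg (champ u j) i \<le> w i" for i
    proof (cases "j = t")
      case True
      then show ?thesis using ct[of i] w by (cases "i = s") (auto simp: e_def)
    next
      case False
      then show ?thesis using cs[OF j(2) False, of i] w j champ(2)[of j] by (cases "i = j") auto
    qed
    then show "x \<in> face w" using j champ(1) by (auto simp: face_def)
  qed
  moreover have "w \<noteq> u" using w e by auto
  ultimately show ?thesis by blast
qed

end

text \<open>A corner is recovered from its face as the exponent of the lcm, and all faces have the
  same size.\<close>

lemma corner_eq: "corner u \<Longrightarrow> corner w \<Longrightarrow> face w \<subseteq> face u \<Longrightarrow> u = w"
proof -
  assume *: "corner u" "corner w" "face w \<subseteq> face u"
  then have eq: "face w = face u" by (intro card_subset_eq) (auto simp: card_face finite_face)
  have "u s \<le> w s" for s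
    using champ_face[OF *(1), of s, folded eq] champ(2)[OF *(1), of s]
    unfolding face_def by (metis (no_types, lifting) mem_Collect_eq)
  moreover have "w s \<le> u s" for s
    using champ_face[OF *(2), of s, unfolded eq] champ(2)[OF *(2), of s]
    unfolding face_def by (metis (no_types, lifting) mem_Collect_eq)
  ultimately show ?thesis by (intro ext antisym)
qed

lemma finite_corners: "finite {u. corner u}"
proof (rule finite_subset)
  show "{u. corner u} \<subseteq> Pi\<^sub>E UNIV (\<lambda>s. (\<lambda>a. deg a s) ` G)"
  proof (rule subsetI)
    fix u assume "u \<in> {u. corner u}"
    then have "u s \<in> (\<lambda>a. deg a s) ` G" for s
      using champ(1,2)[of u s] by (metis imageI mem_Collect_eq)
    then show "u \<in> Pi\<^sub>E UNIV (\<lambda>s. (\<lambda>a. deg a s) ` G)" by (auto simp: PiE_def)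
  qed
qed (use fin in \<open>auto intro!: finite_PiE\<close>)

text \<open>A maximal exponent \<open>b\<close> above \<open>w\<close> that no generator divides is
  a socle monomial of the artinian quotient, and adding 1 to all its coordinates gives a corner. The
  generators from \<open>art\<close> bound such exponents.\<close>

lemma corner_above:
  assumes w: "\<And>a. a \<in> G \<Longrightarrow> \<exists>j. w j < deg a j"
  shows "\<exists>u. corner u \<and> (\<forall>j. w j < u j)"
proof -
  define S where "S = {b. (\<forall>j. w j \<le> b j) \<and> (\<forall>a\<in>G. \<exists>j. b j < deg a j)}"
  have "S \<subseteq> Pi\<^sub>E UNIV (\<lambda>s. {..Max ((\<lambda>a. deg a s) ` G)})"
  proof
    fix b assume b: "b \<in> S"
    have "b s \<le> Max ((\<lambda>a. deg a s) ` G)" for s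
    proof -
      obtain a where a: "a \<in> G" "\<And>j. j \<noteq> s \<Longrightarrow> deg a j = 0" using art[of s] by auto
      then obtain j where "b j < deg a j" using b by (auto simp: S_def)
      then have "b s < deg a s" using a(2)[of j] by (cases "j = s") auto
      moreover have "deg a s \<le> Max ((\<lambda>a. deg a s) ` G)" using fin a by (intro Max_ge) auto
      ultimately show ?thesis by simp
    qed
    then show "b \<in> Pi\<^sub>E UNIV (\<lambda>s. {..Max ((\<lambda>a. deg a s) ` G)})" by (auto simp: PiE_def)
  qed
  then have "finite S" by (rule finite_subset) (auto intro!: finite_PiE)
  moreover have "w \<in> S" using w by (auto simp: S_def)
  ultimately obtain b where b: "b \<in> S" and bmax: "\<And>c. c \<in> S \<Longrightarrow> sum c UNIV \<le> sum b UNIV"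
    using obtains_MAX[of S "\<lambda>b. sum b UNIV"] by (metis empty_iff finite_imageI Max_ge imageI)
  define u where "u = (\<lambda>j. Suc (b j))"
  have "\<exists>a\<in>G. deg a s = u s \<and> (\<forall>j. j \<noteq> s \<longrightarrow> deg a j < u j)" for s
  proof -
    \<comment> \<open>After raising coordinate \<open>s\<close> by one some generator divides; as it
      did not before, its degree in \<open>s\<close> is exactly \<open>b s + 1\<close>.\<close>
    have "b(s := Suc (b s)) \<notin> S"
    proof
      assume "b(s := Suc (b s)) \<in> S"
      from bmax[OF this] show False by (simp add: sum.remove[of UNIV s])
    qed
    moreover have "\<forall>j. w j \<le> (b(s := Suc (b s))) j" using b by (auto simp: S_def intro: le_SucI)
    ultimately obtain a where a: "a \<in> G" "\<And>j. deg a j \<le> (b(s := Suc (b s))) j"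
      by (auto simp: S_def not_less)
    have lt: "deg a j < u j" if "j \<noteq> s" for j using a(2)[of j] that by (auto simp: u_def)
    obtain j where "b j < deg a j" using b a by (auto simp: S_def)
    then have "b s < deg a s" using a(2)[of j] by (cases "j = s") auto
    then have "deg a s = u s" using a(2)[of s] by (auto simp: u_def)
    then show ?thesis using a lt by auto
  qed
  then have "corner u" using b by (auto simp: corner_def u_def S_def Suc_le_eq)
  moreover have "w j < u j" for j using b by (auto simp: S_def u_def less_Suc_eq_le)
  ultimately show ?thesis by blast
qed

section \<open>The polyhedron of a staircase and its sweep\<close>

definition base :: real where
  "base = 4 * real CARD('v)"

text \<open>
  The exponents are doubled to leave room for the functionals with odd exponents \<open>2 b\<^sub>j + 1\<close>. An
  exponent \<open>0\<close> gives the entry \<open>0\<close> and not \<open>1\<close>: then the edge that leaves a vertex through a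
  boundary ridge points in the direction of a positive multiple of a coordinate vector.
\<close>

definition pt :: "'g \<Rightarrow> 'v \<Rightarrow> real" where
  "pt a j = (if deg a j = 0 then 0 else base ^ (2 * deg a j))"

lemma base_ge: "4 \<le> base"
proof -
  have "1 \<le> real CARD('v)" using zero_less_card_finite[where 'a='v] by linarith
  then show ?thesis by (simp add: base_def)
qed

lemma pt_nonneg: "0 \<le> pt a j"
  using base_ge by (simp add: pt_def)

text \<open>Dividing column \<open>j\<close> by \<open>base ^ (2 * u j)\<close> brings the rows of
  the champions close to the identity: off the diagonal the degree drops by at least one, hence the
  doubled exponent by two.\<close>

lemma pt_scaled:
  assumes "corner u"
  shows "pt (champ u s) s / base ^ (2 * u s) = 1"
    and "j \<noteq> s \<Longrightarrow> \<bar>pt (champ u s) j / base ^ (2 * u j)\<bar> \<le> 1 / base\<^sup>2"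
proof -
  show "pt (champ u s) s / base ^ (2 * u s) = 1"
    using champ(2)[OF assms] corner_pos[OF assms, of s] base_ge by (simp add: pt_def)
  assume j: "j \<noteq> s"
  show "\<bar>pt (champ u s) j / base ^ (2 * u j)\<bar> \<le> 1 / base\<^sup>2"
  proof (cases "deg (champ u s) j = 0")
    case False
    obtain k where k: "u j = Suc (deg (champ u s) j + k)"
      using champ(3)[OF assms j] less_imp_Suc_add by blast
    have "pt (champ u s) j / base ^ (2 * u j) = 1 / base ^ (2 * k + 2)"
      using False base_ge by (simp add: pt_def k power_add field_simps power2_eq_square)
    also have "\<dots> \<le> 1 / base\<^sup>2"
      using base_ge by (intro divide_left_mono power_increasing mult_pos_pos) auto
    finally show ?thesis using pt_nonneg base_ge by simp
  qed (simp add: pt_def)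
qed

text \<open>The factor \<open>4 * CARD('v)\<close> in \<open>base\<close> is chosen for this bound
  and for the sum of \<open>CARD('v)\<close> terms in \<open>sweep_iff\<close>.\<close>

lemma scaled_e: "0 \<le> 1 / base\<^sup>2" "real CARD('v) * (1 / base\<^sup>2) \<le> 1 / 16"
proof -
  show "0 \<le> 1 / base\<^sup>2" by simp
  have "real CARD('v) * (1 / base\<^sup>2) = 1 / (4 * base)"
    by (simp add: base_def power2_eq_square field_simps)
  also have "\<dots> \<le> 1 / 16" using base_ge by (simp add: field_simps)
  finally show "real CARD('v) * (1 / base\<^sup>2) \<le> 1 / 16" .
qed

lemma dot_unscale:
  "dot (pt a) y = dot (\<lambda>j. pt a j / base ^ (2 * u j)) (\<lambda>j. y j * base ^ (2 * u j))"
  using base_ge by (simp add: dot_def)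

lemma pt_inj:
  assumes "corner u" "\<And>s. dot (pt (champ u s)) x = dot (pt (champ u s)) y"
  shows "x = y"
proof
  fix j
  have "(x j - y j) * base ^ (2 * u j) = 0"
  proof (rule near_identity_inj[of "\<lambda>s j. pt (champ u s) j / base ^ (2 * u j)" "1 / base\<^sup>2"])
    show "dot (\<lambda>j. pt (champ u s) j / base ^ (2 * u j)) (\<lambda>j. (x j - y j) * base ^ (2 * u j)) = 0"
      for s
      using assms(2)[of s]
        by (simp add: dot_unscale[where u = u and y = "\<lambda>j. x j - y j", symmetric] dot_diff)
    show "real CARD('v) * (1 / base\<^sup>2) < 1" using scaled_e(2) by linarith
  qed (use pt_scaled[OF assms(1)] scaled_e(1) in blast)+
  then show "x j = y j" using base_ge by simp
qed

lemma pt_solve: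
  assumes "corner u"
  shows "\<exists>y. \<forall>s. dot (pt (champ u s)) y = b s"
proof -
  have "\<exists>z. \<forall>s. dot (\<lambda>j. pt (champ u s) j / base ^ (2 * u j)) z = b s"
  proof (rule near_identity_solve[of _ "1 / base\<^sup>2"])
    show "real CARD('v) * (1 / base\<^sup>2) < 1" using scaled_e(2) by linarith
  qed (use pt_scaled[OF assms(1)] scaled_e(1) in blast)+
  then obtain z where "\<And>s. dot (\<lambda>j. pt (champ u s) j / base ^ (2 * u j)) z = b s" by auto
  then show ?thesis
    using base_ge
    by (intro exI[of _ "\<lambda>j. z j / base ^ (2 * u j)"]) (simp add: dot_unscale[where u = u])
qed

definition vertex :: "('v \<Rightarrow> nat) \<Rightarrow> 'v \<Rightarrow> real" where
  "vertex u = (SOME y. \<forall>s. dot (pt (champ u s)) y = 1)"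

context
  fixes u assumes u: "corner u"
begin

lemma vertex_champ: "dot (pt (champ u s)) (vertex u) = 1"
proof -
  have "\<exists>y. \<forall>s. dot (pt (champ u s)) y = 1" by (rule pt_solve[OF u])
  from someI_ex[OF this] show ?thesis by (auto simp: vertex_def)
qed

text \<open>With Z the largest absolute value of a scaled coordinate z_s, near-identity gives |1 -
  z_s| <= Z/16. This yields first Z <= 16/15 and then |1 - z_s| <= 1/15.\<close>

lemma vertex_bounds:
  "14/15 \<le> vertex u j * base ^ (2 * u j)" "vertex u j * base ^ (2 * u j) \<le> 16/15"
proof -
  define z where "z = (\<lambda>j. vertex u j * base ^ (2 * u j))"
  define m where "m = (\<lambda>s j. pt (champ u s) j / base ^ (2 * u j))"
  obtain s0 where s0: "\<And>j. \<bar>z j\<bar> \<le> \<bar>z s0\<bar>"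
    using max_abs_attained[of z] by blast
  have m: "m s s = 1" "j \<noteq> s \<Longrightarrow> \<bar>m s j\<bar> \<le> 1 / base\<^sup>2" for s j
    unfolding m_def by (fact pt_scaled[OF u])+
  have "dot (m s) z = 1" for s
    unfolding m_def z_def dot_unscale[symmetric] by (rule vertex_champ)
  then have "\<bar>1 - z s\<bar> \<le> real CARD('v) * (1 / base\<^sup>2) * \<bar>z s0\<bar>" for s
    using near_identity_bound[of m "1 / base\<^sup>2" z "\<bar>z s0\<bar>" s] m s0 by auto
  moreover have "real CARD('v) * (1 / base\<^sup>2) * \<bar>z s0\<bar> \<le> 1/16 * \<bar>z s0\<bar>"
    using scaled_e by (intro mult_right_mono) auto
  ultimately have *: "\<bar>1 - z s\<bar> \<le> 1/16 * \<bar>z s0\<bar>" for s using order.trans by blast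
  have "\<bar>z s0\<bar> \<le> 16/15" using *[of s0] by (simp add: abs_if split: if_splits)
  then have "\<bar>1 - z j\<bar> \<le> 1/15" using *[of j] by simp
  then have "14/15 \<le> z j" "z j \<le> 16/15" by (auto simp: abs_if split: if_splits)
  then show "14/15 \<le> vertex u j * base ^ (2 * u j)" "vertex u j * base ^ (2 * u j) \<le> 16/15"
    by (simp_all add: z_def)
qed

lemma vertex_pos: "0 < vertex u j"
proof -
  have "0 < vertex u j * base ^ (2 * u j)" using vertex_bounds(1)[of j] by linarith
  then show ?thesis using base_ge by (simp add: zero_less_mult_iff)
qed

lemma vertex_face: "a \<in> face u \<Longrightarrow> dot (pt a) (vertex u) = 1"
  using vertex_champ by (auto simp: face_eq[OF u])

lemma dot_vertex_ge: "(\<And>j. 0 \<le> c j) \<Longrightarrow> c j * vertex u j \<le> dot c (vertex u)"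
  unfolding dot_def
    by (intro member_le_sum) (auto intro: mult_nonneg_nonneg less_imp_le[OF vertex_pos])

text \<open>A single coordinate with exponent beyond \<open>u j\<close> contributes at least 16 *
  14/15. So the vertex satisfies the inequality of every generator, and precisely those of its face
  are tight.\<close>

lemma vertex_off_face:
  assumes "a \<in> G" "a \<notin> face u"
  shows "1 < dot (pt a) (vertex u)"
proof -
  obtain j where j: "u j < deg a j" using assms by (auto simp: face_def not_le)
  then obtain k where k: "deg a j = Suc (u j + k)" using less_imp_Suc_add by blast
  have "1 < 16 * (14/15 :: real)" by simp
  also have "\<dots> \<le> base ^ (2 * k + 2) * (vertex u j * base ^ (2 * u j))"
  proof (intro mult_mono vertex_bounds)
    have "(16::real) = 4 ^ 2" by simp
    also have "\<dots> \<le> base ^ 2" using base_ge by (intro power_mono) auto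
    also have "\<dots> \<le> base ^ (2 * k + 2)" using base_ge by (intro power_increasing) auto
    finally show "16 \<le> base ^ (2 * k + 2)" .
  qed (use base_ge in auto)
  also have "\<dots> = pt a j * vertex u j"
    using k by (simp add: pt_def power_add algebra_simps)
  also have "\<dots> \<le> dot (pt a) (vertex u)" by (intro dot_vertex_ge pt_nonneg)
  finally show ?thesis .
qed

text \<open>The odd exponent \<open>2 * b j + 1\<close> never meets the even \<open>2 * u j\<close>.
  If \<open>b\<close> is strictly below \<open>u\<close>, the \<open>CARD('v)\<close> terms are each
  at most 16/15 divided by \<open>base\<close>, together at most 4/15; a single coordinate with
  \<open>u j \<le> b j\<close> already contributes 4 * 14/15.\<close>

lemma sweep_iff: "dot (\<lambda>j. base ^ (2 * b j + 1)) (vertex u) < 1 \<longleftrightarrow> (\<forall>j. b j < u j)"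
proof
  assume *: "\<forall>j. b j < u j"
  have "base ^ (2 * b j + 1) * vertex u j \<le> 16 / 15 / base" for j
  proof -
    obtain k where k: "u j = Suc (b j + k)" using * less_imp_Suc_add by blast
    have "base ^ (2 * b j + 1) * vertex u j = vertex u j * base ^ (2 * u j) / base ^ (2 * k + 1)"
      using base_ge by (simp add: k power_add field_simps)
    also have "\<dots> \<le> (16/15) / base ^ (2 * k + 1)"
      using vertex_bounds base_ge by (intro divide_right_mono) auto
    also have "\<dots> \<le> (16/15) / base ^ 1"
      using base_ge by (intro divide_left_mono power_increasing mult_pos_pos) auto
    finally show ?thesis by simp
  qed
  then have "dot (\<lambda>j. base ^ (2 * b j + 1)) (vertex u) \<le> (\<Sum>j\<in>(UNIV::'v set). 16 / 15 / base)"
    unfolding dot_def by (intro sum_mono)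
  also have "\<dots> < 1" by (simp add: base_def field_simps)
  finally show "dot (\<lambda>j. base ^ (2 * b j + 1)) (vertex u) < 1" .
next
  assume less: "dot (\<lambda>j. base ^ (2 * b j + 1)) (vertex u) < 1"
  show "\<forall>j. b j < u j"
  proof (rule ccontr)
    assume "\<not> ?thesis"
    then obtain j k where k: "b j = u j + k" by (metis le_iff_add not_less)
    have "1 \<le> 4 * (14/15::real)" by simp
    also have "\<dots> \<le> base ^ (2 * k + 1) * (vertex u j * base ^ (2 * u j))"
    proof (intro mult_mono vertex_bounds)
      have "base ^ 1 \<le> base ^ (2 * k + 1)" using base_ge by (intro power_increasing) auto
      then show "4 \<le> base ^ (2 * k + 1)"
        using base_ge unfolding power_one_right by (rule order.trans[rotated])
    qed (use base_ge in auto)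
    also have "\<dots> = base ^ (2 * b j + 1) * vertex u j" by (simp add: k power_add algebra_simps)
    also have "\<dots> \<le> dot (\<lambda>j. base ^ (2 * b j + 1)) (vertex u)"
      using base_ge by (intro dot_vertex_ge) auto
    finally show False using less by simp
  qed
qed

end

text \<open>The vector from the vertex of \<open>u\<close> to an earlier vertex is a nonnegative
  combination of the edges at \<open>u\<close>, so an edge that occurs in it descends. Such an edge
  does not leave through the boundary, and its other end is the earlier corner that a shelling
  requires.\<close>

lemma shelled_corners:
  "\<exists>Ls. set Ls = face ` {u. corner u \<and> (\<forall>j. b j < u j)} \<and> shelled Ls"
proof -
  let ?U = "{u. corner u \<and> (\<forall>j. b j < u j)}"
  obtain vs :: "'v list" where vs: "set vs = UNIV" using finite_list[of "UNIV :: 'v set"] by auto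
  define \<phi> where "\<phi> = (\<lambda>j. base ^ (2 * b j + 1))"
  \<comment> \<open>\<open>\<phi>\<close> comes first so that a descent stays among the corners
    above \<open>b\<close>; the coordinate functionals break all ties.\<close>
  define cs where "cs = \<phi> # map (\<lambda>s j. if j = s then 1 else 0) vs"
  have coord: "dot (\<lambda>j. if j = s then 1 else 0) y = y s" for s and y :: "'v \<Rightarrow> real"
    by (simp add: dot_def if_distrib[of "\<lambda>x. x * _"] cong: if_cong)
  have cs_nonneg: "0 \<le> c j" if "c \<in> set cs" for c j
    using that base_ge by (auto simp: cs_def \<phi>_def)
  define less where "less = (\<lambda>w u. lexneg cs (\<lambda>j. vertex w j - vertex u j))"
  show ?thesis
  proof (rule shelled_of_order[where less = less])
    show "finite ?U" using finite_corners by (rule rev_finite_subset) auto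
  next
    fix u v w assume "less u v" "less v w"
    then show "less u w" unfolding less_def by (drule_tac lexneg_add) auto
  next
    fix u show "\<not> less u u" unfolding less_def by (rule lexneg_not_nonneg) (simp add: dot_def)
  next
    fix u w assume uw: "u \<in> ?U" "w \<in> ?U" "u \<noteq> w"
    show "less u w \<or> less w u"
    proof (rule ccontr)
      assume "\<not> ?thesis"
      then have "dot c (vertex u) = dot c (vertex w)" if "c \<in> set cs" for c
        using lexneg_total[of cs "vertex u" "vertex w"] that by (auto simp: less_def)
      then have "dot (\<lambda>j. if j = s then 1 else 0) (vertex u) =
          dot (\<lambda>j. if j = s then 1 else 0) (vertex w)" for s
        using vs by (simp add: cs_def)
      then have "vertex u = vertex w" unfolding coord by (rule ext)
      have "face w \<subseteq> face u"
      proof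
        fix a assume a: "a \<in> face w"
        have "dot (pt a) (vertex u) = 1"
          using vertex_face[of w a] a uw(2) \<open>vertex u = vertex w\<close> by simp
        then show "a \<in> face u"
          using vertex_off_face[of u a] a uw(1) by (auto simp: face_def[of w])
      qed
      then show False using corner_eq uw by auto
    qed
  next
    fix u w assume uw: "u \<in> ?U" "w \<in> ?U" "less w u"
    then have u: "corner u" and w: "corner w" by auto
    have "\<exists>y. \<forall>t. dot (pt (champ u t)) y = (if t = s then 1 else 0)" for s
      by (rule pt_solve[OF u])
    then obtain d where d: "\<And>s t. dot (pt (champ u t)) (d s) = (if t = s then 1 else 0)"
      by metis
    \<comment> \<open>\<open>d s\<close> is the edge that leaves the vertex when only the constraint of \<open>champ u s\<close> is relaxed\<close>
    define slack where "slack = (\<lambda>v s. dot (pt (champ u s)) (vertex v) - 1)"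
    have expand: "(\<lambda>j. vertex v j - vertex u j) = (\<lambda>j. \<Sum>s\<in>UNIV. slack v s * d s j)" for v
      by (rule pt_inj[OF u])
        (simp add: dot_diff dot_sum d slack_def vertex_champ[OF u] if_distrib cong: if_cong)
    have slack0: "0 \<le> slack v s" if "corner v" for v s
      using vertex_face[OF that] vertex_off_face[OF that] champ(1)[OF u]
      by (cases "champ u s \<in> face v") (auto simp: slack_def less_imp_le)
    from uw(3) have "\<exists>s\<in>UNIV. 0 < slack w s \<and> lexneg cs (d s)"
      unfolding less_def expand using slack0[OF w] by (intro lexneg_sum) auto
    then obtain s where s: "0 < slack w s" "lexneg cs (d s)" by auto
    have "champ u s \<notin> face w" using s(1) vertex_face[OF w] by (auto simp: slack_def)
    \<comment> \<open>On a boundary ridge \<open>d s\<close> would be a positive multiple of a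
      coordinate vector, where no functional in \<open>cs\<close> is negative.\<close>
    moreover have "\<exists>t. t \<noteq> s \<and> 0 < deg (champ u t) s"
    proof (rule ccontr)
      assume "\<not> ?thesis"
      then have zero: "pt (champ u t) s = 0" if "t \<noteq> s" for t using that by (auto simp: pt_def)
      have ptpos: "0 < pt (champ u s) s"
        using champ(2)[OF u] corner_pos[OF u, of s] base_ge by (simp add: pt_def)
      have "d s = (\<lambda>j. if j = s then 1 / pt (champ u s) s else 0)"
      proof (rule pt_inj[OF u])
        fix t
        show "dot (pt (champ u t)) (d s) =
            dot (pt (champ u t)) (\<lambda>j. if j = s then 1 / pt (champ u s) s else 0)"
          using zero[of t] ptpos unfolding d
          by (simp add: dot_def if_distrib[of "\<lambda>x. _ * x"] cong: if_cong)
      qed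
      then have "0 \<le> dot c (d s)" if "c \<in> set cs" for c
        using cs_nonneg[OF that] ptpos by (auto simp: dot_def intro!: sum_nonneg)
      then show False using s(2) lexneg_not_nonneg by blast
    qed
    then obtain t where "t \<noteq> s" "0 < deg (champ u t) s" by auto
    from ridge_neighbour[OF u this] obtain v where
      v: "corner v" "face u - {champ u s} \<subseteq> face v" "v \<noteq> u" by auto
    have on: "champ u t \<in> face v" if "t \<noteq> s" for t
      using v(2) champ_face[OF u] inj_champ[OF u] that by (auto dest: injD)
    have "champ u s \<notin> face v"
    proof
      assume "champ u s \<in> face v"
      then have "face u \<subseteq> face v" using v(2) by auto
      then show False using corner_eq[OF v(1) u] v(3) by auto
    qed
    then have pos: "0 < slack v s"
      using vertex_off_face[OF v(1)] champ(1)[OF u] by (simp add: slack_def)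
    have "slack v t = 0" if "t \<noteq> s" for t
      using vertex_face[OF v(1) on[OF that]] by (simp add: slack_def)
    \<comment> \<open>At \<open>v\<close> only the constraint of \<open>champ u s\<close> is slack,
      so \<open>v\<close> lies on the edge \<open>d s\<close> at a positive distance.\<close>
    then have "(\<lambda>j. vertex v j - vertex u j) = (\<lambda>j. slack v s * d s j)"
      unfolding expand by (simp add: sum.remove[of UNIV s])
    then have less: "less v u" using lexneg_scale[OF s(2) pos] by (simp add: less_def)
    then have "dot \<phi> (vertex v) \<le> dot \<phi> (vertex u)" by (auto simp: less_def cs_def dot_diff)
    then have "dot \<phi> (vertex v) < 1" using sweep_iff[OF u, of b] uw(1) by (simp add: \<phi>_def)
    then have "v \<in> ?U" using v(1) sweep_iff[OF v(1), of b] by (simp add: \<phi>_def)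
    ultimately show "\<exists>x\<in>face u - face w. \<exists>v\<in>?U. less v u \<and> face u - {x} \<subseteq> face v"
      using v less champ_face[OF u] by blast
  qed
qed

end

section \<open>Weakly regular sequences\<close>

abbreviation "lookup \<equiv> Poly_Mapping.lookup"
abbreviation "keys \<equiv> Poly_Mapping.keys"
abbreviation "single \<equiv> Poly_Mapping.single"

lemma poly_expand: "h = (\<Sum>a\<in>keys h. single a (lookup h a))"
  by (rule poly_mapping_eqI)
    (simp add: lookup_sum lookup_single when_def in_keys_iff sum.delta)

lemma mult_expand:
  "f * g = (\<Sum>a\<in>keys f. \<Sum>b\<in>keys g. single (a + b) (lookup f a * lookup g b))"
  for f g :: "'a::comm_monoid_add \<Rightarrow>\<^sub>0 'b::comm_semiring_0"
  by (subst poly_expand[of f], subst poly_expand[of g])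
    (simp add: sum_product mult_single)

lemma lookup_mult_sum:
  "lookup (f * g) k = (\<Sum>a\<in>keys f. \<Sum>b\<in>keys g. if a + b = k then lookup f a * lookup g b else 0)"
  for f g :: "'a::comm_monoid_add \<Rightarrow>\<^sub>0 'b::comm_semiring_0"
  by (subst mult_expand) (simp add: lookup_sum lookup_single when_def)

text \<open>Applied to extremal terms: where only one pair of terms can contribute, nothing
  cancels.\<close>

lemma lookup_mult_unique:
  fixes f g :: "'a::comm_monoid_add \<Rightarrow>\<^sub>0 'b::comm_semiring_0"
  assumes "\<And>a' b'. a' \<in> keys f \<Longrightarrow> b' \<in> keys g \<Longrightarrow> a' + b' = a + b \<Longrightarrow> a' = a \<and> b' = b"
  shows "lookup (f * g) (a + b) = lookup f a * lookup g b"
proof -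
  have "lookup (f * g) (a + b) =
      (\<Sum>a'\<in>keys f. \<Sum>b'\<in>keys g. if a' = a \<and> b' = b then lookup f a * lookup g b else 0)"
    unfolding lookup_mult_sum using assms by (intro sum.cong) auto
  also have "\<dots> = (\<Sum>a'\<in>keys f. if a' = a then lookup f a * lookup g b else 0)"
    by (intro sum.cong) (auto simp: in_keys_iff sum.delta)
  also have "\<dots> = lookup f a * lookup g b" by (auto simp: in_keys_iff)
  finally show ?thesis .
qed

lemma keys_multE:
  fixes f g :: "'a::comm_monoid_add \<Rightarrow>\<^sub>0 'b::comm_semiring_0"
  assumes "k \<in> keys (f * g)"
  obtains a b where "a \<in> keys f" "b \<in> keys g" "k = a + b"
  using assms keys_mult[of f g] by blast

lemma keys_xmon [simp]: "keys (xmon a) = {a}"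
  by (simp add: xmon_def)

lemma lookup_xmon_mult: "lookup (xmon a * h) (a + b) = lookup h b"
  using lookup_mult_unique[of "xmon a" h a b] by (simp add: xmon_def)

lemma keys_xmon_mult: "keys (xmon a * h) = (+) a ` keys h"
proof
  show "keys (xmon a * h) \<subseteq> (+) a ` keys h" by (auto elim!: keys_multE)
  show "(+) a ` keys h \<subseteq> keys (xmon a * h)" by (auto simp: in_keys_iff lookup_xmon_mult)
qed

lemma xmon_add: "xmon (a + b) = xmon a * xmon b"
  by (simp add: xmon_def mult_single)

lemma xmon_zero [simp]: "xmon 0 = 1"
  by (simp add: xmon_def)

lemma single_xmon: "single a k = single 0 k * xmon a"
  by (simp add: xmon_def mult_single)

lemma lookup_const_mult: "lookup (single 0 k * p) a = k * lookup p a"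
  for p :: "('v, 'k::field) mpoly"
proof -
  have "a' = 0 \<and> b' = a" if "a' \<in> keys (single 0 k)" "a' + b' = 0 + a" for a' b' :: "'v \<Rightarrow>\<^sub>0 nat"
    using that by (auto split: if_splits)
  from lookup_mult_unique[of "single 0 k" p 0 a, OF this] show ?thesis by simp
qed

lemma keys_exp_add: "keys (a + b) = keys a \<union> keys b" for a b :: "'v \<Rightarrow>\<^sub>0 nat"
  by (auto simp: in_keys_iff lookup_add)

lemma lookup_Abs_finite [simp]: "lookup (Abs_poly_mapping f) s = f s" for s :: "'v::finite"
  by (simp add: lookup_Abs_poly_mapping)

definition indic :: "'v::finite set \<Rightarrow> ('v \<Rightarrow>\<^sub>0 nat)" where
  "indic R = Abs_poly_mapping (\<lambda>s. if s \<in> R then 1 else 0)"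

lemma lookup_indic: "lookup (indic R) s = (if s \<in> R then 1 else 0)"
  by (simp add: indic_def)

lemma keys_indic [simp]: "keys (indic R) = R"
  by (auto simp: in_keys_iff lookup_indic split: if_splits)

lemma exp_diff_add: "(\<And>s. lookup a s \<le> lookup b s) \<Longrightarrow> a + (b - a) = b" for a b :: "'v \<Rightarrow>\<^sub>0 nat"
  by (rule poly_mapping_eqI) (simp add: lookup_add lookup_minus)

definition tot :: "('v::finite \<Rightarrow>\<^sub>0 nat) \<Rightarrow> nat" where
  "tot a = (\<Sum>s\<in>UNIV. lookup a s)"

section \<open>Ideals and weakly regular sequences\<close>

definition is_ideal :: "'a::comm_ring_1 set \<Rightarrow> bool" where
  "is_ideal I \<longleftrightarrow> 0 \<in> I \<and> (\<forall>a\<in>I. \<forall>b\<in>I. a + b \<in> I) \<and> (\<forall>a\<in>I. \<forall>r. r * a \<in> I)"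

lemma is_idealD:
  assumes "is_ideal I"
  shows "0 \<in> I" "a \<in> I \<Longrightarrow> b \<in> I \<Longrightarrow> a + b \<in> I" "a \<in> I \<Longrightarrow> r * a \<in> I" "a \<in> I \<Longrightarrow> a * r \<in> I"
    "a \<in> I \<Longrightarrow> - a \<in> I" "a \<in> I \<Longrightarrow> b \<in> I \<Longrightarrow> a - b \<in> I"
proof -
  show *: "0 \<in> I" "a \<in> I \<Longrightarrow> b \<in> I \<Longrightarrow> a + b \<in> I" "a \<in> I \<Longrightarrow> r * a \<in> I" for a b r
    using assms by (auto simp: is_ideal_def)
  show "a \<in> I \<Longrightarrow> a * r \<in> I" using *(3)[of a r] by (simp add: mult.commute)
  show neg: "a \<in> I \<Longrightarrow> - a \<in> I" for a using *(3)[of a "-1"] by simp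
  show "a \<in> I \<Longrightarrow> b \<in> I \<Longrightarrow> a - b \<in> I" using *(2)[of a "-b"] neg by simp
qed

lemma is_ideal_sum: "is_ideal I \<Longrightarrow> (\<And>x. x \<in> A \<Longrightarrow> f x \<in> I) \<Longrightarrow> sum f A \<in> I"
  by (induction A rule: infinite_finite_induct) (auto simp: is_idealD)

lemma is_ideal_one: "is_ideal I \<Longrightarrow> 1 \<in> I \<longleftrightarrow> I = UNIV"
  using is_idealD(3)[of I 1] by auto

definition addgen :: "'a::comm_ring_1 set \<Rightarrow> 'a \<Rightarrow> 'a set" where
  "addgen I f = {i + f * c | i c. i \<in> I}"

lemma addgenI: "i \<in> I \<Longrightarrow> a = i + f * c \<Longrightarrow> a \<in> addgen I f"
  by (auto simp: addgen_def)

lemma addgenE: "a \<in> addgen I f \<Longrightarrow> (\<And>i c. i \<in> I \<Longrightarrow> a = i + f * c \<Longrightarrow> thesis) \<Longrightarrow> thesis"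
  by (auto simp: addgen_def)

lemma addgen_mono: "I \<subseteq> addgen I f"
  by (auto intro: addgenI[where c = 0])

lemma addgen_gen: "is_ideal I \<Longrightarrow> f \<in> addgen I f"
  by (rule addgenI[where c = 1]) (auto simp: is_idealD)

lemma is_ideal_addgen:
  assumes "is_ideal I" shows "is_ideal (addgen I f)"
  unfolding is_ideal_def
proof (intro conjI ballI allI)
  show "0 \<in> addgen I f" using addgen_mono is_idealD(1)[OF assms] by blast
  show "a + b \<in> addgen I f" if ab: "a \<in> addgen I f" "b \<in> addgen I f" for a b
  proof -
    obtain i c where "i \<in> I" "a = i + f * c" using ab(1) by (rule addgenE)
    moreover obtain j d where "j \<in> I" "b = j + f * d" using ab(2) by (rule addgenE)
    ultimately show ?thesis using is_idealD[OF assms]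
      by (intro addgenI[of "i + j" _ _ _ "c + d"]) (auto simp: algebra_simps)
  qed
  show "r * a \<in> addgen I f" if a: "a \<in> addgen I f" for a r
  proof -
    obtain i c where "i \<in> I" "a = i + f * c" using a by (rule addgenE)
    then show ?thesis using is_idealD[OF assms]
      by (intro addgenI[of "r * i" _ _ _ "r * c"]) (auto simp: algebra_simps)
  qed
qed

lemma addgen_swap: "addgen (addgen I f) g = addgen (addgen I g) f"
proof -
  have "addgen (addgen I f) g \<subseteq> addgen (addgen I g) f" for f g
  proof
    fix a assume "a \<in> addgen (addgen I f) g"
    then obtain b c where b: "b \<in> addgen I f" "a = b + g * c" by (rule addgenE)
    from b(1) obtain i d where i: "i \<in> I" "b = i + f * d" by (rule addgenE)
    have "i + g * c \<in> addgen I g" using i(1) by (rule addgenI) simp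
    then show "a \<in> addgen (addgen I g) f" by (rule addgenI) (simp add: b i algebra_simps)
  qed
  then show ?thesis by blast
qed

lemma addgen_cong:
  assumes "is_ideal I" "f - g \<in> I"
  shows "addgen I f = addgen I g"
proof -
  have "addgen I f \<subseteq> addgen I g" if "f - g \<in> I" for f g
  proof
    fix a assume "a \<in> addgen I f"
    then obtain i c where ic: "i \<in> I" "a = i + f * c" by (rule addgenE)
    have "i + (f - g) * c \<in> I" using ic(1) that is_idealD(2,4)[OF assms(1)] by blast
    then show "a \<in> addgen I g" by (rule addgenI) (simp add: ic algebra_simps)
  qed
  moreover have "g - f \<in> I" using is_idealD(5)[OF assms] by simp
  ultimately show ?thesis using assms(2) by blast
qed

text \<open>Properness of the final ideal is left out, because the colon ideals and sums in the
  inductions may be the whole ring; \<open>regular_sequence_map\<close> restores it.\<close>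

fun wreg :: "'a::comm_ring_1 set \<Rightarrow> 'a list \<Rightarrow> bool" where
  "wreg I [] \<longleftrightarrow> True"
| "wreg I (f # fs) \<longleftrightarrow> (\<forall>a. f * a \<in> I \<longrightarrow> a \<in> I) \<and> wreg (addgen I f) fs"

lemma wreg_UNIV: "wreg UNIV fs"
proof (induction fs)
  case (Cons f fs)
  have "addgen UNIV f = UNIV" using addgen_mono[of UNIV f] by auto
  then show ?case using Cons by simp
qed simp

text \<open>Horseshoe argument for \<open>0 \<rightarrow> R/(I : g) \<rightarrow> R/I \<rightarrow> R/(I + (g)) \<rightarrow> 0\<close>.\<close>

lemma wreg_split:
  assumes "is_ideal I" "wreg {a. g * a \<in> I} fs" "wreg (addgen I g) fs"
  shows "wreg I fs"
  using assms
proof (induction fs arbitrary: I)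
  case (Cons f fs)
  note I = is_idealD[OF Cons.prems(1)]
  have f1: "\<And>a. g * (f * a) \<in> I \<Longrightarrow> g * a \<in> I"
    and f2: "\<And>a. f * a \<in> addgen I g \<Longrightarrow> a \<in> addgen I g" using Cons.prems by auto
  \<comment> \<open>Colon and sum commute: if g a = i + f c, regularity of \<open>f\<close> modulo I
    + (g) puts \<open>c\<close> into that ideal, so f c can be absorbed into I and a multiple of g
    f.\<close>
  have colon: "{a. g * a \<in> addgen I f} = addgen {a. g * a \<in> I} f"
  proof (intro equalityI subsetI)
    fix a assume "a \<in> {a. g * a \<in> addgen I f}"
    then have "g * a \<in> addgen I f" by simp
    then obtain i c where i: "i \<in> I" and eq: "g * a = i + f * c" by (rule addgenE)
    have "f * c \<in> addgen I g" using i eq I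
      by (intro addgenI[of "- i" _ _ _ a]) (auto simp: algebra_simps)
    from f2[OF this] obtain j b where j: "j \<in> I" "c = j + g * b" by (rule addgenE)
    have "g * (a - f * b) = i + f * j" using eq j by (simp add: algebra_simps)
    then have "a - f * b \<in> {a. g * a \<in> I}" using i j I by simp
    then show "a \<in> addgen {a. g * a \<in> I} f" by (rule addgenI) simp
  next
    fix a assume "a \<in> addgen {a. g * a \<in> I} f"
    then obtain i c where "i \<in> {a. g * a \<in> I}" "a = i + f * c" by (rule addgenE)
    then show "a \<in> {a. g * a \<in> addgen I f}"
      by (auto intro!: addgenI[of "g * i" _ _ _ "g * c"] simp: algebra_simps)
  qed
  have "wreg (addgen I f) fs"
  proof (rule Cons.IH)
    show "is_ideal (addgen I f)" by (rule is_ideal_addgen[OF Cons.prems(1)])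
  qed (use Cons.prems in \<open>simp_all add: colon addgen_swap[of I f]\<close>)
  moreover have "a \<in> I" if fa: "f * a \<in> I" for a
  proof -
    have "a \<in> addgen I g" using f2[of a] fa addgen_mono by blast
    then obtain i b where ib: "i \<in> I" "a = i + g * b" by (rule addgenE)
    then have "g * (f * b) = f * a - f * i" by (simp add: algebra_simps)
    then have "g * b \<in> I" using f1 fa ib I by simp
    then show ?thesis using ib I by simp
  qed
  ultimately show ?case by simp
qed simp

section \<open>Spans of monomials and Stanley-Reisner ideals\<close>

definition mon_span :: "('v \<Rightarrow>\<^sub>0 nat) set \<Rightarrow> ('v, 'k::field) mpoly set" where
  "mon_span E = {h. keys h \<subseteq> E}"

definition upset :: "('v \<Rightarrow>\<^sub>0 nat) set \<Rightarrow> bool" where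
  "upset E \<longleftrightarrow> (\<forall>a\<in>E. \<forall>b. a + b \<in> E)"

lemma is_ideal_mon_span: "upset E \<Longrightarrow> is_ideal (mon_span E :: ('v, 'k::field) mpoly set)"
proof (unfold is_ideal_def, intro conjI ballI allI)
  assume up: "upset E"
  fix a b r :: "('v, 'k) mpoly" assume a: "a \<in> mon_span E"
  show "r * a \<in> mon_span E"
    unfolding mon_span_def
  proof (intro CollectI subsetI)
    fix k assume "k \<in> keys (r * a)"
    then obtain i j where "j \<in> keys a" "k = i + j" by (rule keys_multE)
    then have "j \<in> E" "k = j + i" using a by (auto simp: mon_span_def add.commute)
    then show "k \<in> E" using up by (simp add: upset_def)
  qed
  assume "b \<in> mon_span E"
  then show "a + b \<in> mon_span E" using a keys_add[of a b] by (auto simp: mon_span_def)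
qed (simp add: mon_span_def)

lemma xmon_mult_mon_span: "xmon g * h \<in> mon_span E \<longleftrightarrow> h \<in> mon_span {b. g + b \<in> E}"
  by (auto simp: mon_span_def keys_xmon_mult)

lemma addgen_mon_span:
  assumes "upset E"
  shows "addgen (mon_span E :: ('v, 'k::field) mpoly set) (xmon g) = mon_span (E \<union> range ((+) g))"
    (is "?L = ?R")
proof
  show "?L \<subseteq> ?R"
  proof
    fix h assume "h \<in> ?L"
    then obtain i c where "i \<in> mon_span E" "h = i + xmon g * c" by (rule addgenE)
    then show "h \<in> ?R"
      using keys_add[of i "xmon g * c"] by (auto simp: mon_span_def keys_xmon_mult)
  qed
  show "?R \<subseteq> ?L"
  proof
    fix h :: "('v, 'k) mpoly" assume h: "h \<in> ?R"
    have up: "upset (E \<union> range ((+) g))" using assms by (auto simp: upset_def add.assoc)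
    have J: "is_ideal ?L" by (rule is_ideal_addgen[OF is_ideal_mon_span[OF assms]])
    have "single a (lookup h a) \<in> ?L" if a: "a \<in> keys h" for a
    proof (cases "a \<in> E")
      case True
      then have "single a (lookup h a) \<in> mon_span E" by (auto simp: mon_span_def)
      then show ?thesis using addgen_mono by blast
    next
      case False
      then obtain b where "a = g + b" using h a by (auto simp: mon_span_def)
      then have "single a (lookup h a) = 0 + xmon g * single b (lookup h a)"
        by (simp add: xmon_def mult_single)
      then show ?thesis by (intro addgenI[of 0]) (auto simp: mon_span_def)
    qed
    then show "h \<in> ?L" by (subst poly_expand) (intro is_ideal_sum[OF J])
  qed
qed

text \<open>For an up-closed \<open>\<U>\<close> this is the Stanley-Reisner ideal of the complex of
  all sets outside \<open>\<U>\<close>.\<close>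

definition sqfree :: "'v set set \<Rightarrow> ('v, 'k::field) mpoly set" where
  "sqfree \<U> = mon_span {a. keys a \<in> \<U>}"

definition upfam :: "'v set set \<Rightarrow> bool" where
  "upfam \<U> \<longleftrightarrow> (\<forall>K\<in>\<U>. \<forall>L. K \<subseteq> L \<longrightarrow> L \<in> \<U>)"

lemma upset_supports: "upfam \<U> \<Longrightarrow> upset {a. keys a \<in> \<U>}"
  by (auto simp: upset_def upfam_def keys_exp_add)

lemma is_ideal_sqfree: "upfam \<U> \<Longrightarrow> is_ideal (sqfree \<U>)"
  unfolding sqfree_def by (rule is_ideal_mon_span[OF upset_supports])

lemma addgen_sqfree:
  fixes \<U> :: "'v::finite set set"
  assumes "upfam \<U>"
  shows "addgen (sqfree \<U>) (xmon (indic R)) = (sqfree (\<U> \<union> {K. R \<subseteq> K}) :: ('v, 'k::field) mpoly set)"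
proof -
  have "a \<in> range ((+) (indic R)) \<longleftrightarrow> R \<subseteq> keys a" for a :: "'v \<Rightarrow>\<^sub>0 nat"
  proof
    assume "R \<subseteq> keys a"
    then have "a = indic R + (a - indic R)"
      by (intro exp_diff_add[symmetric]) (use \<open>R \<subseteq> keys a\<close> in \<open>auto simp: lookup_indic in_keys_iff Suc_le_eq\<close>)
    then show "a \<in> range ((+) (indic R))" by blast
  qed (auto simp: keys_exp_add)
  then have "{a. keys a \<in> \<U>} \<union> range ((+) (indic R)) = {a. keys a \<in> \<U> \<union> {K. R \<subseteq> K}}" by auto
  then show ?thesis unfolding sqfree_def addgen_mon_span[OF upset_supports[OF assms]] by simp
qed

text \<open>For the monomial of a set \<open>R\<close> both outer terms of the exact sequence are
  again Stanley-Reisner rings.\<close>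

lemma wreg_sqfree_split:
  fixes \<U> :: "'v::finite set set" and fs :: "('v, 'k::field) mpoly list"
  assumes "upfam \<U>" "wreg (sqfree {K. R \<union> K \<in> \<U>}) fs" "wreg (sqfree (\<U> \<union> {K. R \<subseteq> K})) fs"
  shows "wreg (sqfree \<U>) fs"
proof (rule wreg_split[where g = "xmon (indic R)"])
  show "is_ideal (sqfree \<U>)" by (rule is_ideal_sqfree[OF assms(1)])
  have "{a. xmon (indic R) * a \<in> sqfree \<U>} = (sqfree {K. R \<union> K \<in> \<U>} :: ('v, 'k) mpoly set)"
    by (auto simp: sqfree_def xmon_mult_mon_span keys_exp_add)
  then show "wreg {a. xmon (indic R) * a \<in> sqfree \<U>} fs" using assms(2) by simp
qed (simp add: addgen_sqfree assms)

section \<open>Elementary symmetric polynomials as parameters\<close>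

definition esym :: "nat \<Rightarrow> ('v::finite, 'k::field) mpoly" where
  "esym d = (\<Sum>G | card G = d. xmon (indic G))"

fun esyms :: "nat \<Rightarrow> ('v::finite, 'k::field) mpoly list" where
  "esyms 0 = []"
| "esyms (Suc d) = esym (Suc d) # esyms d"

lemma length_esyms [simp]: "length (esyms d) = d"
  by (induction d) auto

text \<open>
  The sequence starts with \<open>e\<^sub>d\<close>: modulo the variables in \<open>A\<close> it is the product of the \<open>d\<close> remaining
  ones, and setting one of these to \<open>0\<close> leaves \<open>e\<^sub>d\<^sub>-\<^sub>1, \<dots>, e\<^sub>1\<close> in the same situation.
\<close>

lemma wreg_coordinate:
  "card (- A) = d \<Longrightarrow> wreg (sqfree {K. K \<inter> A \<noteq> {}}) (esyms d :: ('v::finite, 'k::field) mpoly list)"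
proof (induction d arbitrary: A)
  case (Suc d)
  let ?U = "{K. K \<inter> A \<noteq> {}}" and ?Q = "sqfree {K. K \<inter> A \<noteq> {}} :: ('v, 'k) mpoly set"
  have up: "upfam ?U" by (auto simp: upfam_def)
  note Q = is_idealD[OF is_ideal_sqfree[OF up]]
  have "(esym (Suc d) :: ('v, 'k) mpoly) - xmon (indic (- A)) =
      (\<Sum>G\<in>{G. card G = Suc d} - {- A}. xmon (indic G))"
    unfolding esym_def using Suc.prems by (subst sum.remove[of _ "- A"]) auto
  also have "\<dots> \<in> ?Q"
  proof (rule is_ideal_sum[OF is_ideal_sqfree[OF up]])
    fix G assume G: "G \<in> {G. card G = Suc d} - {- A}"
    then have "\<not> G \<subseteq> - A" using Suc.prems card_subset_eq[of "- A" G] by auto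
    then show "xmon (indic G) \<in> ?Q" by (auto simp: sqfree_def mon_span_def)
  qed
  finally have cong: "esym (Suc d) - xmon (indic (- A)) \<in> ?Q" .
  \<comment> \<open>The product over \<open>G\<close> loses one factor \<open>s\<close> at a time:
    the colon by \<open>s\<close> drops it, and adding \<open>s\<close> gives the coordinate ideal
    of \<open>insert s A\<close>, to which the outer induction hypothesis applies.\<close>
  have aux: "wreg (sqfree (?U \<union> {K. G \<subseteq> K})) (esyms d :: ('v, 'k) mpoly list)" if "G \<subseteq> - A" for G
    using finite[of G] that
  proof (induction G rule: finite_induct)
    case empty
    have "sqfree (?U \<union> {K. {} \<subseteq> K}) = (UNIV :: ('v, 'k) mpoly set)"
      by (auto simp: sqfree_def mon_span_def)
    then show ?case by (simp add: wreg_UNIV)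
  next
    case (insert s G)
    show ?case
    proof (rule wreg_sqfree_split[where R = "{s}"])
      show "upfam (?U \<union> {K. insert s G \<subseteq> K})" by (auto simp: upfam_def)
      have "{K. {s} \<union> K \<in> ?U \<union> {K. insert s G \<subseteq> K}} = ?U \<union> {K. G \<subseteq> K}"
        using insert.prems insert.hyps by auto
      then show
        "wreg (sqfree {K. {s} \<union> K \<in> ?U \<union> {K. insert s G \<subseteq> K}}) (esyms d :: ('v, 'k) mpoly list)"
        using insert by simp
      have eq: "?U \<union> {K. insert s G \<subseteq> K} \<union> {K. {s} \<subseteq> K} = {K. K \<inter> insert s A \<noteq> {}}" by auto
      have "card (- insert s A) = d"
        using insert.prems Suc.prems by (subst Compl_insert) (simp add: card_Diff_singleton)
      from Suc.IH[OF this]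
      show "wreg (sqfree (?U \<union> {K. insert s G \<subseteq> K} \<union> {K. {s} \<subseteq> K})) (esyms d :: ('v, 'k) mpoly list)"
        unfolding eq .
    qed
  qed
  have "a \<in> ?Q" if "esym (Suc d) * a \<in> ?Q" for a
  proof -
    have "xmon (indic (- A)) * a = esym (Suc d) * a - (esym (Suc d) - xmon (indic (- A))) * a"
      by (simp add: algebra_simps)
    also have "\<dots> \<in> ?Q" by (rule Q(6)[OF that Q(4)[OF cong]])
    finally have "a \<in> mon_span {b. indic (- A) + b \<in> {a. keys a \<in> ?U}}"
      by (simp only: sqfree_def xmon_mult_mon_span)
    then show ?thesis by (auto simp: sqfree_def keys_exp_add mon_span_def)
  qed
  moreover have "wreg (addgen ?Q (esym (Suc d))) (esyms d :: ('v, 'k) mpoly list)"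
    unfolding addgen_cong[OF is_ideal_sqfree[OF up] cong] addgen_sqfree[OF up, of "- A"]
    by (rule aux) simp
  ultimately show ?case by simp
qed simp

text \<open>\<open>R\<close> is the least new face of \<open>L\<close>: the faces of
  \<open>L\<close> in no earlier facet are those that contain \<open>R\<close>. Hence the colon by
  the monomial of \<open>R\<close> is the ideal of the simplex \<open>L\<close>, and adding this
  monomial gives the ideal of the earlier complex.\<close>

lemma wreg_shelled:
  assumes "shelled Fs" "\<And>F. F \<in> set Fs \<Longrightarrow> card F = d"
  shows "wreg (sqfree {K. \<forall>F\<in>set Fs. \<not> K \<subseteq> F}) (esyms d :: ('v::finite, 'k::field) mpoly list)"
  using assms
proof (induction Fs)
  case Nil
  then show ?case by (simp add: sqfree_def mon_span_def wreg_UNIV)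
next
  case (Cons L Fs)
  let ?U = "{K. \<forall>F\<in>set (L # Fs). \<not> K \<subseteq> F}"
  define R where "R = {s \<in> L. \<exists>K\<in>set Fs. L - {s} \<subseteq> K}"
  have R: "\<not> R \<subseteq> F" if "F \<in> set Fs" for F
    using Cons.prems(1) that by (auto simp: R_def)
  show ?case
  proof (rule wreg_sqfree_split[where R = R])
    show "upfam ?U" by (auto simp: upfam_def)
    have "{K. R \<union> K \<in> ?U} = {K. K \<inter> - L \<noteq> {}}" using R by (auto simp: R_def)
    then show "wreg (sqfree {K. R \<union> K \<in> ?U}) (esyms d :: ('v, 'k) mpoly list)"
      using wreg_coordinate[of "- L" d] Cons.prems(2) by simp
    have "?U \<union> {K. R \<subseteq> K} = {K. \<forall>F\<in>set Fs. \<not> K \<subseteq> F}"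
    proof (intro equalityI subsetI)
      fix K assume "K \<in> ?U \<union> {K. R \<subseteq> K}"
      then show "K \<in> {K. \<forall>F\<in>set Fs. \<not> K \<subseteq> F}" using R by (auto dest: order.trans)
    next
      fix K assume K: "K \<in> {K. \<forall>F\<in>set Fs. \<not> K \<subseteq> F}"
      have "R \<subseteq> K" if "K \<subseteq> L"
      proof (rule ccontr)
        assume "\<not> R \<subseteq> K"
        then obtain s where "s \<in> R" "s \<notin> K" by auto
        then obtain F where "F \<in> set Fs" "L - {s} \<subseteq> F" by (auto simp: R_def)
        then show False using K that \<open>s \<notin> K\<close> by auto
      qed
      then show "K \<in> ?U \<union> {K. R \<subseteq> K}" using K by auto
    qed
    then show "wreg (sqfree (?U \<union> {K. R \<subseteq> K})) (esyms d :: ('v, 'k) mpoly list)"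
      using Cons by simp
  qed
qed

section \<open>Primes, monomial orders and the Hilbert basis theorem\<close>

definition is_prime :: "'a::comm_ring_1 set \<Rightarrow> bool" where
  "is_prime P \<longleftrightarrow> is_ideal P \<and> 1 \<notin> P \<and> (\<forall>a b. a * b \<in> P \<longrightarrow> a \<in> P \<or> b \<in> P)"

text \<open>Krull's argument: an ideal maximal among those above \<open>I\<close> and disjoint from
  the multiplicative set \<open>T\<close> is prime.\<close>

lemma prime_avoiding:
  fixes I :: "'a::comm_ring_1 set"
  assumes I: "is_ideal I" and T: "1 \<in> T" "\<And>a b. a \<in> T \<Longrightarrow> b \<in> T \<Longrightarrow> a * b \<in> T" and "I \<inter> T = {}"
  shows "\<exists>Q. is_prime Q \<and> I \<subseteq> Q \<and> Q \<inter> T = {}"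
proof -
  let ?A = "{J. is_ideal J \<and> I \<subseteq> J \<and> J \<inter> T = {}}"
  have "\<exists>Q\<in>?A. \<forall>X\<in>?A. Q \<subseteq> X \<longrightarrow> X = Q"
  proof (rule subset_Zorn_nonempty)
    show "?A \<noteq> {}" using assms by auto
  next
    fix C assume C: "C \<noteq> {}" "subset.chain ?A C"
    then have CA: "\<And>J. J \<in> C \<Longrightarrow> is_ideal J \<and> I \<subseteq> J \<and> J \<inter> T = {}"
      and lin: "\<And>J K. J \<in> C \<Longrightarrow> K \<in> C \<Longrightarrow> J \<subseteq> K \<or> K \<subseteq> J"
      by (auto simp: subset_chain_def)
    have "is_ideal (\<Union>C)"
      unfolding is_ideal_def
    proof (intro conjI ballI allI)
      show "0 \<in> \<Union>C" using C(1) CA is_idealD(1) by blast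
      show "a + b \<in> \<Union>C" if ab: "a \<in> \<Union>C" "b \<in> \<Union>C" for a b
      proof -
        obtain J K where "J \<in> C" "a \<in> J" "K \<in> C" "b \<in> K" using ab by auto
        then have "a \<in> J \<and> b \<in> J \<or> a \<in> K \<and> b \<in> K" using lin[of J K] by auto
        then have "a + b \<in> J \<or> a + b \<in> K"
          using CA[OF \<open>J \<in> C\<close>] CA[OF \<open>K \<in> C\<close>] is_idealD(2) by blast
        then show ?thesis using \<open>J \<in> C\<close> \<open>K \<in> C\<close> by blast
      qed
      show "r * a \<in> \<Union>C" if "a \<in> \<Union>C" for r a using that CA is_idealD(3) by blast
    qed
    then show "\<Union>C \<in> ?A" using C(1) CA by blast
  qed
  then obtain Q where "Q \<in> ?A" and QX: "\<forall>X\<in>?A. Q \<subseteq> X \<longrightarrow> X = Q" by (elim bexE)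
  then have Q: "is_ideal Q" "I \<subseteq> Q" "Q \<inter> T = {}" by auto
  have max: "X = Q" if "is_ideal X" "X \<inter> T = {}" "Q \<subseteq> X" for X
  proof -
    have "X \<in> ?A" using that Q(2) by auto
    then show ?thesis using QX that(3) by simp
  qed
  note QD = is_idealD[OF Q(1)]
  have meet: "\<exists>q c. q \<in> Q \<and> q + a * c \<in> T" if "a \<notin> Q" for a
  proof (rule ccontr)
    assume no: "\<not> ?thesis"
    have "addgen Q a \<inter> T = {}" using no by (auto simp: addgen_def)
    then have "addgen Q a = Q" using max is_ideal_addgen[OF Q(1)] addgen_mono by blast
    then show False using that addgen_gen[OF Q(1), of a] by simp
  qed
  have "a \<in> Q \<or> b \<in> Q" if ab: "a * b \<in> Q" for a b
  proof (rule ccontr)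
    assume "\<not> ?thesis"
    then obtain q c q' c' where *: "q \<in> Q" "q + a * c \<in> T" "q' \<in> Q" "q' + b * c' \<in> T"
      using meet[of a] meet[of b] by blast
    then have "(q + a * c) * (q' + b * c') \<in> T" using T(2) by blast
    moreover have
      "(q + a * c) * (q' + b * c') = q * (q' + b * c') + (a * c) * q' + (a * b) * (c * c')"
      by (simp add: algebra_simps)
    moreover have "\<dots> \<in> Q" by (rule QD(2)[OF QD(2)[OF QD(4)[OF *(1)] QD(3)[OF *(3)]] QD(4)[OF ab]])
    ultimately show False using Q(3) by auto
  qed
  moreover have "1 \<notin> Q" using Q(3) T(1) by auto
  ultimately have "is_prime Q" using Q(1) unfolding is_prime_def by blast
  then show ?thesis using Q by blast
qed

fun gens :: "'a::comm_ring_1 set \<Rightarrow> 'a list \<Rightarrow> 'a set" where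
  "gens I [] = I"
| "gens I (f # fs) = gens (addgen I f) fs"

lemma gens_mono: "I \<subseteq> gens I fs"
proof (induction fs arbitrary: I)
  case (Cons f fs)
  show ?case using addgen_mono[of I f] Cons[of "addgen I f"] by simp
qed simp

lemma is_ideal_gens: "is_ideal I \<Longrightarrow> is_ideal (gens I fs)"
  by (induction fs arbitrary: I) (auto intro: is_ideal_addgen)

lemma gens_least: "is_ideal J \<Longrightarrow> I \<subseteq> J \<Longrightarrow> set fs \<subseteq> J \<Longrightarrow> gens I fs \<subseteq> J"
proof (induction fs arbitrary: I)
  case (Cons f fs)
  have "addgen I f \<subseteq> J" using Cons.prems is_idealD(2,4)[OF Cons.prems(1)]
    by (auto simp: addgen_def)
  then show ?case using Cons by simp
qed simp

lemma set_subset_gens: "is_ideal I \<Longrightarrow> set fs \<subseteq> gens I fs"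
proof (induction fs arbitrary: I)
  case (Cons f fs)
  then show ?case
    using is_ideal_addgen[of I f] addgen_gen[of I f] gens_mono[of "addgen I f" fs] by auto
qed simp

text \<open>This is the bound of depth by height. An element regular modulo \<open>I\<close> lies in
  no minimal prime of \<open>I\<close>, so below the lowest prime over I + (f) there is one more
  prime over \<open>I\<close>.\<close>

lemma wreg_prime_chain:
  assumes "is_ideal I" "wreg I fs" "is_prime P" "gens I fs \<subseteq> P"
  shows "\<exists>Ps. length Ps = length fs \<and> (\<forall>Q\<in>set Ps. is_prime Q \<and> I \<subseteq> Q) \<and> sorted_wrt (\<subset>) (Ps @ [P])"
  using assms(1,2,4)
proof (induction fs arbitrary: I)
  case Nil
  then show ?case by (intro exI[of _ "[]"]) simp
next
  case (Cons f fs)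
  let ?J = "addgen I f"
  have "\<exists>Ps. length Ps = length fs \<and> (\<forall>Q\<in>set Ps. is_prime Q \<and> ?J \<subseteq> Q) \<and> sorted_wrt (\<subset>) (Ps @ [P])"
    by (rule Cons.IH) (use Cons.prems is_ideal_addgen in auto)
  then obtain Ps where Ps: "length Ps = length fs" "\<And>Q. Q \<in> set Ps \<Longrightarrow> is_prime Q \<and> ?J \<subseteq> Q"
    "sorted_wrt (\<subset>) (Ps @ [P])" by blast
  define R where "R = hd (Ps @ [P])"
  have "?J \<subseteq> P" using Cons.prems gens_mono[of ?J fs] by auto
  then have R: "is_prime R" "?J \<subseteq> R" using Ps(2) assms(3) by (cases Ps; simp add: R_def)+
  have least: "R \<subseteq> X" if "X \<in> set (Ps @ [P])" for X using Ps(3) that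
    by (cases Ps) (auto simp: R_def)
  \<comment> \<open>a prime over \<open>I\<close> that avoids \<open>T\<close> lies in \<open>R\<close> and does not contain \<open>f \<in> R\<close>\<close>
  define T where "T = {f ^ k * s | k s. s \<notin> R}"
  have "\<exists>Q. is_prime Q \<and> I \<subseteq> Q \<and> Q \<inter> T = {}"
  proof (rule prime_avoiding[OF Cons.prems(1)])
    have "1 = f ^ 0 * 1" by simp
    then show "1 \<in> T" using R(1) unfolding T_def is_prime_def by blast
    show "a * b \<in> T" if ab: "a \<in> T" "b \<in> T" for a b
    proof -
      obtain k s l t where "a = f ^ k * s" "b = f ^ l * t" "s \<notin> R" "t \<notin> R"
        using ab unfolding T_def by blast
      moreover from this have "s * t \<notin> R" using R(1) by (auto simp: is_prime_def)
      ultimately show ?thesis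
        by (auto simp: T_def power_add mult_ac intro!: exI[of _ "k + l"] exI[of _ "s * t"])
    qed
    have "f ^ k * s \<in> I \<Longrightarrow> s \<in> I" for k s
      using Cons.prems(2) by (induction k) (auto simp: mult.assoc)
    moreover have "I \<subseteq> R" using R(2) addgen_mono by blast
    ultimately show "I \<inter> T = {}" by (auto simp: T_def)
  qed
  then obtain Q where Q: "is_prime Q" "I \<subseteq> Q" "Q \<inter> T = {}" by blast
  have "s \<in> T" if "s \<notin> R" for s
  proof -
    have "s = f ^ 0 * s" by simp
    then show ?thesis unfolding T_def using that by blast
  qed
  then have "Q \<subseteq> R" using Q(3) by blast
  have "1 \<notin> R" using R(1) by (simp add: is_prime_def)
  moreover have "f = f ^ 1 * 1" by simp
  ultimately have "f \<in> T" unfolding T_def by blast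
  moreover have "f \<in> R" using R(2) addgen_gen[OF Cons.prems(1)] by blast
  ultimately have "Q \<subset> R" using \<open>Q \<subseteq> R\<close> Q(3) by blast
  then have "Q \<subset> X" if "X \<in> set (Ps @ [P])" for X using least[OF that] by blast
  then have "sorted_wrt (\<subset>) ((Q # Ps) @ [P])" using Ps(3) by simp
  moreover have "is_prime X \<and> I \<subseteq> X" if "X \<in> set (Q # Ps)" for X
    using that Ps(2)[of X] Q addgen_mono[of I f] by auto
  ultimately show ?case using Ps(1) by (intro exI[of _ "Q # Ps"]) simp
qed

section \<open>Lexicographic order and leading terms\<close>

definition lexless :: "('v::finite \<Rightarrow>\<^sub>0 nat) \<Rightarrow> ('v \<Rightarrow>\<^sub>0 nat) \<Rightarrow> bool" where
  "lexless a b \<longleftrightarrow>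
     (\<exists>s. lookup a s < lookup b s \<and> (\<forall>t. to_nat t < to_nat s \<longrightarrow> lookup a t = lookup b t))"

lemma lexless_irrefl: "\<not> lexless a a"
  by (simp add: lexless_def)

lemma lexless_trans: "lexless a b \<Longrightarrow> lexless b c \<Longrightarrow> lexless a c"
proof -
  assume "lexless a b" "lexless b c"
  then obtain s t where s: "lookup a s < lookup b s"
    "\<And>i. to_nat i < to_nat s \<Longrightarrow> lookup a i = lookup b i"
    and t: "lookup b t < lookup c t" "\<And>i. to_nat i < to_nat t \<Longrightarrow> lookup b i = lookup c i"
    by (auto simp: lexless_def)
  consider "to_nat s < to_nat t" | "s = t" | "to_nat t < to_nat s"
    using nat_neq_iff[of "to_nat s" "to_nat t"] by auto
  then show ?thesis
  proof cases
    case 1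
    then show ?thesis using s t by (auto simp: lexless_def intro!: exI[of _ s])
  next
    case 2
    then show ?thesis using s t by (auto simp: lexless_def intro!: exI[of _ s])
  next
    case 3
    then show ?thesis using s t by (auto simp: lexless_def intro!: exI[of _ t])
  qed
qed

lemma first_difference:
  fixes a b :: "'v::finite \<Rightarrow>\<^sub>0 nat"
  assumes "a \<noteq> b"
  obtains s where "lookup a s \<noteq> lookup b s" "\<And>t. to_nat t < to_nat s \<Longrightarrow> lookup a t = lookup b t"
proof -
  have "\<exists>s. lookup a s \<noteq> lookup b s"
    using assms poly_mapping_eqI[of a b] by auto
  then obtain s0 where "lookup a s0 \<noteq> lookup b s0" by (elim exE)
  from ex_has_least_nat[of "\<lambda>s. lookup a s \<noteq> lookup b s", OF this, of to_nat]
  obtain s where s: "lookup a s \<noteq> lookup b s"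
    "\<And>t. lookup a t \<noteq> lookup b t \<Longrightarrow> to_nat s \<le> to_nat t" by blast
  show thesis
  proof (rule that[OF s(1)])
    fix t :: 'v assume "to_nat t < to_nat s"
    then show "lookup a t = lookup b t" using s(2)[of t] by (auto simp: not_le[symmetric])
  qed
qed

lemma lexless_total: "a \<noteq> b \<Longrightarrow> lexless a b \<or> lexless b a"
proof (erule first_difference)
  fix s assume "lookup a s \<noteq> lookup b s" "\<And>t. to_nat t < to_nat s \<Longrightarrow> lookup a t = lookup b t"
  then show ?thesis unfolding lexless_def
    by (cases "lookup a s < lookup b s") (auto intro!: exI[of _ s])
qed

lemma lexless_dominated: "(\<And>s. lookup a s \<le> lookup b s) \<Longrightarrow> a = b \<or> lexless a b"
proof (cases "a = b")
  case False
  assume le: "\<And>s. lookup a s \<le> lookup b s"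
  obtain s where "lookup a s \<noteq> lookup b s" "\<And>t. to_nat t < to_nat s \<Longrightarrow> lookup a t = lookup b t"
    using first_difference[OF False] by metis
  then have "lexless a b" using le[of s] by (auto simp: lexless_def intro!: exI[of _ s])
  then show ?thesis by simp
qed simp

lemma lexless_add: "lexless a b \<Longrightarrow> lexless (a + c) (b + c)"
  by (auto simp: lexless_def lookup_add)

lemma lex_max_exists:
  assumes "finite X" "X \<noteq> {}"
  shows "\<exists>m\<in>X. \<forall>x\<in>X. x = m \<or> lexless x m"
proof -
  have "asymp_on X lexless" "transp_on X lexless"
    using lexless_irrefl lexless_trans by (auto intro!: asymp_onI transp_onI)
  from Finite_Set.bex_max_element[OF assms(1) this assms(2)] show ?thesis
    using lexless_total by blast
qed

lemma lex_max_add: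
  assumes "a' = a \<or> lexless a' a" "b' = b \<or> lexless b' b" "a' + b' = a + b"
  shows "a' = a \<and> b' = b"
proof (rule ccontr)
  assume neg: "\<not> ?thesis"
  have "lexless (a' + b') (a + b)"
  proof (cases "a' = a")
    case True
    then have "lexless b' b" using neg assms by auto
    from lexless_add[OF this, of a] True show ?thesis by (simp add: add.commute)
  next
    case False
    then have "lexless (a' + b') (a + b')" using assms(1) lexless_add by blast
    moreover have "b' = b \<or> lexless (a + b') (a + b)"
      using assms(2) lexless_add[of b' b a] by (auto simp: add.commute)
    ultimately show ?thesis using lexless_trans by blast
  qed
  then show False using assms(3) by (simp add: lexless_irrefl)
qed

text \<open>Only terms with support outside \<open>A\<close> matter. The lexicographically largest
  of these in the two factors multiply to a term that cannot cancel.\<close>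

lemma is_prime_coordinate:
  "is_prime (sqfree {K. K \<inter> A \<noteq> {}} :: ('v::finite, 'k::field) mpoly set)" (is "is_prime ?Q")
proof -
  have up: "upfam {K. K \<inter> A \<noteq> {}}" by (auto simp: upfam_def)
  have "f * g \<notin> ?Q" if fg: "f \<notin> ?Q" "g \<notin> ?Q" for f g
  proof -
    have ex: "\<exists>m. m \<in> keys f \<and> keys m \<inter> A = {} \<and>
        (\<forall>x\<in>keys f. keys x \<inter> A = {} \<longrightarrow> x = m \<or> lexless x m)" if "f \<notin> ?Q" for f :: "('v, 'k) mpoly"
    proof -
      have "{x \<in> keys f. keys x \<inter> A = {}} \<noteq> {}"
        using that by (auto simp: sqfree_def mon_span_def)
      from lex_max_exists[OF _ this] show ?thesis by auto
    qed
    from ex[OF fg(1)] obtain a where a: "a \<in> keys f" "keys a \<inter> A = {}"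
        "\<forall>x\<in>keys f. keys x \<inter> A = {} \<longrightarrow> x = a \<or> lexless x a" by (elim exE conjE)
    from ex[OF fg(2)] obtain b where b: "b \<in> keys g" "keys b \<inter> A = {}"
        "\<forall>x\<in>keys g. keys x \<inter> A = {} \<longrightarrow> x = b \<or> lexless x b" by (elim exE conjE)
    have "lookup (f * g) (a + b) = lookup f a * lookup g b"
    proof (rule lookup_mult_unique)
      fix a' b' assume *: "a' \<in> keys f" "b' \<in> keys g" "a' + b' = a + b"
      have "keys a' \<union> keys b' = keys a \<union> keys b" using *(3) by (metis keys_exp_add)
      then have "keys a' \<inter> A = {}" "keys b' \<inter> A = {}" using a(2) b(2) by auto
      then show "a' = a \<and> b' = b" using a(3) b(3) * by (intro lex_max_add) auto
    qed
    then have "a + b \<in> keys (f * g)" using a(1) b(1) by (simp add: in_keys_iff)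
    moreover have "keys (a + b) \<inter> A = {}" using a(2) b(2) by (auto simp: keys_exp_add)
    ultimately show ?thesis by (auto simp: sqfree_def mon_span_def)
  qed
  moreover have "1 \<notin> ?Q" by (auto simp: sqfree_def mon_span_def)
  ultimately show ?thesis using is_ideal_sqfree[OF up] by (auto simp: is_prime_def)
qed

lemma mpoly_no_zero_divisors:
  fixes f g :: "('v::finite, 'k::field) mpoly"
  assumes "f * g = 0" shows "f = 0 \<or> g = 0"
proof -
  have "is_prime (sqfree {K :: 'v set. K \<inter> {} \<noteq> {}} :: ('v, 'k) mpoly set)"
    by (rule is_prime_coordinate)
  moreover have "sqfree {K :: 'v set. K \<inter> {} \<noteq> {}} = ({0} :: ('v, 'k) mpoly set)"
    by (auto simp: sqfree_def mon_span_def)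
  ultimately show ?thesis using assms by (auto simp: is_prime_def)
qed

section \<open>Dickson's lemma and Hilbert's basis theorem\<close>

lemma nat_increasing_subsequence:
  fixes h :: "nat \<Rightarrow> nat"
  shows "\<exists>r. strict_mono r \<and> incseq (\<lambda>n. h (r n))"
proof -
  obtain q where q: "strict_mono q" "monoseq (\<lambda>n. h (q n))" using seq_monosub[of h] by auto
  show ?thesis
  proof (cases "incseq (\<lambda>n. h (q n))")
    case False
    then have dec: "decseq (\<lambda>n. h (q n))" using q(2) by (auto simp: monoseq_iff)
    \<comment> \<open>A decreasing sequence of naturals is constant from a place of its least value
      on.\<close>
    obtain m where m: "\<And>n. h (q m) \<le> h (q n)"
      using ex_has_least_nat[of "\<lambda>_. True" 0 "\<lambda>n. h (q n)"] by auto
    have "h (q (m + n)) = h (q m)" for n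
      using m[of "m + n"] dec by (auto simp: decseq_def intro: antisym)
    then have "strict_mono (\<lambda>n. q (m + n)) \<and> incseq (\<lambda>n. h (q (m + n)))"
      using q(1) by (auto simp: strict_mono_def incseq_def)
    then show ?thesis by blast
  qed (use q in blast)
qed

text \<open>Successive subsequences make one variable after the other weakly increasing; any two
  terms of the last one are comparable.\<close>

lemma dickson:
  fixes f :: "nat \<Rightarrow> ('v::finite \<Rightarrow>\<^sub>0 nat)"
  shows "\<exists>i j. i < j \<and> (\<forall>s. lookup (f i) s \<le> lookup (f j) s)"
proof -
  have "\<exists>r. strict_mono r \<and> (\<forall>s\<in>A. incseq (\<lambda>n. lookup (f (r n)) s))" for A :: "'v set"
    using finite[of A]
  proof (induction A rule: finite_induct)
    case empty
    show ?case by (intro exI[of _ id]) (auto simp: strict_mono_def)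
  next
    case (insert s A)
    then obtain r where r: "strict_mono r" "\<And>t. t \<in> A \<Longrightarrow> incseq (\<lambda>n. lookup (f (r n)) t)" by auto
    obtain q where q: "strict_mono q" "incseq (\<lambda>n. lookup (f (r (q n))) s)"
      using nat_increasing_subsequence[of "\<lambda>n. lookup (f (r n)) s"] by auto
    have "incseq (\<lambda>n. lookup (f (r (q n))) t)" if "t \<in> A" for t
      using r(2)[OF that] strict_mono_mono[OF q(1)] by (auto simp: incseq_def mono_def)
    moreover have "strict_mono (\<lambda>n. r (q n))" using r(1) q(1) by (auto simp: strict_mono_def)
    ultimately show ?case using q(2) by blast
  qed
  then obtain r where r: "strict_mono r" "\<And>s. incseq (\<lambda>n. lookup (f (r n)) s)" by (metis UNIV_I)
  have "r 0 < r 1" using r(1) by (auto simp: strict_mono_def)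
  moreover have "lookup (f (r 0)) s \<le> lookup (f (r 1)) s" for s using r(2)
    by (auto simp: incseq_def)
  ultimately show ?thesis by blast
qed

definition mins :: "('v \<Rightarrow>\<^sub>0 nat) set \<Rightarrow> ('v \<Rightarrow>\<^sub>0 nat) set" where
  "mins E = {a \<in> E. \<forall>b\<in>E. (\<forall>s. lookup b s \<le> lookup a s) \<longrightarrow> b = a}"

lemma finite_mins: "finite (mins E)" for E :: "('v::finite \<Rightarrow>\<^sub>0 nat) set"
proof (rule ccontr)
  assume "infinite (mins E)"
  then obtain f :: "nat \<Rightarrow> ('v \<Rightarrow>\<^sub>0 nat)" where f: "inj f" "range f \<subseteq> mins E"
    using infinite_countable_subset by blast
  obtain i j where ij: "i < j" "\<forall>s. lookup (f i) s \<le> lookup (f j) s" using dickson by blast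
  have "f i \<in> mins E" "f j \<in> mins E" using f(2) by auto
  then have "f i = f j" using ij(2) by (auto simp: mins_def)
  then show False using ij(1) f(1) by (auto dest: injD)
qed

text \<open>In an infinite descent some earlier term would divide a later one, hence not be
  lexicographically larger.\<close>

lemma lexless_wf: "wfP (lexless :: ('v::finite \<Rightarrow>\<^sub>0 nat) \<Rightarrow> _)"
  unfolding wfp_def wf_iff_no_infinite_down_chain
proof (rule notI)
  assume "\<exists>f :: nat \<Rightarrow> ('v \<Rightarrow>\<^sub>0 nat). \<forall>i. (f (Suc i), f i) \<in> {(x, y). lexless x y}"
  then obtain f :: "nat \<Rightarrow> ('v \<Rightarrow>\<^sub>0 nat)" where f: "\<And>i. lexless (f (Suc i)) (f i)" by auto
  obtain i j where ij: "i < j" "\<And>s. lookup (f i) s \<le> lookup (f j) s" using dickson by blast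
  have "lexless (f (Suc (i + n))) (f i)" for n
    by (induction n) (auto intro: f lexless_trans)
  then have "lexless (f j) (f i)" using less_imp_Suc_add[OF ij(1)] by auto
  then show False using lexless_dominated[OF ij(2)] lexless_irrefl lexless_trans by metis
qed

lemma mins_below:
  fixes a :: "'v::finite \<Rightarrow>\<^sub>0 nat"
  assumes "a \<in> E"
  shows "\<exists>m\<in>mins E. \<forall>s. lookup m s \<le> lookup a s"
proof -
  let ?X = "{b \<in> E. \<forall>s. lookup b s \<le> lookup a s}"
  from wfp_eq_minimal[THEN iffD1, OF lexless_wf, rule_format, of a ?X] assms
  obtain m where m: "m \<in> ?X" "\<And>b. lexless b m \<Longrightarrow> b \<notin> ?X" by blast
  have "b = m" if b: "b \<in> E" "\<And>s. lookup b s \<le> lookup m s" for b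
  proof (rule ccontr)
    assume "b \<noteq> m"
    then have "lexless b m" using lexless_dominated[OF b(2)] by blast
    moreover have "b \<in> ?X" using b m(1) by (auto intro: order.trans)
    ultimately show False using m(2) by blast
  qed
  then show ?thesis using m(1) by (intro bexI[of _ m]) (auto simp: mins_def)
qed

text \<open>A Groebner basis: one polynomial is chosen for each minimal leading exponent, and
  division by these lowers the leading exponent of any element of \<open>I\<close>.\<close>

lemma hilbert_basis:
  fixes I :: "('v::finite, 'k::field) mpoly set"
  assumes I: "is_ideal I"
  shows "\<exists>B. finite B \<and> B \<subseteq> I \<and> (\<forall>J. is_ideal J \<longrightarrow> B \<subseteq> J \<longrightarrow> I \<subseteq> J)"
proof -
  define lead where
    "lead = (\<lambda>(f :: ('v, 'k) mpoly) a. a \<in> keys f \<and> (\<forall>x\<in>keys f. x = a \<or> lexless x a))"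
  define L where "L = {a. \<exists>f\<in>I. lead f a}"
  have "\<forall>a\<in>L. \<exists>f. f \<in> I \<and> lead f a" by (auto simp: L_def)
  then obtain F where F: "\<And>a. a \<in> L \<Longrightarrow> F a \<in> I \<and> lead (F a) a" by metis
  have "f \<in> J" if J: "is_ideal J" "F ` mins L \<subseteq> J" and fI: "f \<in> I" for J f
  proof -
    \<comment> \<open>The induction runs over a bound \<open>a\<close> for the exponents of
      \<open>f\<close>, which need not occur in \<open>f\<close>.\<close>
    have "\<forall>f\<in>I. (\<forall>x\<in>keys f. x = a \<or> lexless x a) \<longrightarrow> f \<in> J" for a
      using lexless_wf
    proof (induction a rule: wfp_induct_rule)
      case (less a)
      have small: "h \<in> J" if h: "h \<in> I" "\<And>x. x \<in> keys h \<Longrightarrow> lexless x a" for h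
      proof (cases "keys h = {}")
        case True
        then show ?thesis using is_idealD(1)[OF J(1)] by simp
      next
        case False
        then obtain m where m: "m \<in> keys h" "\<forall>x\<in>keys h. x = m \<or> lexless x m"
          using lex_max_exists[of "keys h"] by auto
        then show ?thesis using less[OF h(2)[OF m(1)]] h(1) by blast
      qed
      show ?case
      proof (intro ballI impI)
        fix f assume f: "f \<in> I" "\<forall>x\<in>keys f. x = a \<or> lexless x a"
        show "f \<in> J"
        proof (cases "a \<in> keys f")
          case False
          show ?thesis by (rule small[OF f(1)]) (use False f(2) in auto)
        next
          case True
          then have "a \<in> L" using f by (auto simp: L_def lead_def)
          then obtain m where m: "m \<in> mins L" "\<And>s. lookup m s \<le> lookup a s" using mins_below
            by blast
          have mL: "m \<in> L" using m(1) by (auto simp: mins_def)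
          note Fm = F[OF mL]
          define c where "c = a - m"
          have ac: "a = c + m" using exp_diff_add[of m a] m(2) by (simp add: c_def add.commute)
          define k where "k = lookup f a / lookup (F m) m"
          define h where "h = f - single c k * F m"
          have nz: "lookup (F m) m \<noteq> 0" using Fm by (auto simp: lead_def in_keys_iff)
          have kz: "k \<noteq> 0" using nz True by (simp add: k_def in_keys_iff)
          have coeff: "lookup (single c k * F m) (c + x) = k * lookup (F m) x" for x
            using lookup_mult_unique[of "single c k" "F m" c x] kz by auto
          have keys: "x \<in> (+) c ` keys (F m)" if "x \<in> keys (single c k * F m)" for x
            using that kz by (auto elim!: keys_multE)
          have "h \<in> J"
          proof (rule small)
            show "h \<in> I" using f(1) Fm is_idealD(3,6)[OF I] by (simp add: h_def)
            fix x assume x: "x \<in> keys h"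
            have "x \<noteq> a"
            proof
              assume "x = a"
              have "lookup h a = 0" using nz coeff[of m] by (simp add: h_def lookup_minus ac k_def)
              then show False using x \<open>x = a\<close> by (simp add: in_keys_iff)
            qed
            moreover have "x = a \<or> lexless x a"
            proof (cases "x \<in> keys f")
              case False
              then have "x \<in> keys (single c k * F m)"
                using x by (auto simp: h_def in_keys_iff lookup_minus)
              then obtain y where y: "y \<in> keys (F m)" "x = c + y" using keys by blast
              then have "y = m \<or> lexless y m" using Fm by (auto simp: lead_def)
              then show ?thesis using lexless_add[of y m c] by (auto simp: y ac add.commute)
            qed (use f(2) in blast)
            ultimately show "lexless x a" by blast
          qed
          moreover have "single c k * F m \<in> J" using J m(1) is_idealD(3)[OF J(1)] by blast
          ultimately have "h + single c k * F m \<in> J" using is_idealD(2)[OF J(1)] by blast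
          then show ?thesis by (simp add: h_def)
        qed
      qed
    qed
    note all = this
    show ?thesis
    proof (cases "keys f = {}")
      case True
      then show ?thesis using is_idealD(1)[OF J(1)] by simp
    next
      case False
      then obtain m where "\<forall>x\<in>keys f. x = m \<or> lexless x m" using lex_max_exists[of "keys f"] by auto
      then show ?thesis using all fI by blast
    qed
  qed
  moreover have "F ` mins L \<subseteq> I" using F by (auto simp: mins_def)
  ultimately show ?thesis using finite_mins by (intro exI[of _ "F ` mins L"]) blast
qed

section \<open>Chains of primes and algebraic dependence\<close>

text \<open>Maximality in the form in which it is used: the quotient is a field.\<close>

definition is_maximal :: "'a::comm_ring_1 set \<Rightarrow> bool" where
  "is_maximal P \<longleftrightarrow> is_ideal P \<and> 1 \<notin> P \<and> (\<forall>a. a \<notin> P \<longrightarrow> (\<exists>w. a * w - 1 \<in> P))"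

text \<open>Gaussian elimination: \<open>x0\<close> is an unknown with nonzero coefficient in the
  equation \<open>y\<close>, and \<open>?g\<close> holds the remaining equations after
  \<open>x0\<close> has been eliminated.\<close>

lemma homogeneous_system:
  fixes f :: "'x \<Rightarrow> 'y \<Rightarrow> 'k::field"
  assumes "finite Y" "finite X" "card Y < card X"
  shows "\<exists>c. (\<exists>x\<in>X. c x \<noteq> 0) \<and> (\<forall>y\<in>Y. (\<Sum>x\<in>X. c x * f x y) = 0)"
  using assms
proof (induction Y arbitrary: X f rule: finite_induct)
  case empty
  then obtain x where "x \<in> X" by fastforce
  then show ?case by (intro exI[of _ "\<lambda>_. 1"]) auto
next
  case (insert y Y)
  show ?case
  proof (cases "\<forall>x\<in>X. f x y = 0")
    case True
    have "\<exists>c. (\<exists>x\<in>X. c x \<noteq> 0) \<and> (\<forall>y\<in>Y. (\<Sum>x\<in>X. c x * f x y) = 0)"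
      by (rule insert.IH) (use insert.prems insert.hyps in auto)
    then show ?thesis using True by auto
  next
    case False
    then obtain x0 where x0: "x0 \<in> X" "f x0 y \<noteq> 0" by auto
    let ?X = "X - {x0}"
    let ?g = "\<lambda>x z. f x z - f x y / f x0 y * f x0 z"
    have "\<exists>c. (\<exists>x\<in>?X. c x \<noteq> 0) \<and> (\<forall>z\<in>Y. (\<Sum>x\<in>?X. c x * ?g x z) = 0)"
      by (rule insert.IH) (use insert.prems insert.hyps x0 in auto)
    then obtain c where c: "\<exists>x\<in>?X. c x \<noteq> 0" "\<And>z. z \<in> Y \<Longrightarrow> (\<Sum>x\<in>?X. c x * ?g x z) = 0"
      by blast
    define k where "k = - (\<Sum>x\<in>?X. c x * f x y) / f x0 y"
    have split: "(\<Sum>x\<in>X. (c(x0 := k)) x * f x z) = k * f x0 z + (\<Sum>x\<in>?X. c x * f x z)" for z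
      using x0(1) insert.prems(1) by (subst sum.remove[of X x0]) auto
    have "(\<Sum>x\<in>X. (c(x0 := k)) x * f x z) = 0" if z: "z \<in> insert y Y" for z
    proof (cases "z = y")
      case True
      then show ?thesis unfolding split using x0(2) by (simp add: k_def)
    next
      case False
      then have "0 = (\<Sum>x\<in>?X. c x * ?g x z)" using c(2) z by simp
      also have "\<dots> = (\<Sum>x\<in>?X. c x * f x z) - (\<Sum>x\<in>?X. c x * f x y) / f x0 y * f x0 z"
        by (simp add: right_diff_distrib sum_subtractf sum_divide_distrib sum_distrib_left
            sum_distrib_right mult_ac)
      finally show ?thesis unfolding split by (simp add: k_def)
    qed
    then show ?thesis using c(1) by (intro exI[of _ "c(x0 := k)"]) auto
  qed
qed

text \<open>Each \<open>y\<close> is regular modulo one ideal of the chain and lies in the next one.\<close>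

fun climb :: "'a::comm_ring_1 set \<Rightarrow> 'a list \<Rightarrow> bool" where
  "climb P [] \<longleftrightarrow> is_ideal P \<and> 1 \<notin> P"
| "climb P (y # ys) \<longleftrightarrow> is_ideal P \<and> (\<forall>a. y * a \<in> P \<longrightarrow> a \<in> P) \<and>
     (\<exists>P'. P \<subseteq> P' \<and> y \<in> P' \<and> climb P' ys)"

fun lpow :: "'a::comm_ring_1 list \<Rightarrow> nat list \<Rightarrow> 'a" where
  "lpow (y # ys) (n # ns) = y ^ n * lpow ys ns"
| "lpow _ _ = 1"

text \<open>A relation may be divided by the least power of \<open>y\<close> in it, since
  \<open>y\<close> is regular modulo \<open>P\<close>. Modulo \<open>P'\<close>, which contains
  \<open>y\<close>, only the terms with exactly this power survive; they form a relation among the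
  remaining elements.\<close>

lemma climb_independent:
  fixes ys :: "('v::finite, 'k::field) mpoly list"
  assumes "climb P ys" "finite X" "\<And>\<alpha>. \<alpha> \<in> X \<Longrightarrow> length \<alpha> = length ys"
    and "(\<Sum>\<alpha>\<in>X. single 0 (c \<alpha>) * lpow ys \<alpha>) \<in> P" and "\<alpha> \<in> X"
  shows "c \<alpha> = 0"
  using assms
proof (induction ys arbitrary: P X c \<alpha>)
  case Nil
  have "X = {[]}" using Nil.prems(3,5) by auto
  then have mem: "single 0 (c []) \<in> P" and "\<alpha> = []" using Nil.prems(4,5) by auto
  show ?case
  proof (rule ccontr)
    assume "c \<alpha> \<noteq> 0"
    then have "(1 :: ('v, 'k) mpoly) = single 0 (1 / c []) * single 0 (c [])"
      by (simp add: mult_single \<open>\<alpha> = []\<close>)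
    also have "\<dots> \<in> P" using mem Nil.prems(1) is_idealD(3) by auto
    finally show False using Nil.prems(1) by simp
  qed
next
  case (Cons y ys)
  have P: "is_ideal P" and reg: "\<And>a. y * a \<in> P \<Longrightarrow> a \<in> P" using Cons.prems(1) by auto
  obtain P' where P': "P \<subseteq> P'" "y \<in> P'" "climb P' ys" using Cons.prems(1) by auto
  have idP': "is_ideal P'" using P'(3) by (cases ys) auto
  show ?case
  proof (rule ccontr)
    assume "c \<alpha> \<noteq> 0"
    define X' where "X' = {\<beta> \<in> X. c \<beta> \<noteq> 0}"
    have X': "finite X'" "\<alpha> \<in> X'" using Cons.prems(2,5) \<open>c \<alpha> \<noteq> 0\<close> by (auto simp: X'_def)
    define m where "m = Min (hd ` X')"
    have "m \<in> hd ` X'" unfolding m_def using X' by (intro Min_in) auto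
    then obtain \<gamma> where \<gamma>: "\<gamma> \<in> X'" "hd \<gamma> = m" by auto
    have mle: "m \<le> hd \<beta>" if "\<beta> \<in> X'" for \<beta> unfolding m_def using X' that by (intro Min_le) auto
    define Z where "Z = {\<beta>. m # \<beta> \<in> X'}"
    have inj: "inj_on (\<lambda>\<beta>. m # \<beta>) Z" by (auto intro: inj_onI)
    have ZX: "(\<lambda>\<beta>. m # \<beta>) ` Z = {\<beta> \<in> X'. hd \<beta> = m}"
      using Cons.prems(3)
        by (auto simp: Z_def X'_def image_iff length_Suc_conv) (metis length_Suc_conv list.sel(1))
    have finZ: "finite Z" using X'(1) ZX inj
      by (metis finite_imageD finite_Collect_conjI Collect_mem_eq)
    define G0 where "G0 = (\<Sum>\<beta>\<in>Z. single 0 (c (m # \<beta>)) * lpow ys \<beta>)"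
    define G1 where
      "G1 = (\<Sum>\<beta>\<in>{\<beta> \<in> X'. hd \<beta> \<noteq> m}. single 0 (c \<beta>) * (y ^ (hd \<beta> - m - 1) * lpow ys (tl \<beta>)))"
    have "(\<Sum>\<alpha>\<in>X. single 0 (c \<alpha>) * lpow (y # ys) \<alpha>) = (\<Sum>\<alpha>\<in>X'. single 0 (c \<alpha>) * lpow (y # ys) \<alpha>)"
      using Cons.prems(2) by (intro sum.mono_neutral_right) (auto simp: X'_def)
    also have "\<dots> = (\<Sum>\<alpha>\<in>{\<beta> \<in> X'. hd \<beta> = m}. single 0 (c \<alpha>) * lpow (y # ys) \<alpha>) +
        (\<Sum>\<alpha>\<in>{\<beta> \<in> X'. hd \<beta> \<noteq> m}. single 0 (c \<alpha>) * lpow (y # ys) \<alpha>)"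
      using X'(1) by (subst sum.union_disjoint[symmetric]) (auto intro: sum.cong)
    also have "(\<Sum>\<alpha>\<in>{\<beta> \<in> X'. hd \<beta> = m}. single 0 (c \<alpha>) * lpow (y # ys) \<alpha>) = y ^ m * G0"
      unfolding ZX[symmetric] G0_def
        by (subst sum.reindex[OF inj]) (simp add: sum_distrib_left mult_ac)
    also have "(\<Sum>\<alpha>\<in>{\<beta> \<in> X'. hd \<beta> \<noteq> m}. single 0 (c \<alpha>) * lpow (y # ys) \<alpha>) = y ^ m * (y * G1)"
      unfolding G1_def sum_distrib_left
    proof (rule sum.cong[OF refl])
      fix \<beta> assume \<beta>: "\<beta> \<in> {\<beta> \<in> X'. hd \<beta> \<noteq> m}"
      then obtain n ns where n: "\<beta> = n # ns" using Cons.prems(3)[of \<beta>]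
        by (cases \<beta>) (auto simp: X'_def)
      have "m < n" using \<beta> mle[of \<beta>] n by auto
      then obtain k where "n = Suc (m + k)" using less_imp_Suc_add by blast
      then show "single 0 (c \<beta>) * lpow (y # ys) \<beta> =
          y ^ m * (y * (single 0 (c \<beta>) * (y ^ (hd \<beta> - m - 1) * lpow ys (tl \<beta>))))"
        by (simp add: n power_add mult_ac)
    qed
    finally have "y ^ m * (G0 + y * G1) \<in> P" using Cons.prems(4) by (simp add: distrib_left)
    then have "G0 + y * G1 \<in> P"
    proof (induction m)
      case (Suc m)
      then show ?case using reg[of "y ^ m * (G0 + y * G1)"] by (simp add: mult.assoc)
    qed simp
    then have "(G0 + y * G1) - y * G1 \<in> P'"
      using P'(1) by (intro is_idealD(6)[OF idP'] is_idealD(4)[OF idP' P'(2)]) auto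
    then have "G0 \<in> P'" by simp
    moreover have "length \<beta> = length ys" if "\<beta> \<in> Z" for \<beta>
      using Cons.prems(3)[of "m # \<beta>"] that by (auto simp: Z_def X'_def)
    moreover obtain \<delta> where \<delta>: "\<delta> \<in> Z" "\<gamma> = m # \<delta>" using \<gamma> ZX by blast
    ultimately have "c (m # \<delta>) = 0"
      using Cons.IH[OF P'(3) finZ, of "\<lambda>\<beta>. c (m # \<beta>)" \<delta>] by (auto simp: G0_def)
    then show False using \<gamma>(1) \<delta>(2) by (simp add: X'_def)
  qed
qed

lemma lookup_mult_bound:
  fixes f g :: "('v, 'k::field) mpoly"
  assumes "\<And>a. a \<in> keys f \<Longrightarrow> lookup a s \<le> m" "\<And>a. a \<in> keys g \<Longrightarrow> lookup a s \<le> n" "a \<in> keys (f * g)"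
  shows "lookup a s \<le> m + n"
  using assms(3) by (elim keys_multE) (auto simp: lookup_add intro: add_mono assms)

lemma keys_power_bound:
  fixes y :: "('v, 'k::field) mpoly"
  assumes "\<And>a. a \<in> keys y \<Longrightarrow> lookup a s \<le> D"
  shows "a \<in> keys (y ^ n) \<Longrightarrow> lookup a s \<le> n * D"
proof (induction n arbitrary: a)
  case (Suc n)
  have "lookup a s \<le> D + n * D"
    by (rule lookup_mult_bound[of y s D "y ^ n"]) (use assms Suc in auto)
  then show ?case by simp
qed simp

lemma keys_lpow_bound:
  fixes ys :: "('v, 'k::field) mpoly list"
  assumes "\<And>y a. y \<in> set ys \<Longrightarrow> a \<in> keys y \<Longrightarrow> lookup a s \<le> D"
  shows "length \<alpha> = length ys \<Longrightarrow> set \<alpha> \<subseteq> {..<N} \<Longrightarrow> a \<in> keys (lpow ys \<alpha>) \<Longrightarrow> lookup a s \<le> length ys * (N * D)"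
  using assms
proof (induction ys arbitrary: \<alpha> a)
  case (Cons y ys)
  obtain n ns where n: "\<alpha> = n # ns" using Cons.prems(1) by (cases \<alpha>) auto
  have "lookup b s \<le> N * D" if "b \<in> keys (y ^ n)" for b
  proof -
    have "lookup b s \<le> n * D" using keys_power_bound[of y s D b n] Cons.prems(4) that by auto
    also have "\<dots> \<le> N * D" using Cons.prems(2) n by (intro mult_right_mono) auto
    finally show ?thesis .
  qed
  moreover have "lookup b s \<le> length ys * (N * D)" if "b \<in> keys (lpow ys ns)" for b
    using Cons.IH[of ns b] Cons.prems that n by auto
  ultimately have "lookup a s \<le> N * D + length ys * (N * D)"
    using Cons.prems(3) n by (intro lookup_mult_bound[of "y ^ n" s _ "lpow ys ns"]) auto
  then show ?case by simp
qed simp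

lemma card_exponent_box:
  "card {a :: 'v::finite \<Rightarrow>\<^sub>0 nat. keys a \<subseteq> S \<and> (\<forall>s. lookup a s < B)} \<le> B ^ card S"
  (is "card ?Y \<le> _") and
  finite_exponent_box: "finite {a :: 'v::finite \<Rightarrow>\<^sub>0 nat. keys a \<subseteq> S \<and> (\<forall>s. lookup a s < B)}"
proof -
  let ?r = "\<lambda>a :: 'v \<Rightarrow>\<^sub>0 nat. restrict (lookup a) S"
  have inj: "inj_on ?r ?Y"
  proof (rule inj_onI, rule poly_mapping_eqI)
    fix a b s assume *: "a \<in> ?Y" "b \<in> ?Y" "?r a = ?r b"
    show "lookup a s = lookup b s"
    proof (cases "s \<in> S")
      case True
      then show ?thesis using fun_cong[OF *(3), of s] by simp
    next
      case False
      then have "s \<notin> keys a" "s \<notin> keys b" using *(1,2) by auto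
      then show ?thesis by (simp add: in_keys_iff)
    qed
  qed
  have sub: "?r ` ?Y \<subseteq> Pi\<^sub>E S (\<lambda>_. {..<B})" by auto
  have fin: "finite (Pi\<^sub>E S (\<lambda>_. {..<B}))" by (intro finite_PiE) auto
  show "finite ?Y" using finite_subset[OF sub fin] inj by (rule finite_imageD)
  have "card ?Y \<le> card (Pi\<^sub>E S (\<lambda>_. {..<B}))" by (rule card_inj_on_le[OF inj sub fin])
  then show "card ?Y \<le> B ^ card S" by (simp add: card_PiE)
qed

text \<open>A count of dimensions replaces transcendence degree. Modulo the variables in
  \<open>A\<close>, the N^h products of the \<open>ys\<close> with exponents below \<open>N\<close>
  lie in the span of fewer than N^h monomials if h > d, and the resulting linear relation
  contradicts independence.\<close>

lemma climb_length:
  fixes ys :: "('v::finite, 'k::field) mpoly list"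
  assumes climb: "climb P ys" and A: "sqfree {K. K \<inter> A \<noteq> {}} \<subseteq> P"
  shows "length ys \<le> card (- A)"
proof (rule ccontr)
  assume long: "\<not> ?thesis"
  define d where "d = card (- A)"
  define h where "h = length ys"
  define D where "D = Max (insert 0 ((\<lambda>(a, s). lookup a s) ` ((\<Union>y\<in>set ys. keys y) \<times> UNIV)))"
  have D: "lookup a s \<le> D" if "y \<in> set ys" "a \<in> keys y" for y a s
    unfolding D_def using that by (intro Max_ge) force+
  \<comment> \<open>The exponents of the products are below \<open>B\<close>, and B <= N K. As N
    exceeds K^d, at most B^d <= N^d K^d < N^(d+1) monomials are involved.\<close>
  define K where "K = h * D + 1"
  define N where "N = K ^ d + 1"
  define B where "B = h * (N * D) + 1"
  define X where "X = {\<alpha> :: nat list. set \<alpha> \<subseteq> {..<N} \<and> length \<alpha> = h}"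
  define Y where "Y = {a :: 'v \<Rightarrow>\<^sub>0 nat. keys a \<subseteq> - A \<and> (\<forall>s. lookup a s < B)}"
  have finX: "finite X" unfolding X_def by (rule finite_lists_length_eq) simp
  have "card Y \<le> B ^ d" unfolding Y_def d_def by (rule card_exponent_box)
  also have "\<dots> \<le> (N * K) ^ d" by (rule power_mono) (simp_all add: B_def K_def N_def algebra_simps)
  also have "\<dots> = N ^ d * K ^ d" by (rule power_mult_distrib)
  also have "\<dots> < N ^ d * N" by (simp add: N_def)
  also have "\<dots> = N ^ Suc d" by simp
  also have "\<dots> \<le> N ^ h" using long by (intro power_increasing) (auto simp: N_def h_def d_def)
  also have "\<dots> = card X" by (simp add: X_def card_lists_length_eq)
  finally have "card Y < card X" .
  from homogeneous_system[OF _ finX this, of "\<lambda>\<alpha> a. lookup (lpow ys \<alpha>) a"]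
  obtain c where c: "\<exists>\<alpha>\<in>X. c \<alpha> \<noteq> 0" "\<And>a. a \<in> Y \<Longrightarrow> (\<Sum>\<alpha>\<in>X. c \<alpha> * lookup (lpow ys \<alpha>) a) = 0"
    using finite_exponent_box[of "- A" B] by (auto simp: Y_def)
  let ?h = "\<Sum>\<alpha>\<in>X. single 0 (c \<alpha>) * lpow ys \<alpha>"
  have "a \<in> {a. keys a \<inter> A \<noteq> {}}" if a: "a \<in> keys ?h" for a
  proof (rule ccontr)
    assume "\<not> ?thesis"
    then have ka: "keys a \<subseteq> - A" by auto
    have nz: "(\<Sum>\<alpha>\<in>X. c \<alpha> * lookup (lpow ys \<alpha>) a) \<noteq> 0"
      using a by (simp add: in_keys_iff lookup_sum lookup_const_mult)
    then obtain \<alpha> where \<alpha>: "\<alpha> \<in> X" "lookup (lpow ys \<alpha>) a \<noteq> 0"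
      by (metis (no_types, lifting) mult_zero_right sum.neutral)
    have "lookup a s < B" for s
      using keys_lpow_bound[of ys s D \<alpha> N a] D \<alpha>
        by (auto simp: X_def B_def h_def in_keys_iff less_Suc_eq_le)
    then have "a \<in> Y" using ka by (simp add: Y_def)
    then show False using c(2) nz by blast
  qed
  then have "?h \<in> P" using A by (auto simp: sqfree_def mon_span_def)
  then have "c \<alpha> = 0" if "\<alpha> \<in> X" for \<alpha>
    using climb_independent[OF climb finX _ _ that, of c] by (auto simp: X_def h_def)
  then show False using c(1) by blast
qed

text \<open>An element of the next prime outside \<open>Q\<close> is regular modulo
  \<open>Q\<close>, because \<open>Q\<close> is prime.\<close>

lemma prime_chain_length:
  fixes Ps :: "('v::finite, 'k::field) mpoly set list"
  assumes "sorted_wrt (\<subset>) (Ps @ [P])" "\<And>Q. Q \<in> set (Ps @ [P]) \<Longrightarrow> is_prime Q"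
    and "sqfree {K. K \<inter> A \<noteq> {}} \<subseteq> hd (Ps @ [P])"
  shows "length Ps \<le> card (- A)"
proof -
  have "\<exists>ys. length ys = length Ps \<and> climb (hd (Ps @ [P])) ys"
    using assms(1,2)
  proof (induction Ps)
    case Nil
    then show ?case by (intro exI[of _ "[]"]) (auto simp: is_prime_def)
  next
    case (Cons Q Ps)
    then obtain ys where ys: "length ys = length Ps" "climb (hd (Ps @ [P])) ys" by auto
    have "hd (Ps @ [P]) \<in> set (Ps @ [P])" by (rule hd_in_set) simp
    then have sub: "Q \<subset> hd (Ps @ [P])" using Cons.prems(1) by auto
    then obtain y where y: "y \<in> hd (Ps @ [P])" "y \<notin> Q" by blast
    have "is_prime Q" using Cons.prems(2) by simp
    then have "climb Q (y # ys)" using y ys(2) sub by (auto simp: is_prime_def)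
    then show ?case using ys(1) by (intro exI[of _ "y # ys"]) simp
  qed
  then show ?thesis using climb_length[OF _ assms(3)] by metis
qed

section \<open>Maximal ideals of polynomial rings\<close>

definition polys_in :: "'v set \<Rightarrow> ('v, 'k::field) mpoly set" where
  "polys_in T = {h. \<forall>a\<in>keys h. keys a \<subseteq> T}"

lemma polys_in_closed:
  fixes f g :: "('v, 'k::field) mpoly"
  shows "0 \<in> polys_in T" "1 \<in> polys_in T"
    "f \<in> polys_in T \<Longrightarrow> g \<in> polys_in T \<Longrightarrow> f + g \<in> polys_in T"
    "f \<in> polys_in T \<Longrightarrow> g \<in> polys_in T \<Longrightarrow> f * g \<in> polys_in T"
    "f \<in> polys_in T \<Longrightarrow> - f \<in> polys_in T"
    "f \<in> polys_in T \<Longrightarrow> g \<in> polys_in T \<Longrightarrow> f - g \<in> polys_in T"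
    "f \<in> polys_in T \<Longrightarrow> f ^ n \<in> polys_in T"
proof -
  show 1: "1 \<in> polys_in T" and "0 \<in> polys_in T" by (auto simp: polys_in_def)
  show add: "f \<in> polys_in T \<Longrightarrow> g \<in> polys_in T \<Longrightarrow> f + g \<in> polys_in T" for f g :: "('v, 'k) mpoly"
    using keys_add[of f g] by (auto simp: polys_in_def)
  show mult: "f \<in> polys_in T \<Longrightarrow> g \<in> polys_in T \<Longrightarrow> f * g \<in> polys_in T" for f g :: "('v, 'k) mpoly"
    unfolding polys_in_def
  proof (intro CollectI ballI)
    fix x assume *: "f \<in> {h. \<forall>a\<in>keys h. keys a \<subseteq> T}" "g \<in> {h. \<forall>a\<in>keys h. keys a \<subseteq> T}"
      "x \<in> keys (f * g)"
    obtain a b where "a \<in> keys f" "b \<in> keys g" "x = a + b" using *(3) by (rule keys_multE)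
    then show "keys x \<subseteq> T" using * by (auto simp: keys_exp_add)
  qed
  show neg: "f \<in> polys_in T \<Longrightarrow> - f \<in> polys_in T" for f :: "('v, 'k) mpoly"
    by (auto simp: polys_in_def in_keys_iff)
  show "f \<in> polys_in T \<Longrightarrow> g \<in> polys_in T \<Longrightarrow> f - g \<in> polys_in T"
    using add[of f "- g"] neg[of g] by simp
  show "f \<in> polys_in T \<Longrightarrow> f ^ n \<in> polys_in T" by (induction n) (auto intro: 1 mult)
qed

lemma polys_in_sum: "(\<And>x. x \<in> A \<Longrightarrow> f x \<in> polys_in T) \<Longrightarrow> sum f A \<in> polys_in T"
  by (induction A rule: infinite_finite_induct) (auto intro: polys_in_closed)

lemma polys_in_prod: "(\<And>x. x \<in> A \<Longrightarrow> f x \<in> polys_in T) \<Longrightarrow> prod f A \<in> polys_in T"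
  by (induction A rule: infinite_finite_induct) (auto intro: polys_in_closed)

text \<open>The determinant trick, carried out by eliminating the generators \<open>X i\<close> one at a time.\<close>

lemma nakayama_elimination:
  fixes P :: "'a::comm_ring_1 set" and X :: "'i \<Rightarrow> 'a"
  assumes P: "is_ideal P"
    and R: "\<And>f g. f \<in> R \<Longrightarrow> g \<in> R \<Longrightarrow> f + g \<in> R" "\<And>f g. f \<in> R \<Longrightarrow> g \<in> R \<Longrightarrow> f * g \<in> R"
    and U: "1 \<in> U" "\<And>f g. f \<in> U \<Longrightarrow> g \<in> U \<Longrightarrow> f * g \<in> U" "\<And>f g. f \<in> U \<Longrightarrow> g \<in> R \<Longrightarrow> f - q * g \<in> U" "U \<subseteq> R"
      "q \<in> R"
    and "finite B"
    and "\<And>i. i \<in> B \<Longrightarrow> \<exists>c\<in>U. \<exists>r. (\<forall>j. r j \<in> R) \<and> c * X i - q * (\<Sum>j\<in>B. r j * X j) \<in> P"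
  shows "\<exists>c\<in>U. \<forall>i\<in>B. c * X i \<in> P"
  using assms(9,10)
proof (induction B rule: finite_induct)
  case empty
  then show ?case using U(1) by auto
next
  case (insert b B)
  note PD = is_idealD[OF P]
  obtain c r where c: "c \<in> U" "\<And>j. r j \<in> R" "c * X b - q * (\<Sum>j\<in>insert b B. r j * X j) \<in> P"
    using insert.prems[of b] by blast
  \<comment> \<open>The diagonal term of equation \<open>b\<close> moves into the coefficient of
    \<open>X b\<close>, which stays in \<open>U\<close>.\<close>
  define u where "u = c - q * r b"
  have u: "u \<in> U" using U(3) c by (simp add: u_def)
  have ub: "u * X b - q * (\<Sum>j\<in>B. r j * X j) \<in> P"
    using c(3) insert.hyps by (simp add: u_def algebra_simps)
  have "\<exists>c\<in>U. \<forall>i\<in>B. c * X i \<in> P"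
  proof (rule insert.IH)
    fix i assume "i \<in> B"
    then obtain e s where e: "e \<in> U" "\<And>j. s j \<in> R" "e * X i - q * (\<Sum>j\<in>insert b B. s j * X j) \<in> P"
      using insert.prems[of i] by blast
    \<comment> \<open>Equation \<open>i\<close> is multiplied by \<open>u\<close>, and then
      \<open>X b\<close> is eliminated by means of \<open>ub\<close>; the common factor
      \<open>q\<close> survives.\<close>
    let ?t = "\<lambda>j. s b * (q * r j) + u * s j"
    have "(u * e) * X i - q * (\<Sum>j\<in>B. ?t j * X j) =
        u * (e * X i - q * (\<Sum>j\<in>insert b B. s j * X j)) +
        (q * s b) * (u * X b - q * (\<Sum>j\<in>B. r j * X j))"
      using insert.hyps by (simp add: algebra_simps sum.distrib sum_distrib_left)
    also have "\<dots> \<in> P" by (rule PD(2)[OF PD(3)[OF e(3)] PD(3)[OF ub]])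
    finally have "(u * e) * X i - q * (\<Sum>j\<in>B. ?t j * X j) \<in> P" .
    moreover have "u * e \<in> U" using u e U(2) by blast
    moreover have "?t j \<in> R" for j
    proof -
      have "u \<in> R" using u U(4) by blast
      then show ?thesis using R c(2)[of j] e(2)[of b] e(2)[of j] U(5) by simp
    qed
    ultimately show "\<exists>c\<in>U. \<exists>r. (\<forall>j. r j \<in> R) \<and> c * X i - q * (\<Sum>j\<in>B. r j * X j) \<in> P"
      by (intro bexI[of _ "u * e"] exI[of _ ?t]) auto
  qed
  then obtain c0 where c0: "c0 \<in> U" "\<And>i. i \<in> B \<Longrightarrow> c0 * X i \<in> P" by blast
  have "(c0 * u) * X i \<in> P" if "i \<in> insert b B" for i
  proof (cases "i = b")
    case True
    have "(c0 * u) * X b = c0 * (u * X b - q * (\<Sum>j\<in>B. r j * X j)) + (\<Sum>j\<in>B. (q * r j) * (c0 * X j))"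
      by (simp add: algebra_simps sum_distrib_left)
    also have "\<dots> \<in> P"
      by (intro PD(2) PD(3)[OF ub] is_ideal_sum[OF P] PD(3) c0(2))
    finally show ?thesis using True by simp
  next
    case False
    then have "c0 * X i \<in> P" using c0(2) that by auto
    then have "u * (c0 * X i) \<in> P" by (rule PD(3))
    then show ?thesis by (simp add: mult_ac)
  qed
  then show ?case using U(2)[OF c0(1) u] by blast
qed

lemma exponent_split:
  fixes a :: "'v::finite \<Rightarrow>\<^sub>0 nat"
  shows "\<exists>c b. a = c + b \<and> keys c \<subseteq> T \<and> keys b \<subseteq> - T \<and> (\<forall>s. s \<notin> T \<longrightarrow> lookup b s = lookup a s)"
proof -
  let ?c = "Abs_poly_mapping (\<lambda>s. if s \<in> T then lookup a s else 0)"
  let ?b = "Abs_poly_mapping (\<lambda>s. if s \<in> T then 0 else lookup a s)"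
  have "a = ?c + ?b" by (rule poly_mapping_eqI) (simp add: lookup_add)
  moreover have "keys ?c \<subseteq> T" "keys ?b \<subseteq> - T" by (auto simp: in_keys_iff split: if_splits)
  ultimately show ?thesis by (intro exI[of _ ?c] exI[of _ ?b]) simp
qed

text \<open>\<open>n\<close> and \<open>c\<close> are the degree and the leading coefficient of
  \<open>p\<close> read as a polynomial in \<open>v\<close> over k[T].\<close>

lemma coefficient_of_variable:
  fixes p :: "('v::finite, 'k::field) mpoly"
  assumes "p \<in> polys_in (insert v T)" "p \<noteq> 0" "v \<notin> T"
  obtains n c where "c \<noteq> 0" "c \<in> polys_in T"
    "\<And>a. a \<in> keys (p - c * xmon (single v n)) \<Longrightarrow> keys a \<subseteq> insert v T \<and> lookup a v < n"
proof -
  define n where "n = Max ((\<lambda>a. lookup a v) ` keys p)"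
  have "n \<in> (\<lambda>a. lookup a v) ` keys p" unfolding n_def using assms(2) by (intro Max_in) auto
  then obtain a0 where a0: "a0 \<in> keys p" "lookup a0 v = n" by auto
  have mx: "lookup a v \<le> n" if "a \<in> keys p" for a unfolding n_def using that by (intro Max_ge) auto
  let ?e = "single v n"
  define c where "c = (\<Sum>a\<in>{a \<in> keys p. lookup a v = n}. single (a - ?e) (lookup p a))"
  have ae: "(a - ?e) + ?e = a" if "lookup a v = n" for a
    using exp_diff_add[of ?e a] that by (auto simp: lookup_single when_def add.commute)
  have ce: "c * xmon ?e = (\<Sum>a\<in>{a \<in> keys p. lookup a v = n}. single a (lookup p a))"
    unfolding c_def sum_distrib_right
    by (intro sum.cong refl) (simp add: xmon_def mult_single ae)
  have lc: "lookup (c * xmon ?e) a = (if lookup a v = n then lookup p a else 0)" for a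
    unfolding ce by (simp add: lookup_sum lookup_single when_def in_keys_iff sum.delta)
  show thesis
  proof (rule that[of c n])
    show "c \<noteq> 0"
    proof
      assume "c = 0"
      then show False using lc[of a0] a0 by (simp add: in_keys_iff)
    qed
    show "c \<in> polys_in T"
      unfolding c_def
    proof (rule polys_in_sum)
      fix a assume a: "a \<in> {a \<in> keys p. lookup a v = n}"
      have "keys (a - ?e) \<subseteq> T"
      proof
        fix x assume "x \<in> keys (a - ?e)"
        then have "x \<in> keys a" "x \<noteq> v"
          using a by (auto simp: in_keys_iff lookup_minus lookup_single when_def split: if_splits)
        then show "x \<in> T" using a assms(1) by (auto simp: polys_in_def)
      qed
      then show "single (a - ?e) (lookup p a) \<in> polys_in T" by (auto simp: polys_in_def)
    qed
    fix a assume "a \<in> keys (p - c * xmon ?e)"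
    then have "lookup a v \<noteq> n" "a \<in> keys p"
      by (auto simp: in_keys_iff lookup_minus lc split: if_splits)
    then show "keys a \<subseteq> insert v T \<and> lookup a v < n"
      using mx[of a] assms(1) by (auto simp: polys_in_def)
  qed
qed

text \<open>The lexicographically largest exponents of \<open>q\<close> and \<open>r\<close> add up
  to an exponent of 1, so both vanish.\<close>

lemma unit_is_constant:
  fixes q r :: "('v::finite, 'k::field) mpoly"
  assumes "q * r = 1" "a \<in> keys q"
  shows "a = 0"
proof (rule ccontr)
  assume "a \<noteq> 0"
  have "keys q \<noteq> {}" "keys r \<noteq> {}" using assms by auto
  then obtain m n where m: "m \<in> keys q" "\<forall>x\<in>keys q. x = m \<or> lexless x m"
    and n: "n \<in> keys r" "\<forall>x\<in>keys r. x = n \<or> lexless x n"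
    using lex_max_exists[of "keys q"] lex_max_exists[of "keys r"] by auto
  have "lookup (q * r) (m + n) = lookup q m * lookup r n"
  proof (rule lookup_mult_unique)
    fix a' b' assume "a' \<in> keys q" "b' \<in> keys r" "a' + b' = m + n"
    then show "a' = m \<and> b' = n" using m(2) n(2) by (intro lex_max_add) auto
  qed
  then have "m + n \<in> keys (q * r)" using m(1) n(1) by (simp add: in_keys_iff)
  then have "m + n = 0" using assms(1) by simp
  then have "m = 0" by (metis add_is_0 lookup_add lookup_zero poly_mapping_eqI)
  then have "lexless a 0" using m(2) assms(2) \<open>a \<noteq> 0\<close> by auto
  then show False by (simp add: lexless_def)
qed

lemma power_minus_one_mod: "\<exists>y. (q - 1) ^ m = (- 1) ^ m + q * y" for q :: "'a::comm_ring_1"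
proof (induction m)
  case 0
  show ?case by (intro exI[of _ 0]) simp
next
  case (Suc m)
  then obtain y where y: "(q - 1) ^ m = (- 1) ^ m + q * y" by auto
  show ?case by (intro exI[of _ "(- 1) ^ m + q * y - y"]) (simp add: y algebra_simps)
qed

lemma mpoly_prod_nonzero:
  "finite A \<Longrightarrow> (\<And>x. x \<in> A \<Longrightarrow> f x \<noteq> (0 :: ('v::finite, 'k::field) mpoly)) \<Longrightarrow> prod f A \<noteq> 0"
  by (induction A rule: finite_induct) (auto dest: mpoly_no_zero_divisors)

text \<open>Otherwise let \<open>T\<close> be a largest set of variables containing \<open>s\<close>
  that is independent modulo \<open>P\<close>. After inverting some \<open>a\<close> in k[T] the
  residue field is finite over k[T], so every nonzero element of k[T] divides a power of
  \<open>a\<close>. But 1 + a x_s does not.\<close>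

lemma zariski:
  fixes P :: "('v::finite, 'k::field) mpoly set"
  assumes P: "is_maximal P"
  shows "\<exists>p. p \<noteq> 0 \<and> p \<in> P \<and> p \<in> polys_in {s}"
proof (rule ccontr)
  assume "\<not> ?thesis"
  then have s: "polys_in {s} \<inter> P \<subseteq> {0}" by auto
  have idP: "is_ideal P" and inv: "\<And>a. a \<notin> P \<Longrightarrow> \<exists>w. a * w - 1 \<in> P" using P
    by (auto simp: is_maximal_def)
  note PD = is_idealD[OF idP]
  have "\<exists>T. s \<in> T \<and> polys_in T \<inter> P \<subseteq> {0} \<and> (\<forall>v. v \<notin> T \<longrightarrow> \<not> polys_in (insert v T) \<inter> P \<subseteq> {0})"
  proof -
    let ?F = "{T. s \<in> T \<and> polys_in T \<inter> P \<subseteq> {0}}"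
    have "finite ?F" "{s} \<in> ?F" using s by auto
    from finite_has_maximal2[OF this] obtain T
      where T: "T \<in> ?F" "\<And>U. U \<in> ?F \<Longrightarrow> T \<subseteq> U \<Longrightarrow> T = U" by (elim bexE) simp
    have "\<not> polys_in (insert v T) \<inter> P \<subseteq> {0}" if "v \<notin> T" for v
    proof
      assume "polys_in (insert v T) \<inter> P \<subseteq> {0}"
      then have "insert v T \<in> ?F" using T(1) by auto
      from T(2)[OF this] that show False by auto
    qed
    then show ?thesis using T(1) by blast
  qed
  then obtain T where T: "s \<in> T" "polys_in T \<inter> P \<subseteq> {0}"
    "\<And>v. v \<notin> T \<Longrightarrow> \<not> polys_in (insert v T) \<inter> P \<subseteq> {0}" by blast
  let ?R = "polys_in T :: ('v, 'k) mpoly set"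
  note R = polys_in_closed[where T = T]
  have "\<exists>p n c. p \<in> P \<and> c \<noteq> 0 \<and> c \<in> ?R \<and>
      (\<forall>a\<in>keys (p - c * xmon (single v n)). keys a \<subseteq> insert v T \<and> lookup a v < n)" if v: "v \<notin> T" for v
  proof -
    obtain p where p: "p \<in> polys_in (insert v T)" "p \<in> P" "p \<noteq> 0" using T(3)[OF v] by auto
    obtain n c where "c \<noteq> 0" "c \<in> polys_in T"
      "\<And>a. a \<in> keys (p - c * xmon (single v n)) \<Longrightarrow> keys a \<subseteq> insert v T \<and> lookup a v < n"
      using coefficient_of_variable[OF p(1,3) v] by metis
    then show ?thesis using p(2) by blast
  qed
  then obtain p n c where pc: "\<And>v. v \<notin> T \<Longrightarrow> p v \<in> P" "\<And>v. v \<notin> T \<Longrightarrow> c v \<noteq> 0" "\<And>v. v \<notin> T \<Longrightarrow> c v \<in> ?R"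
    "\<And>v a. v \<notin> T \<Longrightarrow> a \<in> keys (p v - c v * xmon (single v (n v))) \<Longrightarrow> keys a \<subseteq> insert v T \<and> lookup a v < n v"
    by metis
  \<comment> \<open>In degree 0, \<open>p v\<close> would be its own leading coefficient, a nonzero
    element of k[T] in \<open>P\<close>.\<close>
  have npos: "0 < n v" if v: "v \<notin> T" for v
  proof (rule ccontr)
    assume "\<not> 0 < n v"
    then have n0: "n v = 0" by simp
    have "a \<notin> keys (p v - c v * xmon (single v (n v)))" for a
    proof
      assume "a \<in> keys (p v - c v * xmon (single v (n v)))"
      from pc(4)[OF v this] show False using n0 by simp
    qed
    then have "keys (p v - c v * xmon (single v (n v))) = {}" by blast
    then have "p v - c v * xmon (single v (n v)) = 0" by (simp only: keys_eq_empty)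
    then have "p v = c v" using n0 by simp
    then show False using pc(1-3)[OF v] T(2) by auto
  qed
  have out: "lookup a v = 0" if "r \<in> ?R" "a \<in> keys r" "v \<notin> T" for r a v
  proof -
    have "v \<notin> keys a" using that by (auto simp: polys_in_def)
    then show ?thesis by (simp add: in_keys_iff)
  qed
  \<comment> \<open>after inverting the product \<open>a\<close> of the leading coefficients, the finitely generated
    \<open>k[T]\<close>-module \<open>E\<close> maps onto the residue field of \<open>P\<close>\<close>
  define E where "E = {h :: ('v, 'k) mpoly. \<forall>a\<in>keys h. \<forall>v. v \<notin> T \<longrightarrow> lookup a v < n v}"
  define EP where "EP = {e + p | e p. e \<in> E \<and> p \<in> P}"
  have E_add: "f + g \<in> E" if "f \<in> E" "g \<in> E" for f g
    using that keys_add[of f g] by (auto simp: E_def)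
  have E_mult: "r * f \<in> E" if r: "r \<in> ?R" and f: "f \<in> E" for r f
    unfolding E_def
  proof (intro CollectI ballI allI impI)
    fix x v assume x: "x \<in> keys (r * f)" "v \<notin> T"
    obtain a b where ab: "a \<in> keys r" "b \<in> keys f" "x = a + b" using x(1) by (rule keys_multE)
    have "lookup a v = 0" by (rule out[OF r ab(1) x(2)])
    then show "lookup x v < n v" using ab f x(2) by (simp add: E_def lookup_add)
  qed
  have RE: "r \<in> E" if r: "r \<in> ?R" for r
    unfolding E_def
  proof (intro CollectI ballI allI impI)
    fix a v assume "a \<in> keys r" "v \<notin> T"
    then show "lookup a v < n v" using out[OF r] npos by simp
  qed
  have EP_add: "f + g \<in> EP" if "f \<in> EP" "g \<in> EP" for f g
  proof -
    obtain e p e' p' where "e \<in> E" "p \<in> P" "f = e + p" "e' \<in> E" "p' \<in> P" "g = e' + p'"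
      using \<open>f \<in> EP\<close> \<open>g \<in> EP\<close> unfolding EP_def by blast
    moreover have "(e + p) + (e' + p') = (e + e') + (p + p')" by (simp add: algebra_simps)
    ultimately show ?thesis using E_add PD(2) unfolding EP_def by blast
  qed
  have EP_mult: "r * f \<in> EP" if "r \<in> ?R" "f \<in> EP" for r f
  proof -
    obtain e p where e: "e \<in> E" "p \<in> P" "f = e + p" using \<open>f \<in> EP\<close> unfolding EP_def by blast
    have "r * f = r * e + r * p" by (simp add: e(3) distrib_left)
    then show ?thesis using E_mult[OF that(1) e(1)] PD(3)[OF e(2), of r] unfolding EP_def by blast
  qed
  have E_EP: "f \<in> EP" if "f \<in> E" for f
  proof -
    have "f = f + 0" by simp
    then show ?thesis using that PD(1) unfolding EP_def by blast
  qed
  have P_EP: "f \<in> EP" if "f \<in> P" for f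
  proof -
    have "f = 0 + f" by simp
    then show ?thesis using that RE[OF R(1)] unfolding EP_def by blast
  qed
  define a where "a = (\<Prod>v\<in>- T. c v)"
  have aR: "a \<in> ?R" unfolding a_def using pc(3) by (intro polys_in_prod) auto
  have a0: "a \<noteq> 0" unfolding a_def using pc(2) by (intro mpoly_prod_nonzero) auto
  have EP_sum: "sum f A \<in> EP" if "\<And>x. x \<in> A \<Longrightarrow> f x \<in> EP" for f and A :: "('v \<Rightarrow>\<^sub>0 nat) set"
    using that by (induction A rule: infinite_finite_induct) (simp_all add: EP_add P_EP PD(1))
  \<comment> \<open>When the exponent of \<open>v\<close> reaches \<open>n v\<close>, the relation
    \<open>p v\<close> rewrites this power at the price of the factor \<open>c v\<close>.\<close>
  have cstep: "c v * (xmon (single v 1) * single b k) \<in> EP"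
    if v: "v \<notin> T" and b: "\<And>w. w \<notin> T \<Longrightarrow> lookup b w < n w" for v b and k :: 'k
  proof (cases "Suc (lookup b v) < n v")
    case True
    have "xmon (single v 1) * single b k \<in> E"
      using True b
        by (auto simp: E_def xmon_def mult_single lookup_add lookup_single when_def split: if_splits)
    then show ?thesis using E_EP EP_mult pc(3)[OF v] by blast
  next
    case False
    then have nv: "n v = Suc (lookup b v)" using b[OF v] by simp
    define b' where "b' = b - single v (lookup b v)"
    have bb': "b = single v (lookup b v) + b'"
      unfolding b'_def by (rule exp_diff_add[symmetric]) (simp add: lookup_single when_def)
    have b'v: "lookup b' v = 0" "\<And>w. w \<noteq> v \<Longrightarrow> lookup b' w = lookup b w"
      by (auto simp: b'_def lookup_minus lookup_single when_def)
    have "single v 1 + b = single v (n v) + b'"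
      by (rule poly_mapping_eqI) (auto simp: lookup_add lookup_single when_def nv b'v)
    then have eq: "xmon (single v 1) * single b k = xmon (single v (n v)) * single b' k"
      by (simp add: xmon_def mult_single)
    define r where "r = p v - c v * xmon (single v (n v))"
    have "r * single b' (- k) \<in> E"
      unfolding E_def
    proof (intro CollectI ballI allI impI)
      fix x w assume x: "x \<in> keys (r * single b' (- k))" "w \<notin> T"
      obtain y z where yz: "y \<in> keys r" "z \<in> keys (single b' (- k))" "x = y + z" using x(1)
        by (rule keys_multE)
      have z: "z = b'" using yz(2) by (auto split: if_splits)
      have y: "keys y \<subseteq> insert v T" "lookup y v < n v" using pc(4)[OF v] yz(1) by (auto simp: r_def)
      show "lookup x w < n w"
      proof (cases "w = v")
        case True
        then show ?thesis using y(2) b'v(1) by (simp add: yz(3) z lookup_add)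
      next
        case False
        then have "lookup y w = 0" using y(1) x(2) by (auto simp: in_keys_iff)
        then show ?thesis using b[OF x(2)] b'v(2)[OF False] by (simp add: yz(3) z lookup_add)
      qed
    qed
    moreover have "single b' k * p v \<in> P" using pc(1)[OF v] by (rule PD(3))
    moreover have "c v * (xmon (single v 1) * single b k) = r * single b' (- k) + single b' k * p v"
      unfolding eq r_def by (simp add: single_uminus algebra_simps)
    ultimately show ?thesis unfolding EP_def by blast
  qed
  have step: "a * (xmon (single v 1) * f) \<in> EP" if v: "v \<notin> T" and f: "f \<in> EP" for v f
  proof -
    obtain e p where e: "e \<in> E" "p \<in> P" "f = e + p" using f unfolding EP_def by blast
    define a' where "a' = (\<Prod>w\<in>- T - {v}. c w)"
    have a': "a = a' * c v" unfolding a_def a'_def using v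
      by (subst prod.remove[of _ v]) (auto simp: mult.commute)
    have a'R: "a' \<in> ?R" unfolding a'_def using pc(3) by (intro polys_in_prod) auto
    have "c v * (xmon (single v 1) * e) = (\<Sum>b\<in>keys e. c v * (xmon (single v 1) * single b (lookup e b)))"
      by (subst poly_expand[of e]) (simp add: sum_distrib_left)
    also have "\<dots> \<in> EP" using e(1) by (intro EP_sum cstep[OF v]) (auto simp: E_def)
    finally have "a' * (c v * (xmon (single v 1) * e)) \<in> EP" by (rule EP_mult[OF a'R])
    moreover have "(a * xmon (single v 1)) * p \<in> EP" by (rule P_EP[OF PD(3)[OF e(2)]])
    ultimately have "a' * (c v * (xmon (single v 1) * e)) + (a * xmon (single v 1)) * p \<in> EP"
      by (rule EP_add)
    then show ?thesis by (simp add: e(3) a' algebra_simps)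
  qed
  \<comment> \<open>What falls into \<open>EP\<close> after multiplication by a power of
    \<open>a\<close>; this turns out to be the whole ring.\<close>
  define W where "W = {h. \<exists>m. a ^ m * h \<in> EP}"
  have WI: "h \<in> W" if "a ^ m * h \<in> EP" for h m using that unfolding W_def by blast
  have W_add: "f + g \<in> W" if fg: "f \<in> W" "g \<in> W" for f g
  proof -
    obtain m m' where m: "a ^ m * f \<in> EP" "a ^ m' * g \<in> EP" using fg by (auto simp: W_def)
    have "a ^ m' * (a ^ m * f) + a ^ m * (a ^ m' * g) \<in> EP"
      by (intro EP_add EP_mult m R(7)[OF aR])
    then have "a ^ (m + m') * (f + g) \<in> EP" by (simp add: power_add algebra_simps)
    then show ?thesis by (rule WI)
  qed
  have W_single: "single b k \<in> W" for b and k :: 'k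
  proof (induction "tot b" arbitrary: b)
    case 0
    then have "b = 0" by (intro poly_mapping_eqI) (simp add: tot_def)
    then have "single b k \<in> ?R" by (auto simp: polys_in_def)
    then have "a ^ 0 * single b k \<in> EP" using RE E_EP by simp
    then show ?case by (rule WI)
  next
    case (Suc x)
    show ?case
    proof (cases "keys b \<subseteq> T")
      case True
      then have "single b k \<in> ?R" by (auto simp: polys_in_def)
      then have "a ^ 0 * single b k \<in> EP" using RE E_EP by simp
      then show ?thesis by (rule WI)
    next
      case False
      then obtain v where v: "v \<in> keys b" "v \<notin> T" by auto
      define b' where "b' = b - single v 1"
      have bb': "b = single v 1 + b'"
        unfolding b'_def
          by (rule exp_diff_add[symmetric]) (use v in \<open>auto simp: lookup_single when_def in_keys_iff\<close>)
      have "tot b = Suc (tot b')"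
        by (subst bb') (simp add: tot_def lookup_add sum.distrib lookup_single when_def)
      then have "single b' k \<in> W" using Suc by simp
      then obtain m where m: "a ^ m * single b' k \<in> EP" by (auto simp: W_def)
      have "single b k = xmon (single v 1) * single b' k"
        by (subst bb') (simp add: xmon_def mult_single)
      then have "a ^ Suc m * single b k = a * (xmon (single v 1) * (a ^ m * single b' k))"
        by (simp add: mult_ac)
      then have "a ^ Suc m * single b k \<in> EP" using step[OF v(2) m] by (simp only:)
      then show ?thesis by (rule WI)
    qed
  qed
  have W_all: "h \<in> W" for h
  proof -
    have "(\<Sum>a\<in>A. single a (lookup h a)) \<in> W" if "finite A" for A
      using that
    proof (induction A rule: finite_induct)
      case empty
      have "a ^ 0 * 0 \<in> EP" using P_EP PD(1) by simp
      then have "0 \<in> W" by (rule WI)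
      then show ?case by simp
    qed (auto intro: W_add W_single)
    then show ?thesis by (subst poly_expand) simp
  qed
  define B where "B = {b :: 'v \<Rightarrow>\<^sub>0 nat. keys b \<subseteq> - T \<and> (\<forall>v. v \<notin> T \<longrightarrow> lookup b v < n v)}"
  have finB: "finite B"
  proof (rule finite_subset)
    show "B \<subseteq> {b. keys b \<subseteq> - T \<and> (\<forall>s. lookup b s < Suc (sum n UNIV))}"
    proof
      fix b assume b: "b \<in> B"
      have "lookup b v < Suc (sum n UNIV)" for v
      proof (cases "v \<in> T")
        case True
        then have "v \<notin> keys b" using b by (auto simp: B_def)
        then show ?thesis by (simp add: in_keys_iff)
      next
        case False
        have "n v \<le> sum n UNIV" by (rule member_le_sum) auto
        moreover have "lookup b v < n v" using b False by (simp add: B_def)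
        ultimately show ?thesis by linarith
      qed
      then show "b \<in> {b. keys b \<subseteq> - T \<and> (\<forall>s. lookup b s < Suc (sum n UNIV))}" using b
        by (auto simp: B_def)
    qed
  qed (rule finite_exponent_box)
  have E_span: "\<exists>r. (\<forall>j. r j \<in> ?R) \<and> e = (\<Sum>j\<in>B. r j * xmon j)" if e: "e \<in> E" for e
  proof -
    let ?S = "{\<Sum>j\<in>B. r j * xmon j | r. \<forall>j. r j \<in> ?R}"
    have SI: "x \<in> ?S" if "x = (\<Sum>j\<in>B. r j * xmon j)" "\<forall>j. r j \<in> ?R" for x r
      by (rule CollectI, rule exI[of _ r]) (use that in simp)
    have S_add: "f + g \<in> ?S" if "f \<in> ?S" "g \<in> ?S" for f g
    proof -
      obtain r r' where r: "\<forall>j. r j \<in> ?R" "\<forall>j. r' j \<in> ?R" "f = (\<Sum>j\<in>B. r j * xmon j)"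
        "g = (\<Sum>j\<in>B. r' j * xmon j)"
        using \<open>f \<in> ?S\<close> \<open>g \<in> ?S\<close> by blast
      have "f + g = (\<Sum>j\<in>B. (r j + r' j) * xmon j)" by (simp add: r distrib_right sum.distrib)
      then show ?thesis by (rule SI) (use r R(3) in blast)
    qed
    have S_single: "single x k \<in> ?S" if x: "\<And>v. v \<notin> T \<Longrightarrow> lookup x v < n v" for x and k :: 'k
    proof -
      obtain d b where bd: "x = d + b" "keys d \<subseteq> T" "keys b \<subseteq> - T"
        "\<And>s. s \<notin> T \<Longrightarrow> lookup b s = lookup x s"
        using exponent_split[of x T] by auto
      have bB: "b \<in> B" using bd x by (auto simp: B_def)
      have "single x k = (\<Sum>j\<in>B. (if j = b then single d k else 0) * xmon j)"
        using bB finB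
          by (simp add: if_distrib[of "\<lambda>x. x * _"] bd(1) xmon_def mult_single cong: if_cong)
      then show ?thesis by (rule SI) (use bd(2) in \<open>auto simp: polys_in_def\<close>)
    qed
    have "(\<Sum>x\<in>A. single x (lookup e x)) \<in> ?S" if "finite A" "A \<subseteq> keys e" for A
      using that
    proof (induction A rule: finite_induct)
      case empty
      have "0 = (\<Sum>j\<in>B. 0 * xmon j)" by simp
      then have "0 \<in> ?S" by (rule SI) (use R(1) in blast)
      then show ?case by simp
    next
      case (insert x A)
      have "single x (lookup e x) \<in> ?S" using e insert.prems by (intro S_single) (auto simp: E_def)
      then show ?case using insert S_add by simp
    qed
    from this[of "keys e"] have "e \<in> ?S" using poly_expand[of e] by simp
    then show ?thesis by blast
  qed
  \<comment> \<open>\<open>q\<close> is invertible modulo \<open>P\<close>, hence divides a power of \<open>a\<close> in \<open>k[T]\<close>, although it is coprime to \<open>a\<close>\<close>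
  define q where "q = 1 + a * xmon (single s 1)"
  have qR: "q \<in> ?R" unfolding q_def using T(1) by (intro R(2-4) aR) (auto simp: polys_in_def)
  have shift: "lookup (a * xmon (single s 1)) (single s 1 + x) = lookup a x" for x
    using lookup_xmon_mult[of "single s 1" a x] by (simp add: mult.commute)
  obtain x where x: "x \<in> keys a" using a0 by (metis keys_eq_empty equals0I)
  have x1: "single s 1 + x \<noteq> 0"
  proof
    assume "single s 1 + x = 0"
    then have "lookup (single s 1 + x) s = 0" by simp
    then show False by (simp add: lookup_add)
  qed
  have qkey: "single s 1 + x \<in> keys q"
  proof -
    have "lookup q (single s 1 + x) = lookup a x"
      unfolding q_def lookup_add[of 1] shift lookup_one using x1 by (simp add: when_def)
    then show ?thesis using x unfolding in_keys_iff by (simp only:) simp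
  qed
  then have "q \<notin> P" using T(2) qR by auto
  then obtain w where w: "q * w - 1 \<in> P" using inv by blast
  define U where "U = {c. c \<in> ?R \<and> (\<exists>m r. r \<in> ?R \<and> c = a ^ m + q * r)}"
  \<comment> \<open>As \<open>w\<close> inverts \<open>q\<close> modulo \<open>P\<close>, each a^m
    x^b becomes \<open>q\<close> times an element of \<open>E\<close>. Elimination gives
    \<open>u\<close> in k[T], congruent to a power of \<open>a\<close> modulo \<open>q\<close>, that
    annihilates all the generators modulo \<open>P\<close>.\<close>
  have "\<exists>u\<in>U. \<forall>b\<in>B. u * xmon b \<in> P"
  proof (rule nakayama_elimination[OF idP R(3,4), of U q B xmon])
    have "1 = a ^ 0 + q * 0" by simp
    then show "1 \<in> U" using R(1,2) unfolding U_def by blast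
    show "f * g \<in> U" if fg: "f \<in> U" "g \<in> U" for f g
    proof -
      obtain m r m' r' where m: "r \<in> ?R" "f = a ^ m + q * r" "r' \<in> ?R" "g = a ^ m' + q * r'"
        using fg unfolding U_def by blast
      have "f * g = a ^ (m + m') + q * (r * a ^ m' + a ^ m * r' + q * r * r')"
        by (simp add: m power_add algebra_simps)
      moreover have "r * a ^ m' + a ^ m * r' + q * r * r' \<in> ?R" by (intro R(3,4,7) aR qR m)
      moreover have "f * g \<in> ?R" using fg R(4) by (auto simp: U_def)
      ultimately show ?thesis unfolding U_def by blast
    qed
    show "f - q * g \<in> U" if fg: "f \<in> U" "g \<in> ?R" for f g
    proof -
      obtain m r where m: "r \<in> ?R" "f = a ^ m + q * r" "f \<in> ?R" using fg unfolding U_def by blast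
      have "f - q * g = a ^ m + q * (r - g)" by (simp add: m(2) algebra_simps)
      moreover have "r - g \<in> ?R" by (intro R(6) m fg)
      moreover have "f - q * g \<in> ?R" by (intro R(6) R(4) m fg qR)
      ultimately show ?thesis unfolding U_def by blast
    qed
    show "U \<subseteq> ?R" by (auto simp: U_def)
    show "\<exists>u\<in>U. \<exists>r. (\<forall>j. r j \<in> ?R) \<and> u * xmon b - q * (\<Sum>j\<in>B. r j * xmon j) \<in> P" if "b \<in> B" for b
    proof -
      obtain m where "a ^ m * (w * xmon b) \<in> EP" using W_all[of "w * xmon b"] by (auto simp: W_def)
      then obtain e y where e: "e \<in> E" "y \<in> P" "a ^ m * (w * xmon b) = e + y" unfolding EP_def
        by blast
      obtain r where r: "\<forall>j. r j \<in> ?R" "e = (\<Sum>j\<in>B. r j * xmon j)" using E_span[OF e(1)] by blast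
      have ey: "e = a ^ m * (w * xmon b) - y" using e(3) by simp
      have "a ^ m * xmon b - q * e = (- (a ^ m * xmon b)) * (q * w - 1) + q * y"
        unfolding ey by (simp add: algebra_simps)
      also have "\<dots> \<in> P" by (rule PD(2)[OF PD(3)[OF w] PD(3)[OF e(2)]])
      finally have "a ^ m * xmon b - q * (\<Sum>j\<in>B. r j * xmon j) \<in> P" by (simp only: r(2))
      moreover have "a ^ m = a ^ m + q * 0" by simp
      then have "a ^ m \<in> U" using R(1) R(7)[OF aR] unfolding U_def by blast
      ultimately show ?thesis using r(1) by blast
    qed
  qed (assumption | rule qR finB)+
  then obtain u where u: "u \<in> U" "\<And>b. b \<in> B \<Longrightarrow> u * xmon b \<in> P" by blast
  \<comment> \<open>The monomial 1 is among the generators, so \<open>u\<close> is an element of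
    \<open>P\<close> in k[T], hence 0, and \<open>q\<close> divides a power of
    \<open>a\<close>.\<close>
  have "0 \<in> B" using npos by (simp add: B_def)
  from u(2)[OF this] have "u \<in> P" by simp
  then have "u = 0" using u(1) T(2) by (auto simp: U_def)
  then obtain m r where m: "a ^ m + q * r = 0" using u(1) by (auto simp: U_def)
  \<comment> \<open>Modulo \<open>q\<close> the element a x_s is -1, so \<open>q\<close> divides a
    unit.\<close>
  obtain y where y: "(q - 1) ^ m = (- 1) ^ m + q * y" using power_minus_one_mod by blast
  have "(q - 1) ^ m = a ^ m * xmon (single s 1) ^ m" by (simp add: q_def power_mult_distrib)
  also have "a ^ m = - (q * r)" using m by (simp add: add_eq_0_iff)
  finally have "(- 1) ^ m = q * (- r * xmon (single s 1) ^ m - y)" using y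
    by (simp add: algebra_simps)
  then have "(- 1) ^ m * (- 1) ^ m = q * ((- r * xmon (single s 1) ^ m - y) * (- 1) ^ m)"
    by (simp add: mult_ac)
  then have "q * ((- r * xmon (single s 1) ^ m - y) * (- 1) ^ m) = 1"
    by (simp flip: power_mult_distrib)
  from unit_is_constant[OF this qkey] x1 show False by blast
qed

section \<open>Transfer along a substitution of the variables\<close>

definition same_cap :: "nat \<Rightarrow> ('v \<Rightarrow>\<^sub>0 nat) \<Rightarrow> ('v \<Rightarrow>\<^sub>0 nat) \<Rightarrow> bool" where
  "same_cap D a b \<longleftrightarrow> (\<forall>s. min (lookup a s) D = min (lookup b s) D)"

text \<open>
  A monomial ideal whose generators have exponents at most \<open>D\<close> cannot tell the terms of \<open>h\<close> from the
  leading one.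
\<close>

definition leads :: "nat \<Rightarrow> ('v, 'k::field) mpoly \<Rightarrow> ('v \<Rightarrow>\<^sub>0 nat) \<Rightarrow> bool" where
  "leads D h a \<longleftrightarrow> lookup h a = 1 \<and>
     (\<forall>a'\<in>keys h. (\<forall>s. lookup a' s \<le> lookup a s) \<and> same_cap D a' a)"

definition stretch :: "nat \<Rightarrow> ('v::finite \<Rightarrow>\<^sub>0 nat) \<Rightarrow> ('v \<Rightarrow>\<^sub>0 nat)" where
  "stretch N c = Abs_poly_mapping (\<lambda>s. N * lookup c s)"

lemma lookup_stretch [simp]: "lookup (stretch N c) s = N * lookup c s"
  by (simp add: stretch_def)

lemma exp_antisym:
  "(\<And>s. lookup a s \<le> lookup b s) \<Longrightarrow> (\<And>s. lookup b s \<le> lookup a s) \<Longrightarrow> a = b"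
  for a b :: "'v \<Rightarrow>\<^sub>0 nat"
  by (rule poly_mapping_eqI) (rule order.antisym)

lemma leads_xmon: "leads D (xmon b) b"
  by (simp add: leads_def same_cap_def) (simp add: xmon_def)

text \<open>Domination in every coordinate leaves only one pair of terms for the sum of the leading
  exponents.\<close>

lemma leads_mult:
  assumes "leads D h a" "leads D k b" shows "leads D (h * k) (a + b)"
proof -
  have le: "a' = a \<and> b' = b" if k: "a' \<in> keys h" "b' \<in> keys k" "a' + b' = a + b" for a' b'
  proof -
    have l: "lookup a' s \<le> lookup a s" "lookup b' s \<le> lookup b s" for s
      using assms k by (auto simp: leads_def)
    have e: "lookup a' s + lookup b' s = lookup a s + lookup b s" for s
      using k(3) by (metis lookup_add)
    have "lookup a s \<le> lookup a' s" "lookup b s \<le> lookup b' s" for s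
      using l[of s] e[of s] by auto
    then show ?thesis using l by (auto intro: exp_antisym)
  qed
  have "lookup (h * k) (a + b) = 1"
    using assms by (subst lookup_mult_unique[OF le]) (auto simp: leads_def)
  moreover have "(\<forall>s. lookup x s \<le> lookup (a + b) s) \<and> same_cap D x (a + b)"
    if "x \<in> keys (h * k)" for x
  proof -
    obtain a' b' where k: "a' \<in> keys h" "b' \<in> keys k" "x = a' + b'" using \<open>x \<in> keys (h * k)\<close>
      by (rule keys_multE)
    have l: "lookup a' s \<le> lookup a s" "lookup b' s \<le> lookup b s"
       "min (lookup a' s) D = min (lookup a s) D" "min (lookup b' s) D = min (lookup b s) D" for s
      using assms k by (auto simp: leads_def same_cap_def)
    have "min (lookup a' s + lookup b' s) D = min (lookup a s + lookup b s) D" for s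
      using l(3)[of s] l(4)[of s] by linarith
    then show ?thesis using l by (auto simp: k(3) lookup_add same_cap_def add_mono)
  qed
  ultimately show ?thesis by (simp add: leads_def)
qed

lemma leads_one: "leads D 1 0"
  using leads_xmon[of D 0] by simp

lemma leads_power: "leads D z a \<Longrightarrow> leads D (z ^ n) (stretch n a)"
proof (induction n)
  case 0
  have "stretch 0 a = 0" by (rule poly_mapping_eqI) simp
  then show ?case by (simp add: leads_one)
next
  case (Suc n)
  have "stretch (Suc n) a = a + stretch n a" by (rule poly_mapping_eqI) (simp add: lookup_add)
  then show ?case using Suc by (simp add: leads_mult)
qed

lemma leads_prod: "(\<And>s. s \<in> A \<Longrightarrow> leads D (z s) (e s)) \<Longrightarrow> leads D (\<Prod>s\<in>A. z s) (\<Sum>s\<in>A. e s)"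
  by (induction A rule: infinite_finite_induct) (auto simp: leads_one leads_mult)

section \<open>Substitution and the polynomial ring as a module over k[z]\<close>

definition mono_pow :: "('v::finite \<Rightarrow> 'a::comm_ring_1) \<Rightarrow> ('v \<Rightarrow>\<^sub>0 nat) \<Rightarrow> 'a" where
  "mono_pow z c = (\<Prod>s\<in>UNIV. z s ^ lookup c s)"

lemma mono_pow_add: "mono_pow z (a + b) = mono_pow z a * mono_pow z b"
  by (simp add: mono_pow_def lookup_add power_add prod.distrib)

definition psubst :: "('v::finite \<Rightarrow> ('v, 'k::field) mpoly) \<Rightarrow> ('v, 'k) mpoly \<Rightarrow> ('v, 'k) mpoly" where
  "psubst z h = (\<Sum>c\<in>keys h. single 0 (lookup h c) * mono_pow z c)"

lemma psubst_superset:
  "finite X \<Longrightarrow> keys h \<subseteq> X \<Longrightarrow> psubst z h = (\<Sum>c\<in>X. single 0 (lookup h c) * mono_pow z c)"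
  unfolding psubst_def by (rule sum.mono_neutral_left) (auto simp: in_keys_iff)

lemma psubst_add: "psubst z (f + g) = psubst z f + psubst z g"
proof -
  let ?X = "keys f \<union> keys g"
  have "psubst z (f + g) = (\<Sum>c\<in>?X. single 0 (lookup (f + g) c) * mono_pow z c)"
    by (rule psubst_superset) (use keys_add[of f g] in auto)
  also have "\<dots> = (\<Sum>c\<in>?X. single 0 (lookup f c) * mono_pow z c) +
      (\<Sum>c\<in>?X. single 0 (lookup g c) * mono_pow z c)"
    by (simp add: lookup_add single_add distrib_right sum.distrib)
  also have "\<dots> = psubst z f + psubst z g"
    using psubst_superset[of ?X f z] psubst_superset[of ?X g z] by simp
  finally show ?thesis .
qed

lemma psubst_zero [simp]: "psubst z 0 = 0"
  by (simp add: psubst_def)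

lemma psubst_sum: "psubst z (sum f A) = (\<Sum>x\<in>A. psubst z (f x))"
  by (induction A rule: infinite_finite_induct) (auto simp: psubst_add)

lemma psubst_single: "psubst z (single c k) = single 0 k * mono_pow z c"
  by (cases "k = 0") (simp_all add: psubst_def)

lemma psubst_mult: "psubst z (f * g) = psubst z f * psubst z g"
proof -
  have "psubst z (f * g) = (\<Sum>a\<in>keys f. \<Sum>b\<in>keys g.
      single 0 (lookup f a * lookup g b) * mono_pow z (a + b))"
    by (subst mult_expand) (simp add: psubst_sum psubst_single)
  also have "\<dots> = (\<Sum>a\<in>keys f. \<Sum>b\<in>keys g.
      (single 0 (lookup f a) * mono_pow z a) * (single 0 (lookup g b) * mono_pow z b))"
  proof (intro sum.cong refl)
    fix a b
    have "single 0 (lookup f a * lookup g b) = single 0 (lookup f a) * single (0 :: 'a \<Rightarrow>\<^sub>0 nat) (lookup g b)"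
      by (simp add: mult_single)
    then show "single 0 (lookup f a * lookup g b) * mono_pow z (a + b) =
        (single 0 (lookup f a) * mono_pow z a) * (single 0 (lookup g b) * mono_pow z b)"
      by (simp add: mono_pow_add mult_ac)
  qed
  also have "\<dots> = psubst z f * psubst z g" by (simp add: psubst_def sum_product)
  finally show ?thesis .
qed

definition box :: "nat \<Rightarrow> ('v::finite \<Rightarrow>\<^sub>0 nat) set" where
  "box N = {b. \<forall>s. lookup b s < N}"

lemma finite_box: "finite (box N :: ('v::finite \<Rightarrow>\<^sub>0 nat) set)"
proof (rule finite_imageD)
  show "finite (lookup ` (box N :: ('v \<Rightarrow>\<^sub>0 nat) set))"
  proof (rule finite_subset)
    show "lookup ` (box N :: ('v \<Rightarrow>\<^sub>0 nat) set) \<subseteq> Pi\<^sub>E UNIV (\<lambda>_. {..<N})"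
      by (auto simp: box_def)
  qed (auto intro: finite_PiE)
qed (auto intro!: inj_onI poly_mapping_eqI)

text \<open>Expansion over k[z] in the monomials with exponents below \<open>N\<close>. Division
  with remainder by \<open>N\<close> matches the products of these with monomials in
  \<open>z\<close> to all exponents.\<close>

definition reassemble ::
    "nat \<Rightarrow> ('v::finite \<Rightarrow> ('v, 'k::field) mpoly) \<Rightarrow> (('v \<Rightarrow>\<^sub>0 nat) \<Rightarrow> ('v, 'k) mpoly) \<Rightarrow> ('v, 'k) mpoly" where
  "reassemble N z g = (\<Sum>b\<in>box N. xmon b * psubst z (g b))"

lemma reassemble_add: "reassemble N z (\<lambda>b. f b + g b) = reassemble N z f + reassemble N z g"
  by (simp add: reassemble_def psubst_add distrib_left sum.distrib)

lemma reassemble_mult: "reassemble N z (\<lambda>b. f * g b) = psubst z f * reassemble N z g"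
  by (simp add: reassemble_def psubst_mult sum_distrib_left mult_ac)

lemma reassemble_zero: "reassemble N z (\<lambda>b. 0) = 0"
  by (simp add: reassemble_def)

lemma exp_divmod:
  assumes "0 < N"
  obtains b c where "b \<in> box N" "a = b + stretch N c"
proof
  show "Abs_poly_mapping (\<lambda>s. lookup a s mod N) \<in> box N" using assms by (simp add: box_def)
  show "a = Abs_poly_mapping (\<lambda>s. lookup a s mod N) +
      stretch N (Abs_poly_mapping (\<lambda>s. lookup a s div N))"
    by (rule poly_mapping_eqI) (simp add: lookup_add)
qed

lemma exp_divmod_unique:
  assumes "b \<in> box N" "b' \<in> box N" "b + stretch N c = b' + stretch N c'"
  shows "b = b' \<and> c = c'"
proof -
  have eq: "lookup b s + N * lookup c s = lookup b' s + N * lookup c' s" for s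
    using arg_cong[OF assms(3), of "\<lambda>x. lookup x s"] by (simp add: lookup_add)
  have lt: "lookup b s < N" "lookup b' s < N" for s using assms by (auto simp: box_def)
  have "lookup b s = lookup b' s" for s
    using arg_cong[OF eq[of s], of "\<lambda>x. x mod N"] lt[of s] by simp
  moreover have "lookup c s = lookup c' s" for s
    using arg_cong[OF eq[of s], of "\<lambda>x. x div N"] lt[of s] by simp
  ultimately show ?thesis by (auto intro: poly_mapping_eqI)
qed

lemma tot_strict_mono:
  assumes "\<And>s. lookup a s \<le> lookup b s" "a \<noteq> b"
  shows "tot a < tot b"
proof -
  obtain s where "lookup a s < lookup b s" using assms exp_antisym[of a b] by (metis not_less)
  then show ?thesis unfolding tot_def using assms(1) by (intro sum_strict_mono_ex1) auto
qed

context
  fixes z :: "'v::finite \<Rightarrow> ('v, 'k::field) mpoly" and N D :: nat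
  assumes N: "0 < N" and z: "\<And>s. leads D (z s) (single s N)"
begin

lemma leads_term: "leads D (xmon b * mono_pow z c) (b + stretch N c)"
proof -
  have "leads D (mono_pow z c) (\<Sum>s\<in>UNIV. stretch (lookup c s) (single s N))"
    unfolding mono_pow_def by (intro leads_prod leads_power z)
  moreover have "(\<Sum>s\<in>UNIV. stretch (lookup c s) (single s N)) = stretch N c"
    by (rule poly_mapping_eqI)
      (simp add: lookup_sum lookup_single when_def if_distrib mult.commute cong: if_cong)
  ultimately show ?thesis using leads_mult[OF leads_xmon] by metis
qed

text \<open>Induction on the total degree: x^a and the product \<open>T\<close> with leading
  exponent \<open>a\<close> differ by terms that properly divide x^a.\<close>

lemma reassemble_surj: "\<exists>g. reassemble N z g = h"
proof -
  have "\<forall>h. (\<forall>a\<in>keys h. tot a < n) \<longrightarrow> h \<in> range (reassemble N z)" for n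
  proof (induction n)
    case 0
    have "0 \<in> range (reassemble N z)" using reassemble_zero by (metis rangeI)
    then show ?case by (metis keys_eq_empty not_less_zero ex_in_conv)
  next
    case (Suc n)
    have add: "x + y \<in> range (reassemble N z)"
      if "x \<in> range (reassemble N z)" "y \<in> range (reassemble N z)" for x y
      using that by (auto simp: reassemble_add[symmetric])
    have sgl: "single a k \<in> range (reassemble N z)" if a: "tot a < Suc n" for a k
    proof -
      obtain b c where b: "b \<in> box N" "a = b + stretch N c" by (rule exp_divmod[OF N])
      define T where "T = xmon b * mono_pow z c"
      have T: "leads D T a" using leads_term by (simp add: T_def b)
      have "reassemble N z (\<lambda>b'. if b' = b then single c k else 0) = single 0 k * T"
        using b(1)
          by (simp add: reassemble_def if_distrib finite_box T_def psubst_single mult_ac cong: if_cong)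
      then have 1: "single 0 k * T \<in> range (reassemble N z)" by (metis rangeI)
      have "tot a' < n" if a': "a' \<in> keys (single 0 k * (xmon a - T))" for a'
      proof -
        have nz: "lookup (xmon a - T) a' \<noteq> 0"
          using a' by (auto simp: in_keys_iff lookup_const_mult)
        then have "a' \<noteq> a" using T by (auto simp: lookup_minus leads_def xmon_def)
        then have "a' \<in> keys T" using nz
          by (auto simp: lookup_minus xmon_def lookup_single in_keys_iff)
        then have "\<And>s. lookup a' s \<le> lookup a s" using T by (auto simp: leads_def)
        from tot_strict_mono[OF this \<open>a' \<noteq> a\<close>] show ?thesis using a by simp
      qed
      then have "single 0 k * (xmon a - T) \<in> range (reassemble N z)" using Suc by blast
      from add[OF 1 this] show ?thesis unfolding single_xmon[of a k] by (simp add: algebra_simps)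
    qed
    have "(\<Sum>a\<in>A. single a (f a)) \<in> range (reassemble N z)"
      if "finite A" "\<forall>a\<in>A. tot a < Suc n" for A f
      using that
    proof (induction A)
      case empty
      then show ?case using reassemble_zero by (metis rangeI sum.empty)
    qed (auto intro: add sgl)
    then show ?case by (metis finite_keys poly_expand)
  qed
  moreover have "\<forall>a\<in>keys h. tot a < Suc (Max (tot ` keys h))" by (auto simp: less_Suc_eq_le)
  ultimately show ?thesis by (metis rangeE)
qed

lemma lookup_reassemble:
  "lookup (reassemble N z g) a =
     (\<Sum>b\<in>box N. \<Sum>c\<in>keys (g b). lookup (g b) c * lookup (xmon b * mono_pow z c) a)"
proof -
  have "xmon b * psubst z (g b) = (\<Sum>c\<in>keys (g b). single 0 (lookup (g b) c) * (xmon b * mono_pow z c))" for b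
    by (simp add: psubst_def sum_distrib_left mult_ac)
  then show ?thesis by (simp add: reassemble_def lookup_sum lookup_const_mult)
qed

text \<open>With respect to \<open>E\<close> all terms of x^b z^c behave like the leading one. For
  the forward direction, take a leading exponent outside \<open>E\<close> of largest total degree:
  its coefficient cannot cancel, since another product contributing there has a dominating leading
  exponent, which is again outside \<open>E\<close>.\<close>

lemma reassemble_in_mon_span:
  assumes sat: "\<And>a a'. same_cap D a a' \<Longrightarrow> a \<in> E \<longleftrightarrow> a' \<in> E"
  shows "reassemble N z g \<in> mon_span E \<longleftrightarrow> (\<forall>b\<in>box N. g b \<in> mon_span {c. b + stretch N c \<in> E})"
proof
  assume R: "\<forall>b\<in>box N. g b \<in> mon_span {c. b + stretch N c \<in> E}"
  show "reassemble N z g \<in> mon_span E"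
    unfolding mon_span_def
  proof (intro CollectI subsetI, rule ccontr)
    fix a assume a: "a \<in> keys (reassemble N z g)" "a \<notin> E"
    have "lookup (g b) c * lookup (xmon b * mono_pow z c) a = 0"
      if "b \<in> box N" "c \<in> keys (g b)" for b c
    proof (rule ccontr)
      assume "\<not> ?thesis"
      then have "a \<in> keys (xmon b * mono_pow z c)" by (auto simp: in_keys_iff)
      then have "same_cap D a (b + stretch N c)" using leads_term by (auto simp: leads_def)
      then show False using sat a(2) R that by (auto simp: mon_span_def)
    qed
    then show False using a(1) by (simp add: in_keys_iff lookup_reassemble)
  qed
next
  assume L: "reassemble N z g \<in> mon_span E"
  define S where "S = {p \<in> Sigma (box N) (\<lambda>b. keys (g b)). fst p + stretch N (snd p) \<notin> E}"
  have finS: "finite S"     unfolding S_def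
    by (rule finite_subset[OF _ finite_SigmaI[OF finite_box, of _ "\<lambda>b. keys (g b)"]]) auto
  have "S = {}"
  proof (rule ccontr)
    assume "S \<noteq> {}"
    define m where "m = (\<lambda>p :: ('v \<Rightarrow>\<^sub>0 nat) \<times> ('v \<Rightarrow>\<^sub>0 nat). tot (fst p + stretch N (snd p)))"
    have "Max (m ` S) \<in> m ` S" using finS \<open>S \<noteq> {}\<close> by (intro Max_in) auto
    then obtain p where p: "p \<in> S" "m p = Max (m ` S)" by (metis imageE)
    have mx: "m q \<le> m p" if "q \<in> S" for q unfolding p(2) using that finS by (intro Max_ge) auto
    obtain b c where bc: "p = (b, c)" by (cases p)
    define a where "a = b + stretch N c"
    have b: "b \<in> box N" "c \<in> keys (g b)" "a \<notin> E" using p(1) by (auto simp: S_def bc a_def)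
    have zero: "lookup (xmon b' * mono_pow z c') a = 0"
      if b': "b' \<in> box N" "c' \<in> keys (g b')" "(b', c') \<noteq> (b, c)" for b' c'
    proof (rule ccontr)
      assume "\<not> ?thesis"
      then have "a \<in> keys (xmon b' * mono_pow z c')" by (auto simp: in_keys_iff)
      then have le: "\<And>s. lookup a s \<le> lookup (b' + stretch N c') s"
        and cap: "same_cap D a (b' + stretch N c')" using leads_term[of b' c']
          by (auto simp: leads_def)
      have "(b', c') \<in> S" using sat[OF cap] b' b(3) by (auto simp: S_def)
      from mx[OF this] have "tot (b' + stretch N c') \<le> tot a" by (simp add: m_def bc a_def)
      then have "a = b' + stretch N c'" using tot_strict_mono[OF le] by force
      then show False using exp_divmod_unique[of b N b' c c'] b b' by (auto simp: a_def)
    qed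
    have "lookup (reassemble N z g) a =
        (\<Sum>b'\<in>box N. \<Sum>c'\<in>keys (g b'). if c' = c \<and> b' = b then lookup (g b) c else 0)"
      unfolding lookup_reassemble
    proof (intro sum.cong refl)
      fix b' c' assume b': "b' \<in> box N" "c' \<in> keys (g b')"
      show "lookup (g b') c' * lookup (xmon b' * mono_pow z c') a =
          (if c' = c \<and> b' = b then lookup (g b) c else 0)"
        using zero[OF b'] leads_term[of b c] by (auto simp: leads_def a_def)
    qed
    also have "\<dots> = (\<Sum>b'\<in>box N. if b' = b then lookup (g b) c else 0)"
      using b(2) by (intro sum.cong refl) (auto simp: sum.delta)
    also have "\<dots> = lookup (g b) c" using b(1) by (subst sum.delta[OF finite_box]) simp
    finally have "a \<in> keys (reassemble N z g)" using b(2) by (auto simp: in_keys_iff)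
    then show False using L b(3) by (auto simp: mon_span_def)
  qed
  then show "\<forall>b\<in>box N. g b \<in> mon_span {c. b + stretch N c \<in> E}"
    by (auto simp: S_def mon_span_def)
qed

text \<open>The last assumption makes the quotient a direct sum of copies of k[z] modulo the
  \<open>I b\<close>, so regularity is tested in each component. Enlarging the \<open>I b\<close>
  preserves it, as the induction requires.\<close>

lemma wreg_reassemble:
  assumes "\<And>b. b \<in> box N \<Longrightarrow> is_ideal (I b)" "\<And>b. b \<in> box N \<Longrightarrow> wreg (I b) fs"
    and "\<And>g. reassemble N z g = 0 \<Longrightarrow> \<forall>b\<in>box N. g b \<in> I b"
  shows "wreg {reassemble N z g | g. \<forall>b\<in>box N. g b \<in> I b} (map (psubst z) fs)"
  using assms
proof (induction fs arbitrary: I)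
  case (Cons f fs)
  let ?M = "\<lambda>I. {reassemble N z g | g. \<forall>b\<in>box N. g b \<in> I b}"
  have iff: "reassemble N z g \<in> ?M I \<longleftrightarrow> (\<forall>b\<in>box N. g b \<in> I b)" for g
  proof
    assume "reassemble N z g \<in> ?M I"
    then obtain g' where g': "reassemble N z g = reassemble N z g'" "\<forall>b\<in>box N. g' b \<in> I b" by auto
    have "reassemble N z (\<lambda>b. (g b - g' b) + g' b) = reassemble N z (\<lambda>b. g b - g' b) + reassemble N z g'"
      by (rule reassemble_add)
    then have "reassemble N z (\<lambda>b. g b - g' b) = 0" using g' by simp
    from Cons.prems(3)[OF this] g'(2) Cons.prems(1)
    show "\<forall>b\<in>box N. g b \<in> I b" using is_idealD(2) by (metis diff_add_cancel)
  qed auto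
  have "\<forall>a. psubst z f * a \<in> ?M I \<longrightarrow> a \<in> ?M I"
  proof (intro allI impI)
    fix a assume a: "psubst z f * a \<in> ?M I"
    obtain g where g: "reassemble N z g = a" using reassemble_surj by blast
    have "reassemble N z (\<lambda>b. f * g b) \<in> ?M I" using a by (simp only: reassemble_mult g)
    then have "\<forall>b\<in>box N. f * g b \<in> I b" by (simp only: iff)
    then have "\<forall>b\<in>box N. g b \<in> I b" using Cons.prems(2) by auto
    then show "a \<in> ?M I" using iff[of g] g by simp
  qed
  moreover have "addgen (?M I) (psubst z f) = ?M (\<lambda>b. addgen (I b) f)"
  proof (intro equalityI subsetI)
    fix x assume "x \<in> addgen (?M I) (psubst z f)"
    then obtain i c where i: "i \<in> ?M I" "x = i + psubst z f * c" by (rule addgenE)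
    then obtain g where g: "\<forall>b\<in>box N. g b \<in> I b" "i = reassemble N z g" by auto
    obtain h where h: "reassemble N z h = c" using reassemble_surj by blast
    have "x = reassemble N z (\<lambda>b. g b + f * h b)"
      by (simp add: i(2) g(2) reassemble_add reassemble_mult h)
    moreover have "\<forall>b\<in>box N. g b + f * h b \<in> addgen (I b) f" using g(1) by (auto intro: addgenI)
    ultimately show "x \<in> ?M (\<lambda>b. addgen (I b) f)" by auto
  next
    fix x assume "x \<in> ?M (\<lambda>b. addgen (I b) f)"
    then obtain g where g: "\<forall>b\<in>box N. g b \<in> addgen (I b) f" "x = reassemble N z g" by auto
    have "\<forall>b\<in>box N. \<exists>i c. i \<in> I b \<and> g b = i + f * c" using g(1) unfolding addgen_def by blast
    then obtain i c where ic: "\<And>b. b \<in> box N \<Longrightarrow> i b \<in> I b \<and> g b = i b + f * c b" by metis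
    have "x = reassemble N z (\<lambda>b. i b + f * c b)"
      unfolding g(2) reassemble_def by (rule sum.cong) (simp_all add: ic)
    also have "\<dots> = reassemble N z i + psubst z f * reassemble N z c"
      by (simp add: reassemble_add reassemble_mult)
    finally show "x \<in> addgen (?M I) (psubst z f)"
      using ic by (intro addgenI[of "reassemble N z i"]) auto
  qed
  moreover have "wreg (?M (\<lambda>b. addgen (I b) f)) (map (psubst z) fs)"
  proof (rule Cons.IH)
    show "is_ideal (addgen (I b) f)" if "b \<in> box N" for b
      using Cons.prems(1)[OF that] by (rule is_ideal_addgen)
    show "wreg (addgen (I b) f) fs" if "b \<in> box N" for b
      using Cons.prems(2)[OF that] by simp
    show "\<forall>b\<in>box N. g b \<in> addgen (I b) f" if "reassemble N z g = 0" for g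
      using Cons.prems(3)[OF that] addgen_mono by blast
  qed
  ultimately show ?case by simp
qed simp

lemma wreg_mon_span:
  assumes sat: "\<And>a a'. same_cap D a a' \<Longrightarrow> a \<in> E \<longleftrightarrow> a' \<in> E" and up: "upset E"
    and w: "\<And>b. b \<in> box N \<Longrightarrow> wreg (mon_span {c. b + stretch N c \<in> E} :: ('v, 'k) mpoly set) fs"
  shows "wreg (mon_span E) (map (psubst z) fs)"
proof -
  let ?I = "\<lambda>b. mon_span {c. b + stretch N c \<in> E} :: ('v, 'k) mpoly set"
  have "wreg {reassemble N z g | g. \<forall>b\<in>box N. g b \<in> ?I b} (map (psubst z) fs)"
  proof (rule wreg_reassemble)
    show "is_ideal (?I b)" for b
    proof (rule is_ideal_mon_span, unfold upset_def, intro ballI allI)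
      fix c d assume "c \<in> {c. b + stretch N c \<in> E}"
      moreover have "b + stretch N (c + d) = b + stretch N c + stretch N d"
        by (rule poly_mapping_eqI) (simp add: lookup_add algebra_simps)
      ultimately show "c + d \<in> {c. b + stretch N c \<in> E}" using up by (auto simp: upset_def)
    qed
    show "\<forall>b\<in>box N. g b \<in> ?I b" if "reassemble N z g = 0" for g
      using reassemble_in_mon_span[OF sat, of g] that by (simp add: mon_span_def)
  qed (rule w)
  moreover have "{reassemble N z g | g. \<forall>b\<in>box N. g b \<in> ?I b} = mon_span E"
    using reassemble_in_mon_span[OF sat] reassemble_surj by (auto 0 3) metis
  ultimately show ?thesis by simp
qed

end

section \<open>Quotients of the polynomial ring\<close>

lemma wreg_iff:
  "wreg I fs \<longleftrightarrow> (\<forall>i<length fs. \<forall>a. fs ! i * a \<in> gens I (take i fs) \<longrightarrow> a \<in> gens I (take i fs))"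
  by (induction fs arbitrary: I) (auto simp: All_less_Suc2)

text \<open>Covers both the polynomial ring itself (with \<open>M = {0}\<close>) and its quotients.\<close>

locale quotient_presentation = cring Q for Q :: "('b, 'm) ring_scheme" (structure) +
  fixes \<pi> :: "'a::comm_ring_1 \<Rightarrow> 'b" and M :: "'a set"
  assumes M: "is_ideal M"
    and carr: "carrier Q = range \<pi>"
    and ker: "\<pi> a = \<pi> b \<longleftrightarrow> a - b \<in> M"
    and pi_mult: "\<pi> (a * b) = \<pi> a \<otimes> \<pi> b"
    and pi_add: "\<pi> (a + b) = \<pi> a \<oplus> \<pi> b"
    and pi_one: "\<pi> 1 = \<one>"
    and pi_zero: "\<pi> 0 = \<zero>"
begin

lemma pi_carrier [simp]: "\<pi> a \<in> carrier Q"
  by (simp add: carr)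

lemma is_ideal_vimage:
  assumes "ideal J Q"
  shows "is_ideal (\<pi> -` J)" and "M \<subseteq> \<pi> -` J" and "\<pi> ` (\<pi> -` J) = J"
proof -
  interpret J: ideal J Q by fact
  have zero: "\<pi> 0 \<in> J" by (simp add: pi_zero)
  show "is_ideal (\<pi> -` J)"
    unfolding is_ideal_def
    by (auto simp: zero pi_add pi_mult J.a_closed J.I_l_closed)
  show "M \<subseteq> \<pi> -` J" using zero ker[of _ 0] by auto
  have "J \<subseteq> range \<pi>" using J.a_subset carr by simp
  then show "\<pi> ` (\<pi> -` J) = J" by blast
qed

context
  fixes I assumes I: "is_ideal I" "M \<subseteq> I"
begin

lemma mem_image: "\<pi> a \<in> \<pi> ` I \<longleftrightarrow> a \<in> I"
proof
  assume "\<pi> a \<in> \<pi> ` I"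
  then obtain b where "b \<in> I" "a - b \<in> M" using ker by auto
  then have "(a - b) + b \<in> I" using I by (intro is_idealD(2)[OF I(1)]) auto
  then show "a \<in> I" by simp
qed auto

lemma ideal_image: "ideal (\<pi> ` I) Q"
proof (rule idealI[OF ring_axioms])
  note D = is_idealD[OF I(1)]
  show "subgroup (\<pi> ` I) (add_monoid Q)"
  proof (rule add.subgroupI)
    show "\<pi> ` I \<subseteq> carrier Q" by auto
    show "\<pi> ` I \<noteq> {}" using D(1) by auto
    show "\<ominus> x \<in> \<pi> ` I" if x: "x \<in> \<pi> ` I" for x
    proof -
      obtain a where a: "a \<in> I" "x = \<pi> a" using x by auto
      have "\<pi> (- a) \<oplus> \<pi> a = \<zero>" using pi_add[of "- a" a] by (simp add: pi_zero)
      then have "\<ominus> x = \<pi> (- a)" using a(2) minus_equality by simp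
      then show ?thesis using D(5)[OF a(1)] by simp
    qed
    show "x \<oplus> y \<in> \<pi> ` I" if xy: "x \<in> \<pi> ` I" "y \<in> \<pi> ` I" for x y
    proof -
      obtain a b where "a \<in> I" "x = \<pi> a" "b \<in> I" "y = \<pi> b" using xy by auto
      then show ?thesis using D(2) by (auto simp flip: pi_add)
    qed
  qed
  show "x \<otimes> a \<in> \<pi> ` I" if a: "a \<in> \<pi> ` I" "x \<in> carrier Q" for a x
  proof -
    obtain b c where "b \<in> I" "a = \<pi> b" "x = \<pi> c" using a by (auto simp: carr)
    then show ?thesis using D(3) by (auto simp flip: pi_mult)
  qed
  then show "a \<otimes> x \<in> \<pi> ` I" if a: "a \<in> \<pi> ` I" "x \<in> carrier Q" for a x
    using a m_comm[of a x] by (auto simp: carr)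
qed

lemma image_eq_carrier_iff: "\<pi> ` I = carrier Q \<longleftrightarrow> 1 \<in> I"
proof
  assume "\<pi> ` I = carrier Q"
  then show "1 \<in> I" using mem_image[of 1] by auto
qed (use is_ideal_one[OF I(1)] in \<open>auto simp: carr\<close>)

end

lemma image_psubset:
  assumes "is_ideal I" "M \<subseteq> I" "is_ideal J" "I \<subset> J"
  shows "\<pi> ` I \<subset> \<pi> ` J"
proof -
  obtain a where "a \<in> J" "a \<notin> I" using assms(4) by blast
  then have "\<pi> a \<in> \<pi> ` J" "\<pi> a \<notin> \<pi> ` I" using mem_image[OF assms(1,2)] by auto
  then show ?thesis using assms(4) by blast
qed

lemma vimage_psubset: "ideal I Q \<Longrightarrow> ideal J Q \<Longrightarrow> I \<subset> J \<Longrightarrow> \<pi> -` I \<subset> \<pi> -` J"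
  using is_ideal_vimage(3)[of I] is_ideal_vimage(3)[of J] by blast

lemma is_prime_vimage:
  assumes "primeideal J Q" shows "is_prime (\<pi> -` J)"
proof -
  interpret J: primeideal J Q by fact
  have "\<one> \<notin> J" using J.I_notcarr J.one_imp_carrier by auto
  then show ?thesis
    using is_ideal_vimage(1)[OF J.ideal_axioms] J.I_prime
    by (auto simp: is_prime_def pi_one pi_mult)
qed

lemma primeideal_image:
  assumes "is_prime I" "M \<subseteq> I" shows "primeideal (\<pi> ` I) Q"
proof (rule primeidealI)
  have I: "is_ideal I" "1 \<notin> I" "\<And>a b. a * b \<in> I \<Longrightarrow> a \<in> I \<or> b \<in> I"
    using assms(1) by (auto simp: is_prime_def)
  show "ideal (\<pi> ` I) Q" by (rule ideal_image[OF I(1) assms(2)])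
  show "cring Q" by (rule is_cring)
  show "carrier Q \<noteq> \<pi> ` I" using image_eq_carrier_iff[OF I(1) assms(2)] I(2) by auto
  fix a b assume ab: "a \<in> carrier Q" "b \<in> carrier Q" "a \<otimes> b \<in> \<pi> ` I"
  then obtain c d where cd: "a = \<pi> c" "b = \<pi> d" by (auto simp: carr)
  then have "c * d \<in> I" using ab(3) mem_image[OF I(1) assms(2), of "c * d"] by (simp add: pi_mult)
  then show "a \<in> \<pi> ` I \<or> b \<in> \<pi> ` I" using I(3) cd by auto
qed

lemma is_maximal_vimage:
  assumes "maximalideal J Q" shows "is_maximal (\<pi> -` J)"
proof -
  interpret J: maximalideal J Q by fact
  let ?P = "\<pi> -` J"
  have P: "is_ideal ?P" "M \<subseteq> ?P" "\<pi> ` ?P = J" using is_ideal_vimage[OF J.ideal_axioms] by auto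
  have "\<exists>w. a * w - 1 \<in> ?P" if a: "a \<notin> ?P" for a
  proof -
    let ?K = "addgen ?P a"
    have K: "is_ideal ?K" "M \<subseteq> ?K" using is_ideal_addgen[OF P(1)] P(2) addgen_mono by blast+
    have "J \<subseteq> \<pi> ` ?K" using P(3) image_mono[OF addgen_mono[of ?P a], of \<pi>] by simp
    moreover have "\<pi> ` ?K \<subseteq> carrier Q" by auto
    ultimately have "\<pi> ` ?K = J \<or> \<pi> ` ?K = carrier Q"
      by (intro J.I_maximal ideal_image[OF K])
    moreover have "\<pi> ` ?K \<noteq> J" using addgen_gen[OF P(1), of a] a by blast
    ultimately have "1 \<in> ?K" using image_eq_carrier_iff[OF K] by simp
    then obtain i c where "i \<in> ?P" and one: "1 = i + a * c" by (rule addgenE)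
    have "a * c - 1 = - i" by (subst one) simp
    then show ?thesis using is_idealD(5)[OF P(1) \<open>i \<in> ?P\<close>] by metis
  qed
  moreover have "1 \<notin> ?P" using J.I_notcarr image_eq_carrier_iff[OF P(1,2)] P(3) by auto
  ultimately show ?thesis using P(1) by (auto simp: is_maximal_def)
qed

lemma genideal_image: "Idl (\<pi> ` set fs) = \<pi> ` gens M fs"
proof
  have g: "is_ideal (gens M fs)" "M \<subseteq> gens M fs" using is_ideal_gens[OF M] gens_mono by auto
  show "Idl (\<pi> ` set fs) \<subseteq> \<pi> ` gens M fs"
    using set_subset_gens[OF M] by (intro genideal_minimal ideal_image[OF g]) auto
  have J: "ideal (Idl (\<pi> ` set fs)) Q" by (rule genideal_ideal) auto
  have "\<pi> ` set fs \<subseteq> Idl (\<pi> ` set fs)" by (rule genideal_self) auto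
  then have "gens M fs \<subseteq> \<pi> -` (Idl (\<pi> ` set fs))"
    using is_ideal_vimage[OF J] by (intro gens_least) auto
  then show "\<pi> ` gens M fs \<subseteq> Idl (\<pi> ` set fs)" by auto
qed

lemma regular_sequence_map:
  "regular_sequence Q (map \<pi> fs) \<longleftrightarrow> wreg M fs \<and> 1 \<notin> gens M fs"
proof -
  have g: "is_ideal (gens M gs)" "M \<subseteq> gens M gs" for gs using is_ideal_gens[OF M] gens_mono by auto
  have "(\<forall>i<length (map \<pi> fs). \<forall>a\<in>carrier Q. map \<pi> fs ! i \<otimes> a \<in> Idl (set (take i (map \<pi> fs))) \<longrightarrow>
      a \<in> Idl (set (take i (map \<pi> fs)))) \<longleftrightarrow> wreg M fs"
    unfolding wreg_iff take_map set_map genideal_image carr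
    by (auto simp: mem_image[OF g] simp flip: pi_mult)
  moreover have "Idl (set (map \<pi> fs)) \<noteq> carrier Q \<longleftrightarrow> 1 \<notin> gens M fs"
    using image_eq_carrier_iff[OF g] by (simp add: genideal_image)
  moreover have "set (map \<pi> fs) \<subseteq> carrier Q" by auto
  ultimately show ?thesis by (simp add: regular_sequence_def)
qed

lemma noetherian:
  assumes "\<And>I :: 'a set. is_ideal I \<Longrightarrow> \<exists>B. finite B \<and> B \<subseteq> I \<and> (\<forall>J. is_ideal J \<longrightarrow> B \<subseteq> J \<longrightarrow> I \<subseteq> J)"
  shows "noetherian_ring Q"
proof (unfold_locales)
  fix J assume J: "ideal J Q"
  note V = is_ideal_vimage[OF J]
  obtain B where B: "finite B" "B \<subseteq> \<pi> -` J" "\<And>K. is_ideal K \<Longrightarrow> B \<subseteq> K \<Longrightarrow> \<pi> -` J \<subseteq> K"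
    using assms[OF V(1)] by blast
  have K: "ideal (Idl (\<pi> ` B)) Q" by (rule genideal_ideal) auto
  have "\<pi> ` B \<subseteq> Idl (\<pi> ` B)" by (rule genideal_self) auto
  then have "B \<subseteq> \<pi> -` (Idl (\<pi> ` B))" by blast
  then have "\<pi> -` J \<subseteq> \<pi> -` (Idl (\<pi> ` B))" by (rule B(3)[OF is_ideal_vimage(1)[OF K]])
  then have "\<pi> ` (\<pi> -` J) \<subseteq> Idl (\<pi> ` B)" by blast
  then have "J \<subseteq> Idl (\<pi> ` B)" by (simp only: V(3))
  moreover have "Idl (\<pi> ` B) \<subseteq> J" using B(2) by (intro genideal_minimal J) auto
  ultimately show "\<exists>A\<subseteq>carrier Q. finite A \<and> J = Idl A"
    using B(1) by (intro exI[of _ "\<pi> ` B"] conjI equalityI) auto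
qed

text \<open>One \<open>d\<close> serves all maximal ideals: by \<open>wreg_prime_chain\<close> the
  depth is at most the height, \<open>depth\<close> bounds the former from below and
  \<open>dim\<close> the latter from above.\<close>

lemma cohen_macaulayI:
  assumes noeth:
    "\<And>I :: 'a set. is_ideal I \<Longrightarrow> \<exists>B. finite B \<and> B \<subseteq> I \<and> (\<forall>J. is_ideal J \<longrightarrow> B \<subseteq> J \<longrightarrow> I \<subseteq> J)"
    and depth: "\<And>P. is_maximal P \<Longrightarrow> M \<subseteq> P \<Longrightarrow> \<exists>fs. length fs = d \<and> set fs \<subseteq> P \<and> wreg M fs"
    and dim: "\<And>Ps P. sorted_wrt (\<subset>) (Ps @ [P]) \<Longrightarrow> (\<And>R. R \<in> set (Ps @ [P]) \<Longrightarrow> is_prime R \<and> M \<subseteq> R) \<Longrightarrow> length Ps \<le> d"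
  shows "cohen_macaulay Q"
proof -
  have "ideal_depth Q N = prime_height Q N" if N: "maximalideal N Q" for N
  proof -
    have idN: "ideal N Q" using N by (simp add: maximalideal_def)
    define P where "P = \<pi> -` N"
    have P: "is_maximal P" "M \<subseteq> P" "\<pi> ` P = N"
      using is_maximal_vimage[OF N] is_ideal_vimage[OF idN] by (auto simp: P_def)
    have prN: "primeideal N Q" by (rule maximalideal_prime[OF N])
    have prP: "is_prime P" unfolding P_def by (rule is_prime_vimage[OF prN])
    have idP: "is_ideal P" "1 \<notin> P" using prP by (auto simp: is_prime_def)
    obtain fs where fs: "length fs = d" "set fs \<subseteq> P" "wreg M fs" using depth[OF P(1,2)] by blast
    have gP: "gens M gs \<subseteq> P" if "set gs \<subseteq> P" for gs by (rule gens_least[OF idP(1) P(2) that])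
    have chain:
      "\<exists>Ps. length Ps = length gs \<and> (\<forall>R\<in>set Ps. is_prime R \<and> M \<subseteq> R) \<and> sorted_wrt (\<subset>) (Ps @ [P])"
      if "wreg M gs" "set gs \<subseteq> P" for gs
      by (rule wreg_prime_chain[OF M that(1) prP gP[OF that(2)]])
    have reg: "regular_sequence Q (map \<pi> fs)"
      using regular_sequence_map fs(3) gP[OF fs(2)] idP(2) by blast
    have "ideal_depth Q N = enat d"
    proof (rule antisym)
      show "ideal_depth Q N \<le> enat d"
        unfolding ideal_depth_def
      proof (rule SUP_least)
        fix xs assume xs: "xs \<in> {xs. regular_sequence Q xs \<and> set xs \<subseteq> N}"
        then have "set xs \<subseteq> range \<pi>" by (auto simp: regular_sequence_def carr)
        then have "\<exists>gs. xs = map \<pi> gs" unfolding ex_map_conv by auto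
        then obtain gs where gs: "xs = map \<pi> gs" ..
        have "set gs \<subseteq> P" "wreg M gs" using xs gs regular_sequence_map[of gs] by (auto simp: P_def)
        from chain[OF this(2,1)] obtain Ps where
          Ps: "length Ps = length gs" "\<forall>R\<in>set Ps. is_prime R \<and> M \<subseteq> R" "sorted_wrt (\<subset>) (Ps @ [P])"
            by blast
        have "length Ps \<le> d" by (rule dim[OF Ps(3)]) (use Ps(2) prP P(2) in auto)
        then show "enat (length xs) \<le> enat d" using Ps(1) gs by simp
      qed
      have "enat (length (map \<pi> fs)) \<le> ideal_depth Q N"
        unfolding ideal_depth_def by (rule SUP_upper) (use reg fs(2) in \<open>auto simp: P_def\<close>)
      then show "enat d \<le> ideal_depth Q N" using fs(1) by simp
    qed
    moreover have "prime_height Q N = enat d"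
    proof (rule antisym)
      show "prime_height Q N \<le> enat d"
        unfolding prime_height_def
      proof (rule SUP_least)
        fix Ps assume Ps: "Ps \<in> {Ps. (\<forall>R\<in>set Ps. primeideal R Q) \<and> sorted_wrt (\<subset>) (Ps @ [N])}"
        then have pr: "primeideal R Q" if "R \<in> set (Ps @ [N])" for R using that prN by auto
        then have id: "ideal R Q" if "R \<in> set (Ps @ [N])" for R
          using that by (auto simp: primeideal_def)
        have "sorted_wrt (\<subset>) (map (vimage \<pi>) (Ps @ [N]))"
          unfolding sorted_wrt_map
        proof (rule sorted_wrt_mono_rel[of "Ps @ [N]" "(\<subset>)"])
          show "\<pi> -` R \<subset> \<pi> -` R'" if "R \<in> set (Ps @ [N])" "R' \<in> set (Ps @ [N])" "R \<subset> R'" for R R'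
            by (rule vimage_psubset[OF id[OF that(1)] id[OF that(2)] that(3)])
        qed (use Ps in simp)
        then have "sorted_wrt (\<subset>) (map (vimage \<pi>) Ps @ [P])" by (simp add: P_def)
        then have "length (map (vimage \<pi>) Ps) \<le> d"
        proof (rule dim)
          fix R assume "R \<in> set (map (vimage \<pi>) Ps @ [P])"
          then obtain R' where R': "R' \<in> set (Ps @ [N])" "R = \<pi> -` R'" by (auto simp: P_def)
          show "is_prime R \<and> M \<subseteq> R"
            using is_prime_vimage[OF pr[OF R'(1)]] is_ideal_vimage(2)[OF id[OF R'(1)]] R'(2) by simp
        qed
        then show "enat (length Ps) \<le> enat d" by simp
      qed
      obtain Ps where Ps: "length Ps = length fs" "\<forall>R\<in>set Ps. is_prime R \<and> M \<subseteq> R"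
        "sorted_wrt (\<subset>) (Ps @ [P])"
        using chain[OF fs(3,2)] by blast
      have id: "is_ideal R \<and> M \<subseteq> R" if "R \<in> set (Ps @ [P])" for R
        using that Ps(2) idP P(2) by (auto simp: is_prime_def)
      have "sorted_wrt (\<subset>) (map (image \<pi>) (Ps @ [P]))"
        unfolding sorted_wrt_map
      proof (rule sorted_wrt_mono_rel[of "Ps @ [P]" "(\<subset>)"])
        show "\<pi> ` R \<subset> \<pi> ` R'" if "R \<in> set (Ps @ [P])" "R' \<in> set (Ps @ [P])" "R \<subset> R'" for R R'
          using id[OF that(1)] id[OF that(2)] that(3) by (intro image_psubset) auto
      qed (rule Ps(3))
      then have "sorted_wrt (\<subset>) (map (image \<pi>) Ps @ [N])" by (simp add: P(3))
      moreover have "primeideal R Q" if "R \<in> set (map (image \<pi>) Ps)" for R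
        using that Ps(2) primeideal_image by auto
      ultimately have "enat (length (map (image \<pi>) Ps)) \<le> prime_height Q N"
        unfolding prime_height_def by (intro SUP_upper) auto
      then show "enat d \<le> prime_height Q N" using Ps(1) fs(1) by simp
    qed
    ultimately show ?thesis by simp
  qed
  then show ?thesis using noetherian[OF noeth] is_cring by (auto simp: cohen_macaulay_def)
qed

end

section \<open>The polynomial ring and its quotients\<close>

lemma poly_ring_simps [simp]:
  "carrier poly_ring = UNIV" "x \<otimes>\<^bsub>poly_ring\<^esub> y = x * y" "x \<oplus>\<^bsub>poly_ring\<^esub> y = x + y"
  "\<one>\<^bsub>poly_ring\<^esub> = 1" "\<zero>\<^bsub>poly_ring\<^esub> = 0"
  by (simp_all add: poly_ring_def)

lemma cring_poly_ring: "cring (poly_ring :: ('v, 'k::field) mpoly ring)"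
proof (intro cringI abelian_groupI comm_monoidI)
  fix x :: "('v, 'k) mpoly"
  show "\<exists>y\<in>carrier poly_ring. y \<oplus>\<^bsub>poly_ring\<^esub> x = \<zero>\<^bsub>poly_ring\<^esub>"
    by (intro bexI[of _ "- x"]) auto
qed (simp_all add: algebra_simps)

lemma poly_ring_presentation:
  "quotient_presentation (poly_ring :: ('v, 'k::field) mpoly ring) id {0}"
proof -
  have "is_ideal ({0} :: ('v, 'k) mpoly set)" by (simp add: is_ideal_def)
  then show ?thesis
    by (intro quotient_presentation.intro cring_poly_ring quotient_presentation_axioms.intro) simp_all
qed

lemma ideal_poly_ring_iff: "ideal I poly_ring \<longleftrightarrow> is_ideal I" for I :: "('v, 'k::field) mpoly set"
proof -
  interpret quotient_presentation "poly_ring :: ('v, 'k) mpoly ring" id "{0}"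
    by (rule poly_ring_presentation)
  show ?thesis
  proof
    assume "ideal I poly_ring"
    from is_ideal_vimage(1)[OF this] show "is_ideal I" by simp
  next
    assume "is_ideal I"
    from ideal_image[OF this] show "ideal I poly_ring" using is_idealD(1)[OF \<open>is_ideal I\<close>] by simp
  qed
qed

lemma primeideal_poly_ringI: "is_prime I \<Longrightarrow> primeideal I poly_ring" for I ::
  "('v, 'k::field) mpoly set"
proof -
  interpret quotient_presentation "poly_ring :: ('v, 'k) mpoly ring" id "{0}"
    by (rule poly_ring_presentation)
  assume "is_prime I"
  from primeideal_image[OF this] show ?thesis using \<open>is_prime I\<close>
    by (simp add: is_prime_def is_idealD(1))
qed

lemma quotient_poly_ring_presentation:
  fixes M :: "('v, 'k::field) mpoly set"
  assumes M: "is_ideal M"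
  shows "quotient_presentation (poly_ring Quot M) (\<lambda>a. M +>\<^bsub>poly_ring\<^esub> a) M"
proof -
  interpret R: cring "poly_ring :: ('v, 'k) mpoly ring" by (rule cring_poly_ring)
  interpret M: ideal M poly_ring using M by (simp add: ideal_poly_ring_iff)
  let ?p = "\<lambda>a. M +>\<^bsub>poly_ring\<^esub> a"
  have hom: "?p \<in> ring_hom poly_ring (poly_ring Quot M)" by (rule M.rcos_ring_hom)
  have "cring (poly_ring Quot M)" by (rule M.quotient_is_cring[OF cring_poly_ring])
  moreover have "carrier (poly_ring Quot M) = range ?p" by (auto simp: FactRing_def A_RCOSETS_def')
  moreover have "?p a = ?p b \<longleftrightarrow> a - b \<in> M" for a b
  proof -
    have coset: "?p a = {m + a | m. m \<in> M}" for a
      by (auto simp: a_r_coset_def r_coset_def)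
    show ?thesis
    proof
      assume "?p a = ?p b"
      moreover have "a \<in> ?p a" unfolding coset using is_idealD(1)[OF M] by force
      ultimately obtain m where "m \<in> M" "a = m + b" unfolding coset by blast
      then show "a - b \<in> M" by simp
    next
      have sub: "?p a \<subseteq> ?p b" if "a - b \<in> M" for a b
      proof
        fix x assume "x \<in> ?p a"
        then obtain m where "m \<in> M" "x = m + a" unfolding coset by blast
        moreover have "m + a = (m + (a - b)) + b" by simp
        ultimately show "x \<in> ?p b" unfolding coset using is_idealD(2)[OF M _ that] by blast
      qed
      assume ab: "a - b \<in> M"
      moreover have "b - a \<in> M" using is_idealD(5)[OF M ab] by simp
      ultimately show "?p a = ?p b" using sub by blast
    qed
  qed
  moreover have "?p 0 = \<zero>\<^bsub>poly_ring Quot M\<^esub>" by (simp add: FactRing_def a_r_coset_def r_coset_def)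
  ultimately show ?thesis
    using M ring_hom_mult[OF hom] ring_hom_add[OF hom] ring_hom_one[OF hom]
    by (intro quotient_presentation.intro quotient_presentation_axioms.intro) simp_all
qed

lemma genideal_poly_ring_least:
  "Idl\<^bsub>poly_ring\<^esub> S = \<Inter>{I. is_ideal I \<and> S \<subseteq> I}" for S :: "('v, 'k::field) mpoly set"
  by (simp add: genideal_def ideal_poly_ring_iff)

lemma monomial_ideal_mon_span:
  fixes M :: "('v, 'k::field) mpoly set"
  assumes "monomial_ideal M"
  shows "upset {a. (xmon a :: ('v, 'k) mpoly) \<in> M}" "M = mon_span {a. xmon a \<in> M}" "is_ideal M"
proof -
  obtain A where A: "M = Idl\<^bsub>poly_ring\<^esub> (xmon ` A)" using assms by (auto simp: monomial_ideal_def)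
  have M: "is_ideal M"
    using ring.genideal_ideal[OF cring.axioms(1)[OF cring_poly_ring], of "xmon ` A"]
    by (simp add: A ideal_poly_ring_iff)
  then show "is_ideal M" .
  show up: "upset {a. (xmon a :: ('v, 'k) mpoly) \<in> M}"
    using is_idealD(4)[OF M] by (auto simp: upset_def xmon_add)
  show "M = mon_span {a. xmon a \<in> M}"
  proof
    have "is_ideal (mon_span {a. (xmon a :: ('v, 'k) mpoly) \<in> M})"
      by (rule is_ideal_mon_span[OF up])
    moreover have "xmon ` A \<subseteq> mon_span {a. (xmon a :: ('v, 'k) mpoly) \<in> M}"
      by (auto simp: mon_span_def A genideal_poly_ring_least)
    ultimately show "M \<subseteq> mon_span {a. xmon a \<in> M}"
      by (subst A, unfold genideal_poly_ring_least) blast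
    show "mon_span {a. xmon a \<in> M} \<subseteq> M"
    proof
      fix h :: "('v, 'k) mpoly" assume h: "h \<in> mon_span {a. xmon a \<in> M}"
      have "single a (lookup h a) \<in> M" if "a \<in> keys h" for a
        using h that is_idealD(3)[OF M, of "xmon a" "single 0 (lookup h a)"]
        by (auto simp: mon_span_def single_xmon[of a "lookup h a"])
      then show "h \<in> M" by (subst poly_expand) (rule is_ideal_sum[OF M])
    qed
  qed
qed

section \<open>Unmixed generic monomial ideals\<close>

lemma shelled_drop: "shelled Fs \<Longrightarrow> shelled (drop k Fs)"
  by (induction Fs arbitrary: k) (auto simp: drop_Cons split: nat.split)

text \<open>A facet of the intersection of \<open>L\<close> with the earlier complex lies in some
  earlier \<open>K\<close>, hence in a ridge of \<open>L\<close> that belongs to this intersection,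
  and equals the ridge by maximality.\<close>

lemma shellable_of_shelled:
  assumes "shelled Fs" and card: "\<And>F. F \<in> set Fs \<Longrightarrow> finite F \<and> card F = d"
    and \<Delta>: "\<Delta> = {K. \<exists>F\<in>set Fs. K \<subseteq> F}"
  shows "shellable \<Delta>"
proof -
  have "\<Delta> = \<Union>(Pow ` set Fs)" using \<Delta> by auto
  then have fin: "finite \<Delta>" using card by auto
  have facets: "facets \<Delta> = set Fs"
  proof (intro equalityI subsetI)
    fix F assume "F \<in> facets \<Delta>"
    then obtain L where "L \<in> set Fs" "F \<subseteq> L" "L \<in> \<Delta> \<longrightarrow> L = F" by (auto simp: facets_def \<Delta>)
    then show "F \<in> set Fs" by (auto simp: \<Delta>)
  next
    fix F assume F: "F \<in> set Fs"
    have "G = F" if "G \<in> \<Delta>" "F \<subseteq> G" for G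
    proof -
      obtain L where L: "L \<in> set Fs" "G \<subseteq> L" using \<open>G \<in> \<Delta>\<close> by (auto simp: \<Delta>)
      then have "F = L" using card[OF F] card[OF L(1)] that(2) by (intro card_subset_eq) auto
      then show ?thesis using that L by auto
    qed
    then show "F \<in> facets \<Delta>" using F by (auto simp: facets_def \<Delta>)
  qed
  have notin: "L \<notin> set Ls" if "shelled (L # Ls)" for L Ls using that by auto
  have dist: "distinct Fs" using assms(1) by (induction Fs) (use notin in auto)
  have step: "card G + 1 = card (rev Fs ! j)"
    if j: "0 < j" "j < length (rev Fs)" and G:
      "G \<in> facets (Pow (rev Fs ! j) \<inter> (\<Union>i<j. Pow (rev Fs ! i)))" for j G
  proof -
    \<comment> \<open>The newest facet comes first in \<open>Fs\<close>, so the facets before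
      position \<open>j\<close> of \<open>rev Fs\<close> are those after position \<open>k\<close>
      of \<open>Fs\<close>.\<close>
    define k where "k = length Fs - Suc j"
    define L where "L = rev Fs ! j"
    have k: "k < length Fs" "L = Fs ! k" using j by (auto simp: k_def L_def rev_nth)
    have sh: "shelled (L # drop (Suc k) Fs)"
      using shelled_drop[OF assms(1), of k] k by (simp add: Cons_nth_drop_Suc)
    have "(\<Union>i<j. Pow (rev Fs ! i)) = \<Union>(Pow ` ((!) (rev Fs) ` {0..<j}))"
      by (auto simp: lessThan_atLeast0)
    also have "(!) (rev Fs) ` {0..<j} = set (take j (rev Fs))" using j by (intro nth_image) simp
    also have "\<dots> = set (drop (Suc k) Fs)" using j by (simp add: take_rev k_def Suc_diff_Suc)
    finally have un: "(\<Union>i<j. Pow (rev Fs ! i)) = \<Union>(Pow ` set (drop (Suc k) Fs))" .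
    have G': "G \<in> facets (Pow L \<inter> \<Union>(Pow ` set (drop (Suc k) Fs)))" using G by (simp add: un L_def)
    then obtain K where K: "G \<subseteq> L" "K \<in> set (drop (Suc k) Fs)" "G \<subseteq> K" by (auto simp: facets_def)
    obtain v K' where v: "v \<in> L" "v \<notin> K" "K' \<in> set (drop (Suc k) Fs)" "L - {v} \<subseteq> K'"
      using sh K(2) by auto
    have "L - {v} \<in> Pow L \<inter> \<Union>(Pow ` set (drop (Suc k) Fs))" using v by auto
    moreover have "G \<subseteq> L - {v}" using K v by auto
    moreover have "\<And>H. H \<in> Pow L \<inter> \<Union>(Pow ` set (drop (Suc k) Fs)) \<Longrightarrow> G \<subseteq> H \<Longrightarrow> H = G"
      using G' unfolding facets_def by simp
    ultimately have "G = L - {v}" by metis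
    moreover have "finite L" using k card[of L] by auto
    ultimately show ?thesis using v(1) card_Suc_Diff1[of L v] by (simp add: L_def)
  qed
  have "simplicial_complex \<Delta>"
    unfolding simplicial_complex_def using fin card by (auto simp: \<Delta> intro: finite_subset)
  moreover have "pure_complex \<Delta>" using card by (simp add: pure_complex_def facets)
  moreover have "distinct (rev Fs)" "set (rev Fs) = facets \<Delta>" using dist facets by auto
  ultimately show ?thesis using step unfolding shellable_def by blast
qed

section \<open>Divisibility, least common multiples and leading multiples\<close>

lemma xmon_dvd_iff:
  "(xmon b :: ('v, 'k::field) mpoly) dvd xmon a \<longleftrightarrow> (\<forall>s. lookup b s \<le> lookup a s)"
proof
  assume "(xmon b :: ('v, 'k) mpoly) dvd xmon a"
  then obtain h :: "('v, 'k) mpoly" where h: "xmon a = xmon b * h" by (elim dvdE)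
  have "a \<in> keys (xmon a :: ('v, 'k) mpoly)" by simp
  then obtain c where "a = b + c" unfolding h keys_xmon_mult by blast
  then show "\<forall>s. lookup b s \<le> lookup a s" by (simp add: lookup_add)
next
  assume "\<forall>s. lookup b s \<le> lookup a s"
  then have "b + (a - b) = a" by (intro exp_diff_add) simp
  then have "(xmon a :: ('v, 'k) mpoly) = xmon b * xmon (a - b)" by (metis xmon_add)
  then show "(xmon b :: ('v, 'k) mpoly) dvd xmon a" by simp
qed

lemma min_gens_eq: "min_gens M = mins {a. xmon a \<in> M}"
  by (auto simp: min_gens_def mins_def xmon_dvd_iff)

lemma lookup_mon_lcm: "lookup (mon_lcm \<sigma>) s = Max (insert 0 ((\<lambda>a. lookup a s) ` \<sigma>))"
  by (simp add: mon_lcm_def)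

lemma mon_lcm_le_iff: "finite \<sigma> \<Longrightarrow> lookup (mon_lcm \<sigma>) s \<le> k \<longleftrightarrow> (\<forall>a\<in>\<sigma>. lookup a s \<le> k)"
  by (simp add: lookup_mon_lcm)

lemma mon_lcm_ge: "finite \<sigma> \<Longrightarrow> a \<in> \<sigma> \<Longrightarrow> lookup a s \<le> lookup (mon_lcm \<sigma>) s"
  using mon_lcm_le_iff by blast

lemma mon_lcm_attained:
  assumes "finite \<sigma>" "0 < lookup (mon_lcm \<sigma>) s"
  shows "\<exists>a\<in>\<sigma>. lookup a s = lookup (mon_lcm \<sigma>) s"
proof -
  have "Max (insert 0 ((\<lambda>a. lookup a s) ` \<sigma>)) \<in> insert 0 ((\<lambda>a. lookup a s) ` \<sigma>)"
    using assms(1) by (intro Max_in) auto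
  then show ?thesis using assms(2) unfolding lookup_mon_lcm by auto
qed

lemma mon_lcm_pair: "lookup (mon_lcm {a, b}) s = max (lookup a s) (lookup b s)"
  by (simp add: lookup_mon_lcm)

lemma prime_contains_variable:
  fixes P :: "('v::finite, 'k::field) mpoly set"
  assumes "is_prime P" "xmon a \<in> P"
  shows "\<exists>s\<in>keys a. xmon (single s 1) \<in> P"
  using assms(2)
proof (induction "tot a" arbitrary: a)
  case 0
  then have "a = 0" by (intro poly_mapping_eqI) (simp add: tot_def)
  then show ?case using 0 assms(1) by (simp add: is_prime_def)
next
  case (Suc n)
  have "a \<noteq> 0" using Suc.hyps(2) by (auto simp: tot_def)
  then obtain s where s: "s \<in> keys a" by (metis ex_in_conv keys_eq_empty)
  define b where "b = a - single s 1"
  have ab: "a = single s 1 + b"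
    unfolding b_def
      by (rule exp_diff_add[symmetric]) (use s in \<open>auto simp: lookup_single when_def in_keys_iff\<close>)
  have "tot a = Suc (tot b)"
    by (subst ab) (simp add: tot_def lookup_add sum.distrib lookup_single when_def)
  then have "n = tot b" using Suc.hyps(2) by simp
  have "xmon (single s 1) * xmon b \<in> P" using Suc.prems ab by (metis xmon_add)
  then have "xmon (single s 1) \<in> P \<or> xmon b \<in> P" using assms(1) by (auto simp: is_prime_def)
  then show ?case
  proof
    assume "xmon b \<in> P"
    from Suc.hyps(1)[OF \<open>n = tot b\<close> this] show ?thesis
      by (subst ab) (auto simp: keys_exp_add)
  qed (use s in blast)
qed

text \<open>Multiplication by x_s^(N - n), where \<open>n\<close> is the degree of \<open>p\<close>,
  lifts all exponents to at least \<open>D\<close>, where the cap no longer distinguishes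
  them.\<close>

lemma leading_multiple:
  fixes p :: "('v::finite, 'k::field) mpoly"
  assumes "p \<noteq> 0" "p \<in> polys_in {s}"
  shows "\<exists>n. \<forall>N\<ge>n + D. \<exists>q. leads D (q * p) (single s N)"
proof -
  define n where "n = Max ((\<lambda>a. lookup a s) ` keys p)"
  have "n \<in> (\<lambda>a. lookup a s) ` keys p" unfolding n_def using assms(1) by (intro Max_in) auto
  then obtain a0 where a0: "a0 \<in> keys p" "lookup a0 s = n" by auto
  have sgl: "a = single s (lookup a s)" if "a \<in> keys p" for a
  proof (rule poly_mapping_eqI)
    fix t
    show "lookup a t = lookup (single s (lookup a s)) t"
    proof (cases "t = s")
      case False
      then have "t \<notin> keys a" using assms(2) that by (auto simp: polys_in_def)
      then show ?thesis using False by (simp add: in_keys_iff lookup_single when_def)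
    qed simp
  qed
  have mx: "lookup a s \<le> n" if "a \<in> keys p" for a unfolding n_def using that by (intro Max_ge) auto
  have nz: "lookup p (single s n) \<noteq> 0" using a0 sgl[OF a0(1)] by (simp add: in_keys_iff)
  have "leads D (single (single s (N - n)) (1 / lookup p (single s n)) * p) (single s N)"
    if N: "n + D \<le> N" for N
  proof -
    let ?k = "1 / lookup p (single s n)"
    have eq: "single (single s (N - n)) ?k * p = single 0 ?k * (xmon (single s (N - n)) * p)"
      by (subst single_xmon) (simp add: mult.assoc)
    have sN: "single s N = single s (N - n) + single s n" using N by (simp flip: single_add)
    show ?thesis
      unfolding leads_def
    proof (intro conjI ballI)
      show "lookup (single (single s (N - n)) ?k * p) (single s N) = 1"
        unfolding eq lookup_const_mult sN lookup_xmon_mult using nz by simp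
      fix a assume "a \<in> keys (single (single s (N - n)) ?k * p)"
      then have "a \<in> keys (xmon (single s (N - n)) * p)"
        unfolding eq by (auto simp: in_keys_iff lookup_const_mult)
      then obtain b where b: "b \<in> keys p" "a = single s (N - n) + b" unfolding keys_xmon_mult
        by auto
      have la: "lookup a t = (if t = s then N - n + lookup b s else 0)" for t
        using arg_cong[OF sgl[OF b(1)], of "\<lambda>x. lookup x t"]
        by (auto simp: b(2) lookup_add lookup_single when_def)
      show "\<forall>t. lookup a t \<le> lookup (single s N) t"
        using mx[OF b(1)] N by (auto simp: la lookup_single when_def)
      show "same_cap D a (single s N)"
        using N by (auto simp: same_cap_def la lookup_single when_def)
    qed
  qed
  then show ?thesis by blast
qed

text \<open>Shelled complexes are connected through ridges: each new facet is adjacent to an earlier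
  one.\<close>

lemma shelled_constant:
  assumes "shelled Ls"
    and "\<And>L K v. L \<in> set Ls \<Longrightarrow> K \<in> set Ls \<Longrightarrow> L \<noteq> K \<Longrightarrow> L - {v} \<subseteq> K \<Longrightarrow> f L = f K"
  shows "\<exists>d. \<forall>L\<in>set Ls. f L = d"
  using assms
proof (induction Ls)
  case (Cons L Ls)
  then obtain d where d: "\<forall>K\<in>set Ls. f K = d" by auto
  show ?case
  proof (cases "Ls = []")
    case False
    then obtain K where "K \<in> set Ls" by fastforce
    then obtain v K' where K': "K' \<in> set Ls" "L - {v} \<subseteq> K'" using Cons.prems(1) by auto
    have "L \<notin> set Ls" using Cons.prems(1) by auto
    then have "f L = f K'" using Cons.prems(2)[of L K' v] K' by auto
    then show ?thesis using d K'(1) by auto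
  qed auto
qed simp

section \<open>The staircase of an unmixed generic ideal\<close>

locale unmixed_generic =
  fixes M :: "('v::finite, 'k::field) mpoly set"
  assumes mono: "monomial_ideal M" and gen: "generic M"
    and unmixed: "embedded_primes poly_ring M = {}"
begin

definition E :: "('v \<Rightarrow>\<^sub>0 nat) set" where "E = {a. (xmon a :: ('v, 'k) mpoly) \<in> M}"

text \<open>Strictly above the exponents of all minimal generators, so that no power x_s^D ties with
  one of them.\<close>

definition D :: nat where
  "D = Suc (Max (insert 0 ((\<lambda>(a, s). lookup a s) ` (min_gens M \<times> UNIV))))"

fun deg :: "('v \<Rightarrow>\<^sub>0 nat) + 'v \<Rightarrow> 'v \<Rightarrow> nat" where
  "deg (Inl a) j = lookup a j"
| "deg (Inr s) j = (if j = s then D else 0)"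

definition G :: "(('v \<Rightarrow>\<^sub>0 nat) + 'v) set" where "G = Inl ` min_gens M \<union> range Inr"

lemma M_eq: "M = mon_span E" and M_ideal: "is_ideal M" and up: "upset E"
  using monomial_ideal_mon_span[OF mono] by (simp_all add: E_def)

lemma min_gens_mins: "min_gens M = mins E"
  by (simp add: min_gens_eq E_def)

lemma finite_min_gens: "finite (min_gens M)"
  by (simp add: min_gens_mins finite_mins)

lemma deg_less_D: "a \<in> min_gens M \<Longrightarrow> lookup a s < D"
  unfolding D_def less_Suc_eq_le by (rule Max_ge) (use finite_min_gens in force)+

lemma E_iff: "a \<in> E \<longleftrightarrow> (\<exists>g\<in>min_gens M. \<forall>s. lookup g s \<le> lookup a s)"
proof
  assume "\<exists>g\<in>min_gens M. \<forall>s. lookup g s \<le> lookup a s"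
  then obtain g where g: "g \<in> min_gens M" "\<And>s. lookup g s \<le> lookup a s" by auto
  then have "g \<in> E" by (auto simp: min_gens_mins mins_def)
  then have "g + (a - g) \<in> E" using up by (auto simp: upset_def)
  then show "a \<in> E" using exp_diff_add[of g a] g(2) by simp
qed (use mins_below in \<open>auto simp: min_gens_mins\<close>)

sublocale staircase G deg
proof
  show "finite G" using finite_min_gens by (simp add: G_def)
  show "\<exists>a\<in>G. \<forall>j. j \<noteq> s \<longrightarrow> deg a j = 0" for s
    by (rule bexI[of _ "Inr s"]) (auto simp: G_def)
  fix x y s assume xy: "x \<in> G" "y \<in> G" "x \<noteq> y" "deg x s = deg y s" "0 < deg x s"
  show "\<exists>c\<in>G. \<forall>j. deg c j < max (deg x j) (deg y j) \<or> deg c j = 0"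
  proof (cases "\<exists>a b. x = Inl a \<and> y = Inl b")
    case True
    then obtain a b where ab: "x = Inl a" "y = Inl b" "a \<in> min_gens M" "b \<in> min_gens M" "a \<noteq> b"
      using xy by (auto simp: G_def)
    then have "\<exists>s. lookup a s = lookup b s \<and> 0 < lookup a s" using xy by auto
    with gen ab obtain c where c: "c \<in> min_gens M"
      "(xmon c :: ('v, 'k) mpoly) dvd xmon (mon_lcm {a, b})"
      "keys (mon_lcm {a, b} - c) = keys (mon_lcm {a, b})"
      unfolding generic_def by blast
    \<comment> \<open>Equal supports of the lcm and its quotient by \<open>c\<close> mean that
      \<open>c\<close> is strictly smaller wherever the lcm is positive.\<close>
    have "lookup c j < max (lookup a j) (lookup b j) \<or> lookup c j = 0" for j
    proof (cases "j \<in> keys (mon_lcm {a, b})")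
      case True
      then have "j \<in> keys (mon_lcm {a, b} - c)" using c(3) by simp
      then show ?thesis
        by (simp add: in_keys_iff lookup_minus mon_lcm_pair not_le less_max_iff_disj)
    next
      case False
      moreover have "lookup c j \<le> lookup (mon_lcm {a, b}) j" using c(2) by (simp add: xmon_dvd_iff)
      ultimately show ?thesis by (simp add: in_keys_iff)
    qed
    then show ?thesis using c(1) ab by (intro bexI[of _ "Inl c"]) (auto simp: G_def)
  next
    case False
    have False
    proof (cases x)
      case x: (Inl a)
      then obtain t where t: "y = Inr t" using False by (cases y) auto
      have "lookup a s < D" using xy(1) x by (auto simp: G_def intro: deg_less_D)
      then show ?thesis using xy x t by (auto split: if_splits)
    next
      case x: (Inr t)
      show ?thesis
      proof (cases y)
        case y: (Inl b)
        have "lookup b s < D" using xy(2) y by (auto simp: G_def intro: deg_less_D)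
        then show ?thesis using xy x y by (auto split: if_splits)
      next
        case y: (Inr t')
        then show ?thesis using xy x by (auto split: if_splits)
      qed
    qed
    then show ?thesis ..
  qed
qed

definition sup_face :: "('v \<Rightarrow> nat) \<Rightarrow> 'v set" where
  "sup_face u = {s. u s = D}"

lemma Inl_in_G [simp]: "Inl a \<in> G \<longleftrightarrow> a \<in> min_gens M" and Inr_in_G [simp]: "Inr s \<in> G"
  by (auto simp: G_def)

lemma D_pos: "0 < D"
  by (simp add: D_def)

lemma corner_le_D:
  assumes "corner u" shows "u s \<le> D"
proof -
  have "deg x s \<le> D" if "x \<in> G" for x
    using that deg_less_D[of _ s] by (cases x) (auto simp: G_def intro: less_imp_le)
  from this[OF champ(1)[OF assms, of s]] show ?thesis using champ(2)[OF assms, of s] by simp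
qed

lemma Inr_face: "corner u \<Longrightarrow> Inr -` face u = sup_face u"
  using corner_le_D[of u] by (auto simp: face_def sup_face_def intro: antisym)

lemma Inl_face: "Inl -` face u = {a \<in> min_gens M. \<forall>s. lookup a s \<le> u s}"
  by (auto simp: face_def)

text \<open>A decomposition of \<open>M\<close> into irreducible ideals, one for each corner. A
  coordinate \<open>u j = D\<close> stands for infinity, and the cap \<open>D - 1\<close> removes
  the condition there.\<close>

lemma not_E_iff: "a \<notin> E \<longleftrightarrow> (\<exists>u. corner u \<and> (\<forall>j. min (lookup a j) (D - 1) < u j))"
proof
  assume a: "a \<notin> E"
  show "\<exists>u. corner u \<and> (\<forall>j. min (lookup a j) (D - 1) < u j)"
  proof (rule corner_above)
    fix x assume x: "x \<in> G"
    show "\<exists>j. min (lookup a j) (D - 1) < deg x j"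
    proof (cases x)
      case (Inl g)
      then have "g \<in> min_gens M" using x by (auto simp: G_def)
      then obtain j where "lookup a j < lookup g j" using a E_iff[of a] by (auto simp: not_le)
      then show ?thesis using Inl by (intro exI[of _ j]) auto
    next
      case (Inr s)
      then show ?thesis using D_pos by (intro exI[of _ s]) auto
    qed
  qed
next
  assume "\<exists>u. corner u \<and> (\<forall>j. min (lookup a j) (D - 1) < u j)"
  then obtain u where u: "corner u" "\<And>j. min (lookup a j) (D - 1) < u j" by auto
  show "a \<notin> E"
  proof
    assume "a \<in> E"
    then obtain g where g: "g \<in> min_gens M" "\<And>s. lookup g s \<le> lookup a s" using E_iff by auto
    have "deg (Inl g) j < u j" for j
      using deg_less_D[OF g(1), of j] g(2)[of j] u(2)[of j] by (simp add: min_def split: if_splits)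
    moreover have "Inl g \<in> G" using g by (simp add: G_def)
    ultimately show False using corner_hit[OF u(1)] by (meson leD)
  qed
qed

lemma same_cap_E: "same_cap D a a' \<Longrightarrow> a \<in> E \<longleftrightarrow> a' \<in> E"
proof -
  have "a' \<in> E" if cap: "same_cap D a a'" and a: "a \<in> E" for a a'
  proof -
    obtain g where g: "g \<in> min_gens M" "\<And>s. lookup g s \<le> lookup a s" using a E_iff by auto
    have "lookup g s \<le> lookup a' s" for s
    proof -
      have "min (lookup a s) D = min (lookup a' s) D" using cap by (simp add: same_cap_def)
      then show ?thesis using g(2)[of s] deg_less_D[OF g(1), of s] by linarith
    qed
    then show ?thesis using g(1) E_iff by blast
  qed
  moreover assume "same_cap D a a'"
  moreover from this have "same_cap D a' a" by (simp add: same_cap_def)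
  ultimately show ?thesis by blast
qed

text \<open>On \<open>K\<close> the exponents reach the cap \<open>D - 1\<close>, which is below
  \<open>u j\<close> only if \<open>u j = D\<close>.\<close>

lemma thick_not_E_iff:
  assumes "D \<le> N"
  shows "b + stretch N (indic K) \<notin> E \<longleftrightarrow>
    (\<exists>u. corner u \<and> (\<forall>j. min (lookup b j) (D - 1) < u j) \<and> K \<subseteq> sup_face u)"
proof -
  have "(\<forall>j. min (lookup (b + stretch N (indic K)) j) (D - 1) < u j) \<longleftrightarrow>
      (\<forall>j. min (lookup b j) (D - 1) < u j) \<and> K \<subseteq> sup_face u" if u: "corner u" for u
  proof -
    have m: "min (lookup (b + stretch N (indic K)) j) (D - 1) =
        (if j \<in> K then D - 1 else min (lookup b j) (D - 1))" for j
      using assms by (auto simp: lookup_add lookup_indic)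
    have top: "D - 1 < u j \<longleftrightarrow> u j = D" for j using corner_le_D[OF u, of j] D_pos by auto
    have low: "min (lookup b j) (D - 1) < u j" if "u j = D" for j using that D_pos by auto
    show ?thesis
      unfolding m
    proof (intro iffI conjI allI subsetI)
      fix j assume *: "\<forall>j. (if j \<in> K then D - 1 else min (lookup b j) (D - 1)) < u j"
      show "min (lookup b j) (D - 1) < u j"
        using spec[OF *, of j] top[of j] low[of j] by (cases "j \<in> K") auto
      show "j \<in> sup_face u" if "j \<in> K"
        using spec[OF *, of j] top[of j] that by (simp add: sup_face_def)
    next
      fix j assume "(\<forall>j. min (lookup b j) (D - 1) < u j) \<and> K \<subseteq> sup_face u"
      then show "(if j \<in> K then D - 1 else min (lookup b j) (D - 1)) < u j"
        using top[of j] by (auto simp: sup_face_def)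
    qed
  qed
  then show ?thesis unfolding not_E_iff by blast
qed

text \<open>The prime is the colon of \<open>M\<close> by x^(u - 1): a further variable with
  \<open>u s < D\<close> makes the true generator \<open>champ u s\<close> divide, while variables
  in \<open>sup_face u\<close> never lead into \<open>M\<close>.\<close>

lemma sup_face_assoc:
  assumes u: "corner u"
  shows "sqfree {K. K \<inter> - sup_face u \<noteq> {}} \<in> assoc_primes poly_ring M"
proof -
  define v where "v = (Abs_poly_mapping (\<lambda>j. u j - 1) :: 'v \<Rightarrow>\<^sub>0 nat)"
  have vu: "lookup v j < u j" "Suc (lookup v j) = u j" for j
    using corner_pos[OF u, of j] by (auto simp: v_def)
  have "v + b \<in> E \<longleftrightarrow> keys b \<inter> - sup_face u \<noteq> {}" for b
  proof
    assume "v + b \<in> E"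
    then obtain g where g: "g \<in> min_gens M" "\<And>s. lookup g s \<le> lookup (v + b) s" using E_iff by auto
    show "keys b \<inter> - sup_face u \<noteq> {}"
    proof
      assume "keys b \<inter> - sup_face u = {}"
      have "deg (Inl g) j < u j" for j
      proof (cases "j \<in> sup_face u")
        case True
        then show ?thesis using deg_less_D[OF g(1), of j] by (simp add: sup_face_def)
      next
        case False
        then have "j \<notin> keys b" using \<open>keys b \<inter> - sup_face u = {}\<close> by auto
        then show ?thesis using g(2)[of j] vu(1)[of j] by (simp add: lookup_add in_keys_iff)
      qed
      moreover have "Inl g \<in> G" using g by (simp add: G_def)
      ultimately show False using corner_hit[OF u] by (meson leD)
    qed
  next
    assume "keys b \<inter> - sup_face u \<noteq> {}"
    then obtain s where s: "s \<in> keys b" "u s \<noteq> D" by (auto simp: sup_face_def)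
    note c = champ[OF u]
    obtain g where g: "champ u s = Inl g"
    proof (cases "champ u s")
      case (Inr t)
      then have "u s = (if s = t then D else 0)" using c(2)[of s] by simp
      then show ?thesis using s(2) corner_pos[OF u, of s] by (auto split: if_splits)
    qed
    have "g \<in> min_gens M" using c(1)[of s] g by (auto simp: G_def)
    moreover have "lookup g j \<le> lookup (v + b) j" for j
    proof (cases "j = s")
      case True
      have "lookup g s = u s" using c(2)[of s] g by simp
      then show ?thesis using s(1) vu(2)[of s] True by (simp add: lookup_add in_keys_iff)
    next
      case False
      have "lookup g j < u j" using c(3)[OF False] g by simp
      then show ?thesis using vu(2)[of j] by (simp add: lookup_add)
    qed
    ultimately show "v + b \<in> E" using E_iff by blast
  qed
  then have "{b. v + b \<in> E} = {b. keys b \<in> {K. K \<inter> - sup_face u \<noteq> {}}}" by blast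
  moreover have "h * xmon v \<in> M \<longleftrightarrow> h \<in> mon_span {b. v + b \<in> E}" for h
    by (subst M_eq) (simp add: mult.commute[of h] xmon_mult_mon_span)
  ultimately have "sqfree {K. K \<inter> - sup_face u \<noteq> {}} =
      {h \<in> carrier poly_ring. h \<otimes>\<^bsub>poly_ring\<^esub> xmon v \<in> M}" by (simp add: sqfree_def)
  moreover have "primeideal (sqfree {K. K \<inter> - sup_face u \<noteq> {}} :: ('v, 'k) mpoly set) poly_ring"
    by (rule primeideal_poly_ringI[OF is_prime_coordinate])
  moreover have "(xmon v :: ('v, 'k) mpoly) \<in> carrier poly_ring" by simp
  ultimately show ?thesis unfolding assoc_primes_def by blast
qed

lemma sup_face_antichain:
  assumes "corner u" "corner w" "sup_face u \<subseteq> sup_face w"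
  shows "sup_face u = sup_face w"
proof (rule ccontr)
  let ?Q = "\<lambda>u. sqfree {K. K \<inter> - sup_face u \<noteq> {}} :: ('v, 'k) mpoly set"
  assume "sup_face u \<noteq> sup_face w"
  then obtain s where s: "s \<in> sup_face w" "s \<notin> sup_face u" using assms(3) by auto
  have "xmon (single s 1) \<in> ?Q u" "xmon (single s 1) \<notin> ?Q w"
    using s by (auto simp: sqfree_def mon_span_def)
  moreover have "?Q w \<subseteq> ?Q u" using assms(3) by (auto simp: sqfree_def mon_span_def)
  ultimately have "?Q w \<subset> ?Q u" by blast
  then have "?Q u \<in> embedded_primes poly_ring M"
    using sup_face_assoc assms(1,2) unfolding embedded_primes_def by blast
  then show False using unmixed by simp
qed

text \<open>Adjacent faces differ by at most one exchange. Hence the sets of powers are nested, and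
  then equal by the antichain property, or each has exactly one element outside the other.\<close>

lemma card_sup_face_adjacent:
  assumes u: "corner u" and w: "corner w" and "face u \<noteq> face w" "face u - {v} \<subseteq> face w"
  shows "card (sup_face u) = card (sup_face w)"
proof -
  let ?A = "sup_face u" and ?B = "sup_face w"
  have fin: "finite (face u)" "finite (face w)" by (rule finite_face u w)+
  have "card (face u - face w) + card (face u \<inter> face w) = card (face u)"
    using fin by (simp add: card_Diff_subset_Int card_mono)
  moreover have "card (face w - face u) + card (face u \<inter> face w) = card (face w)"
    using fin by (simp add: card_Diff_subset_Int card_mono Int_commute)
  moreover have "card (face u) = card (face w)" using card_face u w by simp
  moreover have "card (face u - face w) \<le> card {v}" using assms(4) by (intro card_mono) auto
  ultimately have le: "card (face u - face w) \<le> 1" "card (face w - face u) \<le> 1" by auto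
  have part: "card (X - Y) \<le> card (L - K)"
    if "X = Inr -` L" "Y = Inr -` K" "finite L" for X Y :: "'v set" and L K ::
      "(('v \<Rightarrow>\<^sub>0 nat) + 'v) set"
    using that by (intro card_inj_on_le[of Inr]) auto
  have "card (?A - ?B) \<le> 1" "card (?B - ?A) \<le> 1"
    using part[of ?A "face u" ?B "face w"] part[of ?B "face w" ?A "face u"] Inr_face u w fin le
      by auto
  show ?thesis
  proof (cases "?A \<subseteq> ?B \<or> ?B \<subseteq> ?A")
    case True
    then show ?thesis using sup_face_antichain[OF u w] sup_face_antichain[OF w u] by auto
  next
    case False
    then have "card (?A - ?B) \<noteq> 0" "card (?B - ?A) \<noteq> 0" by auto
    then have "card (?A - ?B) = card (?B - ?A)"
      using \<open>card (?A - ?B) \<le> 1\<close> \<open>card (?B - ?A) \<le> 1\<close> by linarith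
    moreover have "card (?A - ?B) + card (?A \<inter> ?B) = card ?A"
      "card (?B - ?A) + card (?A \<inter> ?B) = card ?B"
      by (simp_all add: card_Diff_subset_Int card_mono Int_commute)
    ultimately show ?thesis by linarith
  qed
qed

lemma pure: "\<exists>d. \<forall>u. corner u \<longrightarrow> card (sup_face u) = d"
proof -
  obtain Ls where Ls: "set Ls = face ` {u. corner u \<and> (\<forall>j. 0 < u j)}" "shelled Ls"
    using shelled_corners[of "\<lambda>_. 0"] by auto
  have "\<exists>d. \<forall>L\<in>set Ls. card (Inr -` L) = d"
  proof (rule shelled_constant[OF Ls(2)])
    fix L K v assume *: "L \<in> set Ls" "K \<in> set Ls" "L \<noteq> K" "L - {v} \<subseteq> K"
    then obtain u w where "corner u" "corner w" "L = face u" "K = face w" unfolding Ls(1) by blast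
    then show "card (Inr -` L) = card (Inr -` K)" using * card_sup_face_adjacent Inr_face by metis
  qed
  then obtain d where d: "\<And>L. L \<in> set Ls \<Longrightarrow> card (Inr -` L) = d" by blast
  have "card (sup_face u) = d" if "corner u" for u
    using d[of "face u"] Inr_face[OF that] corner_pos[OF that] that unfolding Ls(1) by auto
  then show ?thesis by blast
qed

text \<open>An arbitrary number when \<open>M\<close> is the unit ideal, which has no corners.\<close>

definition d :: nat where "d = (SOME d. \<forall>u. corner u \<longrightarrow> card (sup_face u) = d)"

lemma card_sup_face: "corner u \<Longrightarrow> card (sup_face u) = d"
  using someI_ex[OF pure] unfolding d_def by (elim allE[where x = u]) simp

section \<open>The Stanley-Reisner and Scarf complexes\<close>

lemma shelled_sup_faces:
  "\<exists>Fs. set Fs = sup_face ` {u. corner u \<and> (\<forall>j. b j < u j)} \<and> shelled Fs"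
proof -
  obtain Ls where Ls: "set Ls = face ` {u. corner u \<and> (\<forall>j. b j < u j)}" "shelled Ls"
    using shelled_corners by blast
  have "\<exists>Fs. set Fs = (\<lambda>L. Inr -` L) ` set Ls \<and> shelled Fs"
    by (rule shelled_vimage[OF _ Ls(2), of _ d]) (auto simp: Ls(1) Inr_face card_sup_face)
  moreover have "(\<lambda>L. Inr -` L) ` set Ls = sup_face ` {u. corner u \<and> (\<forall>j. b j < u j)}"
    unfolding Ls(1) image_image by (rule image_cong) (auto simp: Inr_face)
  ultimately show ?thesis by simp
qed

text \<open>Whether \<open>K\<close> is a support set is decided by the monomial with exponent
  \<open>D\<close> on \<open>K\<close>, as \<open>D\<close> exceeds the exponents of the minimal
  generators.\<close>

lemma stanley_reisner_eq: "stanley_reisner_complex M = {K. \<exists>u. corner u \<and> K \<subseteq> sup_face u}"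
proof -
  have "(\<exists>a. (xmon a :: ('v, 'k) mpoly) \<in> M \<and> keys a = K) \<longleftrightarrow> 0 + stretch D (indic K) \<in> E" for K
  proof
    assume "\<exists>a. (xmon a :: ('v, 'k) mpoly) \<in> M \<and> keys a = K"
    then obtain a where a: "a \<in> E" "keys a = K" by (auto simp: E_def)
    then obtain g where g: "g \<in> min_gens M" "\<And>s. lookup g s \<le> lookup a s" using E_iff by auto
    have "lookup g s \<le> lookup (0 + stretch D (indic K)) s" for s
      using deg_less_D[OF g(1), of s] g(2)[of s] a(2) by (auto simp: lookup_indic in_keys_iff)
    then show "0 + stretch D (indic K) \<in> E" using g(1) E_iff by blast
  next
    assume "0 + stretch D (indic K) \<in> E"
    moreover have "keys (0 + stretch D (indic K)) = K"
      using D_pos by (auto simp: in_keys_iff lookup_indic split: if_splits)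
    ultimately show "\<exists>a. (xmon a :: ('v, 'k) mpoly) \<in> M \<and> keys a = K" unfolding E_def by blast
  qed
  moreover have "(\<forall>j. min (lookup (0 :: 'v \<Rightarrow>\<^sub>0 nat) j) (D - 1) < u j)" if "corner u" for u
    using corner_pos[OF that] by simp
  ultimately show ?thesis
    unfolding stanley_reisner_complex_def using thick_not_E_iff[OF order.refl, of 0] by auto
qed

lemma shellable_stanley_reisner: "shellable (stanley_reisner_complex M)"
proof -
  obtain Fs where Fs: "set Fs = sup_face ` {u. corner u \<and> (\<forall>j. 0 < u j)}" "shelled Fs"
    using shelled_sup_faces[of "\<lambda>_. 0"] by auto
  show ?thesis
  proof (rule shellable_of_shelled[OF Fs(2)])
    show "finite F \<and> card F = d" if "F \<in> set Fs" for F using that card_sup_face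
      by (auto simp: Fs(1))
    show "stanley_reisner_complex M = {K. \<exists>F\<in>set Fs. K \<subseteq> F}"
      unfolding stanley_reisner_eq Fs(1) using corner_pos by auto
  qed
qed

lemma mon_lcm_le_corner:
  "\<sigma> \<subseteq> Inl -` face u \<Longrightarrow> lookup (mon_lcm \<sigma>) s \<le> u s"
  using finite_subset[of \<sigma> "min_gens M"] finite_min_gens mon_lcm_le_iff[of \<sigma> s "u s"]
  by (auto simp: Inl_face)

text \<open>Each \<open>a\<close> in the face is the only member that attains \<open>u s\<close> for
  its coordinate \<open>s\<close>, so the lcm reveals whether \<open>a\<close> is present.\<close>

lemma scarf_face_subset:
  assumes u: "corner u" and "\<sigma> \<subseteq> Inl -` face u" "\<tau> \<subseteq> Inl -` face u" "mon_lcm \<sigma> = mon_lcm \<tau>"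
  shows "\<sigma> \<subseteq> \<tau>"
proof
  have fin: "finite \<sigma>" "finite \<tau>" using assms(2,3) finite_min_gens
    by (auto simp: Inl_face intro: finite_subset)
  fix a assume a: "a \<in> \<sigma>"
  then have "Inl a \<in> face u" using assms(2) by auto
  then obtain s where s: "Inl a = champ u s" unfolding face_eq[OF u] by auto
  then have as: "lookup a s = u s" using champ(2)[OF u, of s] by (metis deg.simps(1))
  have eq: "lookup (mon_lcm \<tau>) s = u s"
    using mon_lcm_ge[OF fin(1) a, of s] mon_lcm_le_corner[OF assms(2), of s] as assms(4) by simp
  then obtain b where b: "b \<in> \<tau>" "lookup b s = u s"
    using mon_lcm_attained[OF fin(2), of s] corner_pos[OF u, of s] by auto
  have "Inl b = champ u s" using champ_unique[OF u, of "Inl b" s] b assms(3) by auto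
  then have "a = b" using s by (metis sum.inject(1))
  then show "a \<in> \<tau>" using b(1) by simp
qed

text \<open>If a Scarf face were below no corner, some generator \<open>c\<close> would be strictly
  below its lcm wherever that is positive. Adding or removing \<open>c\<close> would leave the lcm
  unchanged, contrary to uniqueness.\<close>

lemma scarf_eq: "scarf_complex M = {\<sigma>. \<exists>u. corner u \<and> \<sigma> \<subseteq> Inl -` face u}"
proof (intro equalityI subsetI)
  fix \<sigma> assume "\<sigma> \<in> {\<sigma>. \<exists>u. corner u \<and> \<sigma> \<subseteq> Inl -` face u}"
  then obtain u where u: "corner u" "\<sigma> \<subseteq> Inl -` face u" by auto
  have "\<tau> = \<sigma>" if \<tau>: "\<tau> \<subseteq> min_gens M" "mon_lcm \<tau> = mon_lcm \<sigma>" for \<tau>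
  proof -
    have "finite \<tau>" using \<tau>(1) finite_min_gens finite_subset by blast
    then have "lookup a s \<le> u s" if "a \<in> \<tau>" for a s
      using mon_lcm_ge[of \<tau> a s] mon_lcm_le_corner[OF u(2), of s] \<tau>(2) that by simp
    then have "\<tau> \<subseteq> Inl -` face u" using \<tau>(1) by (auto simp: Inl_face)
    then show ?thesis using scarf_face_subset[OF u(1)] u(2) \<tau>(2) by (metis antisym)
  qed
  moreover have "\<sigma> \<subseteq> min_gens M" using u(2) by (auto simp: Inl_face)
  ultimately show "\<sigma> \<in> scarf_complex M" by (auto simp: scarf_complex_def)
next
  fix \<sigma> assume \<sigma>: "\<sigma> \<in> scarf_complex M"
  then have sub: "\<sigma> \<subseteq> min_gens M"
    and uniq: "\<And>\<tau>. \<tau> \<subseteq> min_gens M \<Longrightarrow> mon_lcm \<tau> = mon_lcm \<sigma> \<Longrightarrow> \<tau> = \<sigma>"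
    by (auto simp: scarf_complex_def)
  have fin: "finite \<sigma>" using sub finite_min_gens finite_subset by blast
  \<comment> \<open>Subtraction is truncated: where the lcm has exponent 0, failure of the condition
    means that \<open>c\<close> has exponent 0 too.\<close>
  have "\<exists>u. corner u \<and> (\<forall>j. lookup (mon_lcm \<sigma>) j - 1 < u j)"
  proof (rule corner_above)
    fix x assume x: "x \<in> G"
    show "\<exists>j. lookup (mon_lcm \<sigma>) j - 1 < deg x j"
    proof (cases x)
      case (Inr s)
      have "lookup (mon_lcm \<sigma>) s \<le> D"
        using mon_lcm_le_iff[OF fin, of s D] sub deg_less_D by (auto intro: less_imp_le)
      then show ?thesis using Inr D_pos by (intro exI[of _ s]) auto
    next
      case (Inl c)
      then have c: "c \<in> min_gens M" using x by (auto simp: G_def)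
      show ?thesis
      proof (rule ccontr)
        assume "\<not> ?thesis"
        then have le: "lookup c j \<le> lookup (mon_lcm \<sigma>) j - 1" for j using Inl
          by (simp add: not_less)
        have eq: "mon_lcm (insert c \<sigma>) = mon_lcm (\<sigma> - {c})"
        proof (rule exp_antisym)
          fix j
          show "lookup (mon_lcm (\<sigma> - {c})) j \<le> lookup (mon_lcm (insert c \<sigma>)) j"
            using fin mon_lcm_ge[of "insert c \<sigma>" _ j] by (subst mon_lcm_le_iff) auto
          have "lookup (mon_lcm \<sigma>) j \<le> lookup (mon_lcm (\<sigma> - {c})) j"
          proof (cases "lookup (mon_lcm \<sigma>) j = 0")
            case False
            then obtain a where a: "a \<in> \<sigma>" "lookup a j = lookup (mon_lcm \<sigma>) j"
              using mon_lcm_attained[OF fin, of j] by auto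
            then have "a \<noteq> c" using le[of j] False by auto
            then show ?thesis using mon_lcm_ge[of "\<sigma> - {c}" a j] fin a by auto
          qed simp
          moreover have "lookup (mon_lcm (insert c \<sigma>)) j \<le> lookup (mon_lcm \<sigma>) j"
            using fin mon_lcm_ge[OF fin, of _ j] le[of j] by (subst mon_lcm_le_iff) auto
          ultimately show "lookup (mon_lcm (insert c \<sigma>)) j \<le> lookup (mon_lcm (\<sigma> - {c})) j" by simp
        qed
        show False
        proof (cases "c \<in> \<sigma>")
          case True
          then have "insert c \<sigma> = \<sigma>" by auto
          then show ?thesis using uniq[of "\<sigma> - {c}"] eq sub True by auto
        next
          case False
          then have "\<sigma> - {c} = \<sigma>" by auto
          then show ?thesis using uniq[of "insert c \<sigma>"] eq sub c False by auto
        qed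
      qed
    qed
  qed
  then obtain u where u: "corner u" "\<And>j. lookup (mon_lcm \<sigma>) j - 1 < u j" by auto
  have "lookup a s \<le> u s" if "a \<in> \<sigma>" for a s
    using mon_lcm_ge[OF fin that, of s] u(2)[of s] by simp
  then have "\<sigma> \<subseteq> Inl -` face u" using sub by (auto simp: Inl_face)
  then show "\<sigma> \<in> {\<sigma>. \<exists>u. corner u \<and> \<sigma> \<subseteq> Inl -` face u}" using u(1) by auto
qed

lemma card_Inl_face:
  assumes "corner u" shows "finite (Inl -` face u)" "card (Inl -` face u) = CARD('v) - d"
proof -
  show fin: "finite (Inl -` face u)" using finite_min_gens by (simp add: Inl_face)
  have "face u = (Inl -` face u) <+> (Inr -` face u)"
  proof (intro equalityI subsetI)
    fix x assume "x \<in> face u"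
    then show "x \<in> (Inl -` face u) <+> (Inr -` face u)" by (cases x) auto
  qed auto
  then have "card (face u) = card ((Inl -` face u) <+> (Inr -` face u))" by (rule arg_cong)
  also have "\<dots> = card (Inl -` face u) + card (Inr -` face u)"
    by (rule card_Plus) (simp_all add: fin)
  finally show "card (Inl -` face u) = CARD('v) - d"
    using card_face[OF assms] card_sup_face[OF assms] Inr_face[OF assms] by simp
qed

lemma shellable_scarf: "shellable (scarf_complex M)"
proof -
  obtain Ls where Ls: "set Ls = face ` {u. corner u \<and> (\<forall>j. 0 < u j)}" "shelled Ls"
    using shelled_corners[of "\<lambda>_. 0"] by auto
  have "\<exists>Fs. set Fs = (\<lambda>L. Inl -` L) ` set Ls \<and> shelled Fs"
    by (rule shelled_vimage[OF _ Ls(2), of _ "CARD('v) - d"]) (auto simp: Ls(1) card_Inl_face)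
  then obtain Fs where Fs: "set Fs = (\<lambda>L. Inl -` L) ` set Ls" "shelled Fs" by blast
  show ?thesis
  proof (rule shellable_of_shelled[OF Fs(2)])
    show "finite F \<and> card F = CARD('v) - d" if "F \<in> set Fs" for F
      using that card_Inl_face by (auto simp: Fs(1) Ls(1))
    show "scarf_complex M = {K. \<exists>F\<in>set Fs. K \<subseteq> F}"
      unfolding scarf_eq Fs(1) Ls(1) using corner_pos by auto
  qed
qed

section \<open>Depth and dimension of S/M\<close>

lemma depth_ge:
  assumes P: "is_maximal P"
  shows "\<exists>fs. length fs = d \<and> set fs \<subseteq> P \<and> wreg M fs"
proof -
  have idP: "is_ideal P" using P by (simp add: is_maximal_def)
  have "\<forall>s. \<exists>p n. p \<in> P \<and> (\<forall>N\<ge>n + D. \<exists>q. leads D (q * p) (single s N))"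
    using zariski[OF P] leading_multiple by metis
  then obtain p n where p: "\<And>s. p s \<in> P" "\<And>s N. n s + D \<le> N \<Longrightarrow> \<exists>q. leads D (q * p s) (single s N)"
    by metis
  \<comment> \<open>One exponent that is large enough for every variable.\<close>
  define N where "N = sum n UNIV + D"
  have "n s + D \<le> N" for s unfolding N_def by (auto intro: member_le_sum)
  then have "\<forall>s. \<exists>q. leads D (q * p s) (single s N)" using p(2) by simp
  from choice[OF this] obtain q where q: "\<And>s. leads D (q s * p s) (single s N)" by auto
  define z where "z = (\<lambda>s. q s * p s)"
  have z: "leads D (z s) (single s N)" "z s \<in> P" for s
    using q p(1) is_idealD(3)[OF idP] by (auto simp: z_def)
  have N: "0 < N" "D \<le> N" using D_pos by (auto simp: N_def)
  have "wreg (mon_span E) (map (psubst z) (esyms d))"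
  proof (rule wreg_mon_span[OF N(1) z(1) same_cap_E up])
    fix b :: "'v \<Rightarrow>\<^sub>0 nat"
    let ?b = "\<lambda>j. min (lookup b j) (D - 1)"
    obtain Fs where Fs: "set Fs = sup_face ` {u. corner u \<and> (\<forall>j. ?b j < u j)}" "shelled Fs"
      using shelled_sup_faces[of ?b] by (elim exE conjE)
    \<comment> \<open>Only the support of \<open>c\<close> matters: wherever \<open>c\<close> is
      positive, N c reaches the cap \<open>D\<close>.\<close>
    have "b + stretch N c \<in> E \<longleftrightarrow> (\<forall>F\<in>set Fs. \<not> keys c \<subseteq> F)" for c
    proof -
      have "same_cap D (b + stretch N c) (b + stretch N (indic (keys c)))"
        unfolding same_cap_def
      proof
        fix s
        show "min (lookup (b + stretch N c) s) D = min (lookup (b + stretch N (indic (keys c))) s) D"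
        proof (cases "s \<in> keys c")
          case True
          then have "D * 1 \<le> N * lookup c s" by (intro mult_le_mono N(2)) (simp add: in_keys_iff)
          then have "min (lookup b s + N * lookup c s) D = D" by (intro min_absorb2) linarith
          moreover have "min (lookup b s + N) D = D" using N(2) by (intro min_absorb2) linarith
          ultimately show ?thesis using True by (simp add: lookup_add lookup_indic)
        qed (simp add: lookup_add lookup_indic in_keys_iff)
      qed
      then have "b + stretch N c \<in> E \<longleftrightarrow> b + stretch N (indic (keys c)) \<in> E" by (rule same_cap_E)
      also have "\<dots> \<longleftrightarrow> (\<forall>F\<in>set Fs. \<not> keys c \<subseteq> F)"
        using thick_not_E_iff[OF N(2), of b "keys c"] by (auto simp: Fs(1))
      finally show ?thesis .
    qed
    then have
      "mon_span {c. b + stretch N c \<in> E} = (sqfree {K. \<forall>F\<in>set Fs. \<not> K \<subseteq> F} :: ('v, 'k) mpoly set)"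
      by (simp add: sqfree_def)
    moreover have "card F = d" if "F \<in> set Fs" for F using that card_sup_face by (auto simp: Fs(1))
    ultimately show "wreg (mon_span {c. b + stretch N c \<in> E} :: ('v, 'k) mpoly set) (esyms d)"
      using wreg_shelled[OF Fs(2), of d] by simp
  qed
  then have "wreg M (map (psubst z) (esyms d))" by (subst M_eq)
  \<comment> \<open>All listed symmetric polynomials have positive degree, so each of their terms
    contains some \<open>z s\<close> and lies in \<open>P\<close>.\<close>
  moreover have "psubst z f \<in> P" if "f \<in> set (esyms m)" for f m
    using that
  proof (induction m)
    case (Suc m)
    have "psubst z (esym (Suc m)) \<in> P"
      unfolding esym_def psubst_sum
    proof (rule is_ideal_sum[OF idP])
      fix S :: "'v set" assume "S \<in> {S. card S = Suc m}"
      then obtain s where s: "s \<in> S" by fastforce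
      have "psubst z (xmon (indic S)) = mono_pow z (indic S)" by (simp add: xmon_def psubst_single)
      also have "\<dots> = z s * (\<Prod>t\<in>UNIV - {s}. z t ^ lookup (indic S) t)"
        unfolding mono_pow_def using s by (subst prod.remove[of _ s]) (auto simp: lookup_indic)
      also have "\<dots> \<in> P" by (rule is_idealD(4)[OF idP z(2)])
      finally show "psubst z (xmon (indic S)) \<in> P" .
    qed
    then show ?case using Suc by auto
  qed simp
  ultimately show ?thesis by (intro exI[of _ "map (psubst z) (esyms d)"]) auto
qed

text \<open>No power product of the variables outside the lowest prime lies in \<open>M\<close>. So
  these variables form a subset of some \<open>sup_face u\<close>, and their number bounds the
  length of the chain.\<close>

lemma chain_le:
  assumes "sorted_wrt (\<subset>) (Ps @ [P])" "\<And>R. R \<in> set (Ps @ [P]) \<Longrightarrow> is_prime R \<and> M \<subseteq> R"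
  shows "length Ps \<le> d"
proof -
  define R where "R = hd (Ps @ [P])"
  have "R \<in> set (Ps @ [P])" unfolding R_def by (rule hd_in_set) simp
  then have R: "is_prime R" "M \<subseteq> R" using assms(2) by auto
  have idR: "is_ideal R" using R(1) by (simp add: is_prime_def)
  define A where "A = {s. (xmon (single s 1) :: ('v, 'k) mpoly) \<in> R}"
  have "sqfree {K. K \<inter> A \<noteq> {}} \<subseteq> R"
  proof
    fix h :: "('v, 'k) mpoly" assume h: "h \<in> sqfree {K. K \<inter> A \<noteq> {}}"
    have "single a (lookup h a) \<in> R" if a: "a \<in> keys h" for a
    proof -
      obtain s where s: "s \<in> keys a" "s \<in> A" using h a by (auto simp: sqfree_def mon_span_def)
      have "a = single s 1 + (a - single s 1)"
        by (rule exp_diff_add[symmetric]) (use s in \<open>auto simp: lookup_single when_def in_keys_iff\<close>)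
      then have "single a (lookup h a) = xmon (single s 1) * single (a - single s 1) (lookup h a)"
        by (simp add: xmon_def mult_single)
      then show ?thesis using is_idealD(4)[OF idR] s(2) by (simp add: A_def)
    qed
    then show "h \<in> R" by (subst poly_expand) (rule is_ideal_sum[OF idR])
  qed
  then have "length Ps \<le> card (- A)"
    using prime_chain_length[OF assms(1), of A] assms(2) by (simp add: R_def)
  moreover have "0 + stretch D (indic (- A)) \<notin> E"
  proof
    assume "0 + stretch D (indic (- A)) \<in> E"
    then have "xmon (stretch D (indic (- A))) \<in> R" using R(2) by (auto simp: E_def)
    from prime_contains_variable[OF R(1) this] obtain s
      where s: "s \<in> keys (stretch D (indic (- A)))" "s \<in> A" by (auto simp: A_def)
    then show False by (auto simp: in_keys_iff lookup_indic split: if_splits)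
  qed
  then obtain u where "corner u" "- A \<subseteq> sup_face u" using thick_not_E_iff[OF order.refl, of 0]
    by blast
  then have "card (- A) \<le> d" using card_sup_face card_mono[of "sup_face u" "- A"] by simp
  ultimately show ?thesis by simp
qed

lemma cohen_macaulay: "cohen_macaulay (poly_ring Quot M)"
proof -
  interpret quotient_presentation "poly_ring Quot M" "\<lambda>a. M +>\<^bsub>poly_ring\<^esub> a" M
    by (rule quotient_poly_ring_presentation[OF M_ideal])
  show ?thesis
  proof (rule cohen_macaulayI[of d])
    show "\<exists>fs. length fs = d \<and> set fs \<subseteq> P \<and> wreg M fs" if "is_maximal P" for P
      by (rule depth_ge[OF that])
    show "length Ps \<le> d" if "sorted_wrt (\<subset>) (Ps @ [P])"
      "\<And>R. R \<in> set (Ps @ [P]) \<Longrightarrow> is_prime R \<and> M \<subseteq> R" for Ps P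
      by (rule chain_le[OF that])
  qed (rule hilbert_basis)
qed

end

theorem theorem2p5:
  fixes M :: "('v::finite, 'k::field) mpoly set"
  assumes "monomial_ideal M"
    and "generic M"
    and "embedded_primes poly_ring M = {}"
  shows "cohen_macaulay (poly_ring Quot M) \<and>
         shellable (scarf_complex M) \<and>
         shellable (stanley_reisner_complex M)"
proof -
  interpret unmixed_generic M by (rule unmixed_generic.intro[OF assms])
  show ?thesis using cohen_macaulay shellable_scarf shellable_stanley_reisner by blast
qed

end
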